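(* Assume the following. (1) $C_{pen}\ge 8C_{trace}$, where $C_{trace}>0$ is a constant such that for every $\bar v\in\overline{\mathcal V}$, $v'\in\mathcal V'_{disc}$ and $\Omega_K\in\mathcal M$, each $w\in\{\bar v,v'\}$ satisfies $\|w\|^2_{0,\Gamma_K}\le \frac{C_{trace}}{h_K}\|w\|^2_{0,\Omega_K}$ and $\|\nabla w\cdot\boldsymbol n\|^2_{0,\Gamma_K}\le\frac{C_{trace}}{h_K}|w|^2_{1,\Omega_K}$. (2) On each element $\Omega_K$, $\kappa_{art}=C_{art}\left(\max\left\{\frac{\|\boldsymbol a\|_{0,\infty,\Omega_K}}{h_K},\frac{C_{inv}\kappa}{h_K^2}\right\}\right)^{-1}\|\boldsymbol a\|^2_{0,\infty,\Omega_K}$, where $C_{art}\ge0$ is a constant and $C_{inv}>0$ is a constant such that for every $\bar v\in\overline{\mathcal V}$, $v'\in\mathcal V'_{disc}$ and $\Omega_K\in\mathcal M$, each $w\in\{\bar v,v'\}$ satisfies $|w|^2_{1,\Omega_K}\le\frac{C_{inv}}{h_K^2}\|w\|^2_{0,\Omega_K}$ and $\|\Delta w\|^2_{0,\Omega_K}\le\frac{C_{inv}}{h_K^2}|w|^2_{1,\Omega_K}$. (3) There is a constant $C_{SUPG}>0$, independent of $\boldsymbol a$, $\kappa$ and $h=\max_Kh_K$, such that for every $(\bar v,v')\in\boldsymbol{\mathcal V}^h$ and every $\Omega_K\in\mathcal M$, $$\|\tau_K^{1/2}\boldsymbol a\cdot\nabla(\bar v+v')\|^2_{0,\Omega_K}\le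 C_{SUPG}\left(\kappa_{art}|v'|^2_{1,\Omega_K}+\|\tau_K^{1/2}\mathcal P'_K(\boldsymbol a\cdot\nabla(\bar v+v'))\|^2_{0,\Omega_K}\right).$$ Then there is a constant $\beta_{SUPG}>0$, independent of $\boldsymbol a$, $\kappa$ and $h$, such that $$\inf_{\mathbf 0\ne\mathbf U^h\in\boldsymbol{\mathcal V}^h}\ \sup_{\mathbf 0\ne\mathbf V^h\in\boldsymbol{\mathcal V}^h}\frac{\mathbf B(\mathbf U^h,\mathbf V^h)}{\|\mathbf U^h\|_{SUPG}\,\|\mathbf V^h\|_{SUPG}}\ \ge\ \beta_{SUPG},$$ where for $\mathbf V^h=(\bar v,v')$ $$\|\mathbf V^h\|_{SUPG}^2=\kappa|\bar v|^2_{1,\Omega}+\sum_{K=1}^{n_{el}}\left((\kappa+\kappa_{art})|v'|^2_{1,\Omega_K}+\frac{C_{pen}\kappa}{h_K}\|v'\|^2_{0,\Gamma_K}+\||a_n|^{1/2}v'\|^2_{0,\Gamma_K}\right)+\sum_{K=1}^{n_{el}}\|\tau_K^{1/2}\boldsymbol a\cdot\nabla(\bar v+v')\|^2_{0,\Omega_K}.$$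
   Context: Setting. $\Omega\subset\mathbb R^d$ ($d\in\{2,3\}$) is a bounded polygonal/polyhedral domain, partitioned by a conforming mesh $\mathcal M=\{\Omega_K\}_{K=1}^{n_{el}}$ of simplices or of parallelotopes (affine images of a reference element); $\Gamma_K=\partial\Omega_K$, $\boldsymbol n$ is the unit outward normal on $\Gamma_K$, and $h_K$ is the size (e.g. diameter) of $\Omega_K$. $\boldsymbol a:\Omega\to\mathbb R^d$ is a smooth (up to the boundary) divergence-free velocity field, $\kappa>0$ is a constant diffusivity, $C_{pen}>0$ is a constant, and $\kappa_{art}\ge 0$ is an artificial diffusivity, constant on each element. On $\Gamma_K$, $a_n=\boldsymbol a\cdot\boldsymbol n$ and $a_n^+=\max\{a_n,0\}$. Spaces. $\overline{\mathcal V}\subset H^1_0(\Omega)$ is the space of continuous functions vanishing on $\partial\Omega$ whose restriction to each element is a polynomial of degree $p\ge1$ (simplices) or (the affine image of) a tensor-product polynomial of degree $p$ (parallelotopes). $\mathcal V'_{disc}\subset L^2(\Omega)$ is the space of functions, with no inter-element continuity and no boundary conditions, whose restriction to each element is a polynomial (resp. tensor-product polynomial) of degree $p_f$; $\mathcal V'_{disc,K}$ is the space of its restrictions to $\Omega_K$, and $\mathcal P'_K$ is the $L^2(\Omega_K)$-orthogonal projector onto $\mathcal V'_{disc,K}$. $\boldsymbol{\mathcal V}^h=\overline{\mathcal V}\times\mathcal V'_{disc}$. Norms. $\|\cdot\|_{0,D}$ is the $L^2(D)$ norm, $|v|_{1,D}=\|\nabla v\|_{L^2(D)}$, and $\|\boldsymbol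 a\|_{0,\infty,D}=\operatorname{ess\,sup}_D|\boldsymbol a|$. Moreover $$\tau_K=C_\tau\left(\max\left\{\frac{\|\boldsymbol a\|_{0,\infty,\Omega_K}}{h_K},\frac{C_{inv}\kappa}{h_K^2}\right\}\right)^{-1}$$ with $C_\tau>0$ an arbitrary positive constant. Bilinear form. For $\mathbf U^h=(\bar u,u')$, $\mathbf V^h=(\bar v,v')$ in $\boldsymbol{\mathcal V}^h$, $$\mathbf B(\mathbf U^h,\mathbf V^h)=\bar B(\bar u,\bar v)+\bar C(u',\bar v)+C'(\bar u,v')+B'(u',v'),$$ $$\bar B(\bar u,\bar v)=-\int_\Omega\bar u\,\boldsymbol a\cdot\nabla\bar v+\int_\Omega\kappa\nabla\bar u\cdot\nabla\bar v,\qquad \bar C(u',\bar v)=-\sum_K\int_{\Omega_K}u'\,\boldsymbol a\cdot\nabla\bar v,$$ $$C'(\bar u,v')=\sum_K\int_{\Omega_K}v'\left(\boldsymbol a\cdot\nabla\bar u-\nabla\cdot(\kappa\nabla\bar u)\right),$$ $$B'(u',v')=\sum_K\Big(-\int_{\Omega_K}u'\boldsymbol a\cdot\nabla v'+\int_{\Omega_K}(\kappa+\kappa_{art})\nabla u'\cdot\nabla v'+\int_{\Gamma_K}u'v'a_n^+-\int_{\Gamma_K}\kappa\nabla u'\cdot\boldsymbol n\,v'-\int_{\Gamma_K}u'\kappa\nabla v'\cdot\boldsymbol n+\int_{\Gamma_K}\frac{C_{pen}\kappa}{h_K}u'v'\Big),$$ where derivatives on $\Omega_K$ and traces on $\Gamma_K$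 are taken from inside $\Omega_K$. Convention on constants. "Independent of $\boldsymbol a$, $\kappa$ and $h$" means that the constant may depend only on the fixed data $\Omega$, $d$, $p$, $p_f$, the mesh (shape) regularity, and the constants $C_{trace},C_{inv},C_{pen},C_{art},C_\tau$ (and, for $\beta_{SUPG}$, also $C_{SUPG}$). *)

theory Defs
  imports "HOL-Analysis.Analysis" "HOL-Probability.Essential_Supremum"
begin

text \<open>
  Elements are represented by the closed sets \<open>K\<close> (closures of the open elements of the mesh).
  A function in the continuous space is a function \<open>v\<close> on the whole space that vanishes outside the
  open domain. A function in the discontinuous space is a family \<open>w\<close>: \<open>w K\<close> is the restriction
  to \<open>K\<close>, given as a polynomial function on the whole space, so that its values on the boundary
  of \<open>K\<close> are the traces from inside \<open>K\<close>.
\<close>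

text \<open>
  All derivatives are taken relative to a set \<open>D\<close>. For open \<open>D\<close> and \<open>x \<in> D\<close> these are the usual
  derivatives; for a closed element and \<open>x\<close> on its boundary they are the derivatives from inside.
  A continuous piecewise polynomial \<open>v\<close> is differentiable at almost every point of the domain
  \<open>\<Omega>\<close>, and there \<open>grad \<Omega> v\<close> is its weak gradient.
\<close>

definition grad :: "(real^'n) set \<Rightarrow> (real^'n \<Rightarrow> real) \<Rightarrow> real^'n \<Rightarrow> real^'n" where
  "grad D f x = (\<chi> i. frechet_derivative f (at x within D) (axis i 1))"

definition divg :: "(real^'n) set \<Rightarrow> (real^'n \<Rightarrow> real^'n) \<Rightarrow> real^'n \<Rightarrow> real" where
  "divg D F x = (\<Sum>i\<in>UNIV. grad D (\<lambda>y. F y $ i) x $ i)"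

definition laplacian :: "(real^'n) set \<Rightarrow> (real^'n \<Rightarrow> real) \<Rightarrow> real^'n \<Rightarrow> real" where
  "laplacian D f x = divg D (grad D f) x"

text \<open>
  \<open>Ck_up_to_boundary k D f\<close>, for open \<open>D\<close>: the partial derivatives of \<open>f\<close> of order at most \<open>k\<close>
  exist in \<open>D\<close> and extend continuously to the closure.
\<close>

primrec Ck_up_to_boundary :: "nat \<Rightarrow> (real^'n) set \<Rightarrow> (real^'n \<Rightarrow> real) \<Rightarrow> bool" where
  "Ck_up_to_boundary 0 D f \<longleftrightarrow>
     (\<exists>g. continuous_on (closure D) g \<and> (\<forall>x\<in>D. g x = f x))"
| "Ck_up_to_boundary (Suc k) D f \<longleftrightarrow>
     (\<exists>g. continuous_on (closure D) g \<and> (\<forall>x\<in>D. g x = f x)) \<and>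
     (\<forall>x\<in>D. f differentiable (at x)) \<and>
     (\<forall>i. Ck_up_to_boundary k D (\<lambda>x. grad D f x $ i))"

text \<open>Continuity on the closure fixes the values on the boundary as the continuous extension.\<close>

definition smooth_up_to_boundary :: "(real^'n) set \<Rightarrow> (real^'n \<Rightarrow> real^'n) \<Rightarrow> bool" where
  "smooth_up_to_boundary D F \<longleftrightarrow>
     continuous_on (closure D) F \<and> (\<forall>i k. Ck_up_to_boundary k D (\<lambda>x. F x $ i))"

definition polytopal_domain :: "(real^'n) set \<Rightarrow> bool" where
  "polytopal_domain \<Omega> \<longleftrightarrow>
     open \<Omega> \<and> connected \<Omega> \<and> bounded \<Omega> \<and> \<Omega> \<noteq> {} \<and> interior (closure \<Omega>) = \<Omega> \<and>
     (\<exists>\<P>. finite \<P> \<and> (\<forall>P\<in>\<P>. polytope P) \<and> closure \<Omega> = \<Union>\<P>)"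

datatype element_type = Simplex | Parallelotope

definition reference_element :: "element_type \<Rightarrow> (real^'n) set" where
  "reference_element et =
     (case et of Simplex \<Rightarrow> convex hull (insert 0 Basis) | Parallelotope \<Rightarrow> cbox 0 One)"

definition affine_iso :: "(real^'n \<Rightarrow> real^'n) \<Rightarrow> bool" where
  "affine_iso F \<longleftrightarrow> (\<exists>A b. linear A \<and> inj A \<and> F = (\<lambda>x. A x + b))"

text \<open>\<open>F K\<close> is the affine map from the reference element onto \<open>K\<close>.\<close>

definition conforming_mesh ::
  "element_type \<Rightarrow> (real^'n) set \<Rightarrow> (real^'n) set set \<Rightarrow> ((real^'n) set \<Rightarrow> real^'n \<Rightarrow> real^'n) \<Rightarrow> bool"
where
  "conforming_mesh et \<Omega> M F \<longleftrightarrow>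
     finite M \<and> closure \<Omega> = \<Union>M \<and>
     (\<forall>K\<in>M. affine_iso (F K) \<and> F K ` reference_element et = K) \<and>
     (\<forall>K\<in>M. \<forall>L\<in>M. (K \<inter> L) face_of K \<and> (K \<inter> L) face_of L)"

definition shape_regular :: "real \<Rightarrow> (real^'n) set set \<Rightarrow> bool" where
  "shape_regular \<sigma> M \<longleftrightarrow> (\<forall>K\<in>M. \<exists>c. cball c (diameter K / \<sigma>) \<subseteq> K)"

text \<open>
  \<open>h K\<close> is any measure of the size of \<open>K\<close> that is equivalent to the diameter; \<open>h = diameter\<close>
  is allowed whenever \<open>\<sigma> \<ge> 1\<close>.
\<close>

definition mesh_size :: "real \<Rightarrow> (real^'n) set set \<Rightarrow> ((real^'n) set \<Rightarrow> real) \<Rightarrow> bool" where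
  "mesh_size \<sigma> M h \<longleftrightarrow> (\<forall>K\<in>M. diameter K / \<sigma> \<le> h K \<and> h K \<le> \<sigma> * diameter K)"

definition total_degree_polys :: "nat \<Rightarrow> (real^'n \<Rightarrow> real) set" where
  "total_degree_polys p =
     {q. \<exists>c. q = (\<lambda>x. \<Sum>\<alpha>\<in>{\<alpha>::'n \<Rightarrow> nat. (\<Sum>i\<in>UNIV. \<alpha> i) \<le> p}. c \<alpha> * (\<Prod>i\<in>UNIV. (x $ i) ^ \<alpha> i))}"

definition tensor_polys :: "nat \<Rightarrow> (real^'n \<Rightarrow> real) set" where
  "tensor_polys p =
     {q. \<exists>c. q = (\<lambda>x. \<Sum>\<alpha>\<in>{\<alpha>::'n \<Rightarrow> nat. \<forall>i. \<alpha> i \<le> p}. c \<alpha> * (\<Prod>i\<in>UNIV. (x $ i) ^ \<alpha> i))}"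

text \<open>On a parallelotope, \<open>q\<close> is a tensor-product polynomial in the reference coordinates.\<close>

definition local_polys :: "element_type \<Rightarrow> nat \<Rightarrow> (real^'n \<Rightarrow> real^'n) \<Rightarrow> (real^'n \<Rightarrow> real) set" where
  "local_polys et p FK =
     (case et of Simplex \<Rightarrow> total_degree_polys p | Parallelotope \<Rightarrow> {q. q \<circ> FK \<in> tensor_polys p})"

definition cont_space ::
  "element_type \<Rightarrow> nat \<Rightarrow> (real^'n) set \<Rightarrow> (real^'n) set set \<Rightarrow> ((real^'n) set \<Rightarrow> real^'n \<Rightarrow> real^'n)
     \<Rightarrow> (real^'n \<Rightarrow> real) set" where
  "cont_space et p \<Omega> M F =
     {v. continuous_on (closure \<Omega>) v \<and> (\<forall>x. x \<notin> \<Omega> \<longrightarrow> v x = 0) \<and>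
         (\<forall>K\<in>M. \<exists>q\<in>local_polys et p (F K). \<forall>x\<in>K. v x = q x)}"

definition disc_space ::
  "element_type \<Rightarrow> nat \<Rightarrow> (real^'n) set set \<Rightarrow> ((real^'n) set \<Rightarrow> real^'n \<Rightarrow> real^'n)
     \<Rightarrow> ((real^'n) set \<Rightarrow> real^'n \<Rightarrow> real) set" where
  "disc_space et pf M F =
     {w. (\<forall>K\<in>M. w K \<in> local_polys et pf (F K)) \<and> (\<forall>K. K \<notin> M \<longrightarrow> w K = (\<lambda>_. 0))}"

abbreviation vol_int :: "(real^'n) set \<Rightarrow> (real^'n \<Rightarrow> real) \<Rightarrow> real" where
  "vol_int D f \<equiv> (LINT x:D|lebesgue. f x)"

text \<open>
  Surface integral over a flat facet \<open>E\<close> with unit normal \<open>n\<close>: by Fubini, it is the volume integral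
  over the prism of unit height erected on \<open>E\<close>, of the integrand extended constantly along \<open>n\<close>
  (\<open>closest_point E\<close> maps \<open>x + t *\<^sub>R n\<close> back to \<open>x\<close>).
\<close>

definition facet_int :: "real^'n \<Rightarrow> (real^'n) set \<Rightarrow> (real^'n \<Rightarrow> real) \<Rightarrow> real" where
  "facet_int n E f =
     vol_int {x + t *\<^sub>R n | x t. x \<in> E \<and> 0 \<le> t \<and> t \<le> 1} (\<lambda>y. f (closest_point E y))"

definition outer_normal :: "(real^'n) set \<Rightarrow> (real^'n) set \<Rightarrow> real^'n" where
  "outer_normal K E =
     (THE n. norm n = 1 \<and> (\<exists>b. K \<subseteq> {x. n \<bullet> x \<le> b} \<and> E \<subseteq> {x. n \<bullet> x = b}))"

text \<open>
  Integral over the boundary of a polytope; the first argument of the integrand is the unit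
  outward normal, which is constant on each facet.
\<close>

definition bdry_int :: "(real^'n) set \<Rightarrow> (real^'n \<Rightarrow> real^'n \<Rightarrow> real) \<Rightarrow> real" where
  "bdry_int K g =
     (\<Sum>E | E facet_of K. facet_int (outer_normal K E) E (g (outer_normal K E)))"

definition norm0 :: "(real^'n) set \<Rightarrow> (real^'n \<Rightarrow> real) \<Rightarrow> real" where
  "norm0 D f = sqrt (vol_int D (\<lambda>x. (f x)\<^sup>2))"

definition seminorm1 :: "(real^'n) set \<Rightarrow> (real^'n \<Rightarrow> real) \<Rightarrow> real" where
  "seminorm1 D f = sqrt (vol_int D (\<lambda>x. (norm (grad D f x))\<^sup>2))"

definition norm0_bdry :: "(real^'n) set \<Rightarrow> (real^'n \<Rightarrow> real^'n \<Rightarrow> real) \<Rightarrow> real" where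
  "norm0_bdry K g = sqrt (bdry_int K (\<lambda>n x. (g n x)\<^sup>2))"

definition norm_inf :: "(real^'n) set \<Rightarrow> (real^'n \<Rightarrow> real^'n) \<Rightarrow> real" where
  "norm_inf D a = real_of_ereal (esssup (lebesgue_on D) (\<lambda>x. ereal (norm (a x))))"

definition l2_projector ::
  "(real^'n) set \<Rightarrow> (real^'n \<Rightarrow> real) set \<Rightarrow> (real^'n \<Rightarrow> real) \<Rightarrow> real^'n \<Rightarrow> real" where
  "l2_projector K W f = (THE g. g \<in> W \<and> (\<forall>w\<in>W. vol_int K (\<lambda>x. (f x - g x) * w x) = 0))"

definition time_scale :: "real \<Rightarrow> (real^'n \<Rightarrow> real^'n) \<Rightarrow> real \<Rightarrow> ((real^'n) set \<Rightarrow> real) \<Rightarrow> (real^'n) set \<Rightarrow> real"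
where
  "time_scale Cinv a \<kappa> h K = inverse (max (norm_inf K a / h K) (Cinv * \<kappa> / (h K)\<^sup>2))"

definition form_bar ::
  "(real^'n) set \<Rightarrow> (real^'n \<Rightarrow> real^'n) \<Rightarrow> real \<Rightarrow> (real^'n \<Rightarrow> real) \<Rightarrow> (real^'n \<Rightarrow> real) \<Rightarrow> real"
where
  "form_bar \<Omega> a \<kappa> u v =
     - vol_int \<Omega> (\<lambda>x. u x * (a x \<bullet> grad \<Omega> v x))
     + vol_int \<Omega> (\<lambda>x. \<kappa> * (grad \<Omega> u x \<bullet> grad \<Omega> v x))"

definition form_coupling_bar ::
  "(real^'n) set set \<Rightarrow> (real^'n \<Rightarrow> real^'n) \<Rightarrow> ((real^'n) set \<Rightarrow> real^'n \<Rightarrow> real)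
     \<Rightarrow> (real^'n \<Rightarrow> real) \<Rightarrow> real" where
  "form_coupling_bar M a u' v = - (\<Sum>K\<in>M. vol_int K (\<lambda>x. u' K x * (a x \<bullet> grad K v x)))"

definition form_coupling_prime ::
  "(real^'n) set set \<Rightarrow> (real^'n \<Rightarrow> real^'n) \<Rightarrow> real \<Rightarrow> (real^'n \<Rightarrow> real)
     \<Rightarrow> ((real^'n) set \<Rightarrow> real^'n \<Rightarrow> real) \<Rightarrow> real" where
  "form_coupling_prime M a \<kappa> u v' =
     (\<Sum>K\<in>M. vol_int K (\<lambda>x. v' K x * (a x \<bullet> grad K u x - divg K (\<lambda>y. \<kappa> *\<^sub>R grad K u y) x)))"

definition form_prime ::
  "(real^'n) set set \<Rightarrow> ((real^'n) set \<Rightarrow> real) \<Rightarrow> (real^'n \<Rightarrow> real^'n) \<Rightarrow> real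
     \<Rightarrow> ((real^'n) set \<Rightarrow> real) \<Rightarrow> real
     \<Rightarrow> ((real^'n) set \<Rightarrow> real^'n \<Rightarrow> real) \<Rightarrow> ((real^'n) set \<Rightarrow> real^'n \<Rightarrow> real) \<Rightarrow> real" where
  "form_prime M h a \<kappa> \<kappa>art Cpen u' v' =
     (\<Sum>K\<in>M.
        - vol_int K (\<lambda>x. u' K x * (a x \<bullet> grad K (v' K) x))
        + vol_int K (\<lambda>x. (\<kappa> + \<kappa>art K) * (grad K (u' K) x \<bullet> grad K (v' K) x))
        + bdry_int K (\<lambda>n x. u' K x * v' K x * max (a x \<bullet> n) 0)
        - bdry_int K (\<lambda>n x. \<kappa> * (grad K (u' K) x \<bullet> n) * v' K x)
        - bdry_int K (\<lambda>n x. u' K x * (\<kappa> * (grad K (v' K) x \<bullet> n)))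
        + bdry_int K (\<lambda>n x. Cpen * \<kappa> / h K * u' K x * v' K x))"

definition form_B ::
  "(real^'n) set \<Rightarrow> (real^'n) set set \<Rightarrow> ((real^'n) set \<Rightarrow> real) \<Rightarrow> (real^'n \<Rightarrow> real^'n) \<Rightarrow> real
     \<Rightarrow> ((real^'n) set \<Rightarrow> real) \<Rightarrow> real
     \<Rightarrow> (real^'n \<Rightarrow> real) \<times> ((real^'n) set \<Rightarrow> real^'n \<Rightarrow> real)
     \<Rightarrow> (real^'n \<Rightarrow> real) \<times> ((real^'n) set \<Rightarrow> real^'n \<Rightarrow> real) \<Rightarrow> real" where
  "form_B \<Omega> M h a \<kappa> \<kappa>art Cpen U V =
     form_bar \<Omega> a \<kappa> (fst U) (fst V) + form_coupling_bar M a (snd U) (fst V)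
     + form_coupling_prime M a \<kappa> (fst U) (snd V)
     + form_prime M h a \<kappa> \<kappa>art Cpen (snd U) (snd V)"

definition supg_norm ::
  "(real^'n) set \<Rightarrow> (real^'n) set set \<Rightarrow> ((real^'n) set \<Rightarrow> real) \<Rightarrow> (real^'n \<Rightarrow> real^'n) \<Rightarrow> real
     \<Rightarrow> ((real^'n) set \<Rightarrow> real) \<Rightarrow> real \<Rightarrow> ((real^'n) set \<Rightarrow> real)
     \<Rightarrow> (real^'n \<Rightarrow> real) \<times> ((real^'n) set \<Rightarrow> real^'n \<Rightarrow> real) \<Rightarrow> real" where
  "supg_norm \<Omega> M h a \<kappa> \<kappa>art Cpen \<tau> V = sqrt (
     \<kappa> * (seminorm1 \<Omega> (fst V))\<^sup>2
     + (\<Sum>K\<in>M. (\<kappa> + \<kappa>art K) * (seminorm1 K (snd V K))\<^sup>2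
               + Cpen * \<kappa> / h K * (norm0_bdry K (\<lambda>n. snd V K))\<^sup>2
               + (norm0_bdry K (\<lambda>n x. sqrt \<bar>a x \<bullet> n\<bar> * snd V K x))\<^sup>2)
     + (\<Sum>K\<in>M. (norm0 K (\<lambda>x. sqrt (\<tau> K) * (a x \<bullet> grad K (\<lambda>y. fst V y + snd V K y) x)))\<^sup>2))"

end

theory Submission
  imports Defs
begin

text \<open>
  The bilinear form is coercive for the part of the SUPG norm that does not contain the streamline
  derivative, and a second test function recovers the rest.

  \<^bold>\<open>Coercivity.\<close> Test \<open>B(U, \<cdot>)\<close> with \<open>U = (v, u')\<close> itself. Since \<open>a\<close> is divergence free and \<open>v\<close> vanishes on the
  boundary of the domain, the advective part of the mean form is zero. On an element the
  advective terms in \<open>u'\<close> combine, after integration by parts, to half the boundary integral of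
  \<open>\<bar>a \<bullet> n\<bar> u'\<^sup>2\<close>, and the two coupling terms leave only \<open>- \<kappa> u' \<Delta>v\<close>. Green's formula turns this
  into a gradient product and a boundary flux, which the diffusive terms and the penalty absorb
  because \<open>Cpen \<ge> 8 Ctrace\<close> (\<open>element_coercivity\<close>).

  \<^bold>\<open>Streamline control.\<close> Test with \<open>(0, w)\<close>, where on each element \<open>w = \<tau> P\<close> and \<open>P\<close> is the projection of
  \<open>a \<bullet> \<nabla>(v + u')\<close> to the discontinuous space. The orthogonality of the projection gives the
  square of the norm \<open>S\<close> of \<open>\<surd>\<tau> P\<close>, and every other term is at most a constant times \<open>S\<close> times the
  coercive norm of \<open>U\<close> (\<open>element_test_bound\<close>), because the
  stabilisation parameter \<open>\<tau>\<close> balances the inverse and trace inequalities (\<open>test_function_bounds\<close>).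
  Hence \<open>(v, u' + \<delta> w)\<close>, with a small constant \<open>\<delta>\<close>, controls both parts, and its SUPG norm and that
  of \<open>U\<close> are bounded by the same quantity (\<open>supg_inf_sup_witness\<close>).

  \<^bold>\<open>Integration by parts.\<close> All of this rests on the divergence theorem on elements
  (\<open>gauss_polytope\<close>) and on the domain (\<open>mesh_divergence_zero\<close>). Both come from the fundamental theorem of calculus on
  almost every line in a fixed direction, integrated over all such lines
  (\<open>integral_eq_if_line_integrals_eq\<close>). On an element, a generic line enters and leaves through the
  interior of one facet each, and a boundary integral weighted with \<open>n \<bullet> e\<close> is the volume
  integral over a prism erected on the facet in direction \<open>e\<close> (\<open>facet_int_eq_skew_prism\<close>). On
  the domain, the integrand is the derivative of a continuous function with bounded
  support, so its integral over a line vanishes, and no cancellation between neighbouring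
  elements has to be tracked.
\<close>

section \<open>Integration along parallel lines\<close>

text \<open>
  These functions form a class that is closed under linear combinations and under restriction to
  lines, so that Fubini's theorem and linearity of the integral apply without further integrability conditions.
\<close>

definition bdd_supp_borel :: "('a::euclidean_space \<Rightarrow> real) \<Rightarrow> bool" where
  "bdd_supp_borel f \<longleftrightarrow> f \<in> borel_measurable borel \<and> (\<exists>B. \<forall>x. \<bar>f x\<bar> \<le> B) \<and> bounded {x. f x \<noteq> 0}"

lemma bdd_supp_borel_integrable:
  assumes "bdd_supp_borel f" shows "integrable lborel f"
proof -
  obtain B where m: "f \<in> borel_measurable borel" and B: "\<And>x. \<bar>f x\<bar> \<le> B" and s: "bounded {x. f x \<noteq> 0}"
    using assms by (auto simp: bdd_supp_borel_def)
  obtain a where a: "{x. f x \<noteq> 0} \<subseteq> cbox (-a) a"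
    using bounded_subset_cbox_symmetric[OF s] by blast
  have "integrable lborel (\<lambda>x. indicator (cbox (-a) a) x * B)"
    by (intro integrable_mult_left integrable_real_indicator) (use emeasure_lborel_cbox_finite[of "-a" a] in \<open>auto simp: less_top\<close>)
  then show ?thesis
  proof (rule Bochner_Integration.integrable_bound)
    show "AE x in lborel. norm (f x) \<le> norm (indicator (cbox (-a) a) x * B)"
    proof (rule AE_I2)
      fix x show "norm (f x) \<le> norm (indicator (cbox (-a) a) x * B)"
      proof (cases "f x = 0")
        case False then have "x \<in> cbox (-a) a" using a by blast
        then show ?thesis using B[of x] by simp
      qed simp
    qed
  qed (use m in simp)
qed

lemma bdd_supp_borelI:
  assumes "f \<in> borel_measurable borel" "\<And>x. \<bar>f x\<bar> \<le> B" "bounded S" "\<And>x. x \<notin> S \<Longrightarrow> f x = 0"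
  shows "bdd_supp_borel f"
  unfolding bdd_supp_borel_def using assms
  by (metis (mono_tags, lifting) bounded_subset mem_Collect_eq subsetI)

lemma bdd_supp_borel_add:
  assumes "bdd_supp_borel f" "bdd_supp_borel g" shows "bdd_supp_borel (\<lambda>x. f x + g x)"
proof -
  obtain B C where B: "\<And>x. \<bar>f x\<bar> \<le> B" and C: "\<And>x. \<bar>g x\<bar> \<le> C"
    using assms by (auto simp: bdd_supp_borel_def)
  show ?thesis
  proof (rule bdd_supp_borelI[where B = "B + C" and S = "{x. f x \<noteq> 0} \<union> {x. g x \<noteq> 0}"])
    show "\<bar>f x + g x\<bar> \<le> B + C" for x using B[of x] C[of x] by linarith
  qed (use assms in \<open>auto simp: bdd_supp_borel_def\<close>)
qed

lemma bdd_supp_borel_cmult: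
  assumes "bdd_supp_borel f" shows "bdd_supp_borel (\<lambda>x. c * f x)"
proof -
  obtain B where B: "\<And>x. \<bar>f x\<bar> \<le> B"
    using assms by (auto simp: bdd_supp_borel_def)
  show ?thesis
  proof (rule bdd_supp_borelI[where B = "\<bar>c\<bar> * B" and S = "{x. f x \<noteq> 0}"])
    show "\<bar>c * f x\<bar> \<le> \<bar>c\<bar> * B" for x using B[of x] by (simp add: abs_mult mult_left_mono)
  qed (use assms in \<open>auto simp: bdd_supp_borel_def\<close>)
qed

lemma bdd_supp_borel_sum:
  "finite I \<Longrightarrow> (\<And>i. i \<in> I \<Longrightarrow> bdd_supp_borel (f i)) \<Longrightarrow> bdd_supp_borel (\<lambda>x. \<Sum>i\<in>I. f i x)"
proof (induction I rule: finite_induct)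
  case empty
  then show ?case by (auto simp: bdd_supp_borel_def)
next
  case (insert i I)
  then show ?case by (simp add: bdd_supp_borel_add)
qed

lemma bdd_supp_borel_indicator:
  assumes "compact K" "continuous_on K f"
  shows "bdd_supp_borel (\<lambda>x. indicator K x * f x)"
proof -
  obtain B where B: "\<And>x. x \<in> K \<Longrightarrow> \<bar>f x\<bar> \<le> B"
    using compact_imp_bounded[OF compact_continuous_image[OF assms(2,1)]]
    by (auto simp: bounded_iff)
  show ?thesis
  proof (rule bdd_supp_borelI[where B = "\<bar>B\<bar>" and S = K])
    show "(\<lambda>x. indicator K x * f x) \<in> borel_measurable borel"
      using borel_measurable_continuous_on_indicator[OF _ assms(2)] assms(1)
      by (simp add: borel_compact)
    show "\<bar>indicator K x * f x\<bar> \<le> \<bar>B\<bar>" for x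
      using B[of x] by (cases "x \<in> K") auto
  qed (use assms(1) compact_imp_bounded in auto)
qed

lemma bdd_supp_borel_line:
  assumes f: "bdd_supp_borel f" and e: "e \<noteq> 0"
  shows "bdd_supp_borel (\<lambda>t. f (y + t *\<^sub>R e))"
proof -
  obtain B where m: "f \<in> borel_measurable borel" and B: "\<And>x. \<bar>f x\<bar> \<le> B" and s: "bounded {x. f x \<noteq> 0}"
    using assms by (auto simp: bdd_supp_borel_def)
  obtain R where R: "\<And>x. f x \<noteq> 0 \<Longrightarrow> norm x \<le> R" using s by (auto simp: bounded_iff)
  show ?thesis
  proof (rule bdd_supp_borelI[where B = B and S = "cball 0 ((R + norm y) / norm e)"])
    have "(\<lambda>t. y + t *\<^sub>R e) \<in> borel_measurable borel" by measurable
    then show "(\<lambda>t. f (y + t *\<^sub>R e)) \<in> borel_measurable borel"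
      by (rule measurable_compose[OF _ m])
    fix t :: real assume t: "t \<notin> cball 0 ((R + norm y) / norm e)"
    show "f (y + t *\<^sub>R e) = 0"
    proof (rule ccontr)
      assume "f (y + t *\<^sub>R e) \<noteq> 0"
      then have "norm (y + t *\<^sub>R e) \<le> R" by (rule R)
      moreover have "norm (t *\<^sub>R e) \<le> norm (y + t *\<^sub>R e) + norm y"
        by (metis add_diff_cancel_left' norm_triangle_ineq4)
      ultimately have "\<bar>t\<bar> * norm e \<le> R + norm y" by simp
      then have "\<bar>t\<bar> \<le> (R + norm y) / norm e" using e by (simp add: field_simps)
      then show False using t by simp
    qed
  qed (use B in auto)
qed

text \<open>
  The slab \<open>0 \<le> y \<bullet> e \<le> e \<bullet> e\<close> meets every line in direction \<open>e\<close> in a parameter interval of length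
  one. Weighting the line integrals with its indicator therefore counts every point once, and
  Fubini's theorem needs no coordinates adapted to \<open>e\<close>. The joint integrand has bounded support,
  because a point of the slab from which the support of \<open>f\<close> is reached at parameter \<open>t\<close> bounds \<open>t\<close>.
\<close>

lemma integral_over_lines:
  fixes f :: "'a::euclidean_space \<Rightarrow> real"
  assumes f: "bdd_supp_borel f" and e: "e \<noteq> 0"
  shows "(LINT x|lborel. f x)
       = (LINT y|lborel. indicator {y. 0 \<le> y \<bullet> e \<and> y \<bullet> e \<le> e \<bullet> e} y * (LINT t|lborel. f (y + t *\<^sub>R e)))"
proof -
  define A where "A = {y. 0 \<le> y \<bullet> e \<and> y \<bullet> e \<le> e \<bullet> e}"
  have ee: "e \<bullet> e > 0" using e by simp
  have "closed A" unfolding A_def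
    by (intro closed_Collect_conj closed_Collect_le continuous_intros)
  then have Am: "A \<in> sets borel" by (rule borel_closed)
  obtain B where m: "f \<in> borel_measurable borel" and B: "\<And>x. \<bar>f x\<bar> \<le> B" and s: "bounded {x. f x \<noteq> 0}"
    using f by (auto simp: bdd_supp_borel_def)
  obtain R where R: "\<And>x. f x \<noteq> 0 \<Longrightarrow> norm x \<le> R" using s by (auto simp: bounded_iff)
  \<comment> \<open>A bound for the parameters at which a line through the slab meets the support of \<open>f\<close>.\<close>
  define T where "T = (R * norm e + e \<bullet> e) / (e \<bullet> e)"
  have tbound: "\<bar>t\<bar> \<le> T" if "y \<in> A" "f (y + t *\<^sub>R e) \<noteq> 0" for y t
  proof -
    have "\<bar>(y + t *\<^sub>R e) \<bullet> e\<bar> \<le> norm (y + t *\<^sub>R e) * norm e" by (rule Cauchy_Schwarz_ineq2)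
    also have "\<dots> \<le> R * norm e" using R[OF that(2)] by (simp add: mult_right_mono)
    finally have "\<bar>y \<bullet> e + t * (e \<bullet> e)\<bar> \<le> R * norm e" by (simp add: inner_add_left)
    moreover have "\<bar>y \<bullet> e\<bar> \<le> e \<bullet> e" using that(1) by (auto simp: A_def)
    ultimately have "\<bar>t * (e \<bullet> e)\<bar> \<le> R * norm e + e \<bullet> e" by linarith
    then show ?thesis using ee by (simp add: T_def abs_mult field_simps)
  qed
  have tri: "norm y \<le> R + T * norm e" if "norm (y + t *\<^sub>R e) \<le> R" "\<bar>t\<bar> \<le> T" for y t
  proof -
    have "norm y \<le> norm (y + t *\<^sub>R e) + norm (t *\<^sub>R e)"
      by (metis add_diff_cancel_right' norm_triangle_ineq4)
    also have "\<dots> \<le> R + T * norm e" using that by (simp add: add_mono mult_right_mono)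
    finally show ?thesis .
  qed
  have 1: "bdd_supp_borel (\<lambda>(y, t). indicator A y * f (y + t *\<^sub>R e))"
  proof (rule bdd_supp_borelI[where B = B and S = "cball 0 (R + T * norm e) \<times> cball 0 T"])
    have "(\<lambda>x::'a\<times>real. fst x + snd x *\<^sub>R e) \<in> borel_measurable borel"
      by (intro borel_measurable_continuous_onI continuous_intros)
    then have "(\<lambda>x::'a\<times>real. f (fst x + snd x *\<^sub>R e)) \<in> borel_measurable borel"
      by (rule measurable_compose[OF _ m])
    moreover have "(\<lambda>x::'a\<times>real. indicator A (fst x) :: real) \<in> borel_measurable borel"
      using Am by (intro measurable_compose[OF _ borel_measurable_indicator]) 
         (auto intro!: borel_measurable_continuous_onI continuous_intros)
    ultimately show "(\<lambda>(y, t). indicator A y * f (y + t *\<^sub>R e)) \<in> borel_measurable borel"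
      by (simp add: case_prod_beta)
    show "\<bar>case x of (y, t) \<Rightarrow> indicator A y * f (y + t *\<^sub>R e)\<bar> \<le> B" for x
      using B[of "fst x + snd x *\<^sub>R e"] B[of 0] by (auto simp: case_prod_beta indicator_def)
    show "(case x of (y, t) \<Rightarrow> indicator A y * f (y + t *\<^sub>R e)) = 0"
      if "x \<notin> cball 0 (R + T * norm e) \<times> cball 0 T" for x
      using that tbound[of "fst x" "snd x"] tri[of "fst x" "snd x"] R[of "fst x + snd x *\<^sub>R e"]
      by (cases x) (auto simp: indicator_def)
  qed (auto intro: bounded_Times)
  have 2: "bdd_supp_borel (\<lambda>(z, t). indicator A (z - t *\<^sub>R e) * f z)"
  proof (rule bdd_supp_borelI[where B = B and S = "cball 0 R \<times> cball 0 T"])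
    have "(\<lambda>x::'a\<times>real. fst x - snd x *\<^sub>R e) \<in> borel_measurable borel"
      by (intro borel_measurable_continuous_onI continuous_intros)
    then have "(\<lambda>x::'a\<times>real. indicator A (fst x - snd x *\<^sub>R e) :: real) \<in> borel_measurable borel"
      using Am by (intro measurable_compose[OF _ borel_measurable_indicator]) 
    moreover have "(\<lambda>x::'a\<times>real. f (fst x)) \<in> borel_measurable borel"
      by (intro measurable_compose[OF _ m])
         (auto intro!: borel_measurable_continuous_onI continuous_intros)
    ultimately show "(\<lambda>(z, t). indicator A (z - t *\<^sub>R e) * f z) \<in> borel_measurable borel"
      by (simp add: case_prod_beta)
    show "\<bar>case x of (z, t) \<Rightarrow> indicator A (z - t *\<^sub>R e) * f z\<bar> \<le> B" for x
      using B[of "fst x"] B[of 0] by (auto simp: case_prod_beta indicator_def)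
    show "(case x of (z, t) \<Rightarrow> indicator A (z - t *\<^sub>R e) * f z) = 0"
      if "x \<notin> cball 0 R \<times> cball 0 T" for x
      using that tbound[of "fst x - snd x *\<^sub>R e" "snd x"] R[of "fst x"]
      by (cases x) (auto simp: indicator_def)
  qed (auto intro: bounded_Times)
  have "(LINT y|lborel. indicator A y * (LINT t|lborel. f (y + t *\<^sub>R e)))
      = (LINT y|lborel. LINT t|lborel. indicator A y * f (y + t *\<^sub>R e))"
    by simp
  also have "\<dots> = (LINT t|lborel. LINT y|lborel. indicator A y * f (y + t *\<^sub>R e))"
    using lborel_pair.Fubini_integral[of "\<lambda>y t. indicator A y * f (y + t *\<^sub>R e)"]
      bdd_supp_borel_integrable[OF 1] by (simp add: lborel_prod case_prod_beta)
  also have "\<dots> = (LINT t|lborel. LINT z|lborel. indicator A (z - t *\<^sub>R e) * f z)"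
  proof (rule Bochner_Integration.integral_cong[OF refl])
    fix t :: real
    have meas: "(\<lambda>z. indicator A (z - t *\<^sub>R e) * f z) \<in> borel_measurable borel"
      using Am m by measurable
    have "(LINT z|lborel. indicator A (z - t *\<^sub>R e) * f z)
        = (LINT z|distr lborel borel ((+) (t *\<^sub>R e)). indicator A (z - t *\<^sub>R e) * f z)"
      by (simp add: lborel_distr_plus)
    also have "\<dots> = (LINT y|lborel. indicator A (t *\<^sub>R e + y - t *\<^sub>R e) * f (t *\<^sub>R e + y))"
      by (rule integral_distr) (use meas in auto)
    finally show "(LINT y|lborel. indicator A y * f (y + t *\<^sub>R e)) 
        = (LINT z|lborel. indicator A (z - t *\<^sub>R e) * f z)"
      by (simp add: add.commute)
  qed
  also have "\<dots> = (LINT z|lborel. LINT t|lborel. indicator A (z - t *\<^sub>R e) * f z)"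
    using lborel_pair.Fubini_integral[of "\<lambda>z t. indicator A (z - t *\<^sub>R e) * f z"]
      bdd_supp_borel_integrable[OF 2] by (simp add: lborel_prod case_prod_beta)
  also have "\<dots> = (LINT z|lborel. f z)"
  proof (rule Bochner_Integration.integral_cong[OF refl])
    fix z :: 'a
    have eq: "indicator A (z - t *\<^sub>R e) = (indicator {z \<bullet> e / (e \<bullet> e) - 1 .. z \<bullet> e / (e \<bullet> e)} t :: real)" for t
      using ee by (auto simp: A_def indicator_def field_simps inner_diff_left)
    show "(LINT t|lborel. indicator A (z - t *\<^sub>R e) * f z) = f z"
      unfolding eq by simp
  qed
  finally show ?thesis by (simp add: A_def)
qed

text \<open>
  This is the form in which Fubini's theorem is used: an identity that holds on almost every line
  in one direction holds for the volume integrals. Almost every is meant with respect to the base point in space.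
\<close>

lemma integral_eq_if_line_integrals_eq:
  fixes f g :: "'a::euclidean_space \<Rightarrow> real"
  assumes f: "bdd_supp_borel f" and g: "bdd_supp_borel g" and e: "e \<noteq> 0"
    and eq: "AE y in lborel. (LINT t|lborel. f (y + t *\<^sub>R e)) = c * (LINT t|lborel. g (y + t *\<^sub>R e))"
  shows "(LINT x|lborel. f x) = c * (LINT x|lborel. g x)"
proof -
  let ?h = "\<lambda>x. f x + - c * g x"
  let ?A = "{y. 0 \<le> y \<bullet> e \<and> y \<bullet> e \<le> e \<bullet> e}"
  have h: "bdd_supp_borel ?h"
    by (intro bdd_supp_borel_add f bdd_supp_borel_cmult g)
  have "AE y in lborel. indicator ?A y * (LINT t|lborel. ?h (y + t *\<^sub>R e)) = 0"
    using eq
  proof eventually_elim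
    case (elim y)
    have "(LINT t|lborel. ?h (y + t *\<^sub>R e))
       = (LINT t|lborel. f (y + t *\<^sub>R e)) + (LINT t|lborel. - c * g (y + t *\<^sub>R e))"
      by (intro Bochner_Integration.integral_add bdd_supp_borel_integrable bdd_supp_borel_cmult bdd_supp_borel_line f g e)
    then show ?case using elim by simp
  qed
  then have "(LINT x|lborel. ?h x) = 0"
    unfolding integral_over_lines[OF h e] by (rule integral_eq_zero_AE)
  moreover have "(LINT x|lborel. ?h x) = (LINT x|lborel. f x) + (LINT x|lborel. - c * g x)"
    by (intro Bochner_Integration.integral_add bdd_supp_borel_integrable bdd_supp_borel_cmult f g)
  ultimately show ?thesis by simp
qed

text \<open>
  The fundamental theorem of calculus as a Lebesgue integral. The finite set \<open>S\<close> will contain the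
  parameters at which a line crosses the boundary of an element.
\<close>

lemma integral_of_derivative_off_finite:
  fixes g h :: "real \<Rightarrow> real"
  assumes h: "bdd_supp_borel h" and ab: "a \<le> b" and S: "finite S"
    and out: "\<And>t. t \<notin> S \<Longrightarrow> t < a \<or> b < t \<Longrightarrow> h t = 0"
    and cont: "continuous_on {a..b} g"
    and deriv: "\<And>t. a < t \<Longrightarrow> t < b \<Longrightarrow> t \<notin> S \<Longrightarrow> (g has_real_derivative h t) (at t)"
  shows "(LINT t|lborel. h t) = g b - g a"
proof -
  have hi: "(h has_integral (LINT t|lborel. h t)) UNIV"
    by (rule has_integral_integral_lborel[OF bdd_supp_borel_integrable[OF h]])
  have "(h has_integral (g b - g a)) {a..b}"
    by (rule fundamental_theorem_of_calculus_interior_strong[OF S ab _ cont])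
       (use deriv in \<open>auto simp: has_real_derivative_iff_has_vector_derivative\<close>)
  then have "((\<lambda>t. if t \<in> {a..b} then h t else 0) has_integral (g b - g a)) UNIV"
    using has_integral_restrict_UNIV[of "{a..b}" h "g b - g a"] by simp
  then have "(h has_integral (g b - g a)) UNIV"
    by (rule has_integral_spike_finite[OF S, rotated]) (use out in auto)
  then show ?thesis using hi has_integral_unique by blast
qed

section \<open>Facets of polytopes and boundary integrals\<close>

lemma vol_int_eq_lborel:
  assumes "compact K" "continuous_on K f"
  shows "vol_int K f = (LINT x|lborel. indicator K x * f x)"
proof -
  have "(\<lambda>x. indicator K x *\<^sub>R f x) \<in> borel_measurable lborel"
    using bdd_supp_borel_indicator[OF assms] by (simp add: bdd_supp_borel_def)
  from integral_completion[OF this] show ?thesis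
    by (simp add: set_lebesgue_integral_def)
qed

definition solid_polytope :: "('a::euclidean_space) set \<Rightarrow> bool" where
  "solid_polytope K \<longleftrightarrow> polytope K \<and> interior K \<noteq> {}"

lemma solid_polytope_compact: "solid_polytope K \<Longrightarrow> compact K"
  by (simp add: solid_polytope_def polytope_imp_compact)

lemma solid_polytope_convex: "solid_polytope K \<Longrightarrow> convex K"
  by (simp add: solid_polytope_def polytope_imp_convex)

lemma solid_polytope_finite_facets: "solid_polytope K \<Longrightarrow> finite {E. E facet_of K}"
  by (simp add: solid_polytope_def finite_polytope_facets)

text \<open>
  For a polytope with interior points the relative boundary, which is the union of the facets, is
  the topological boundary.
\<close>

lemma solid_polytope_boundary: "solid_polytope K \<Longrightarrow> x \<in> K \<Longrightarrow> x \<notin> interior K \<Longrightarrow> \<exists>E. E facet_of K \<and> x \<in> E"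
  using rel_boundary_of_polyhedron[of K] rel_interior_nonempty_interior[of K]
  by (auto simp: solid_polytope_def polytope_imp_polyhedron)

text \<open>
  The right-hand side of the equation of the hyperplane of the facet; every point of the facet gives the same value.
\<close>

definition facet_level :: "(real^'n) set \<Rightarrow> (real^'n) set \<Rightarrow> real" where
  "facet_level K E = outer_normal K E \<bullet> (SOME x. x \<in> E)"

text \<open>
  The affine hull of a facet is a whole hyperplane, so that two unit vectors that define supporting
  hyperplanes through the facet agree up to sign. The interior of \<open>K\<close> fixes the sign. Thus the description that
  defines the outer normal has exactly one solution.
\<close>

lemma facet_normal:
  fixes K :: "(real^'n) set"
  assumes K: "solid_polytope K" and E: "E facet_of K"
  shows "norm (outer_normal K E) = 1"
    and "x \<in> K \<Longrightarrow> outer_normal K E \<bullet> x \<le> facet_level K E"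
    and "E = K \<inter> {x. outer_normal K E \<bullet> x = facet_level K E}"
proof -
  define P where "P n b \<longleftrightarrow> norm n = 1 \<and> K \<subseteq> {x. n \<bullet> x \<le> b} \<and> E \<subseteq> {x. n \<bullet> x = b}" for n b
  have ph: "polyhedron K" using K by (simp add: solid_polytope_def polytope_imp_polyhedron)
  obtain a b where a: "a \<noteq> 0" "K \<subseteq> {x. a \<bullet> x \<le> b}" "E = K \<inter> {x. a \<bullet> x = b}"
    using facet_of_polyhedron[OF ph E] by metis
  define n where "n = a /\<^sub>R norm a"
  define c where "c = b / norm a"
  have na: "norm a > 0" using a by simp
  have n1: "norm n = 1" using na by (simp add: n_def)
  have n0: "n \<noteq> 0" using n1 by auto
  have n2: "K \<subseteq> {x. n \<bullet> x \<le> c}" 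
    using a(2) na by (auto simp: n_def c_def divide_right_mono field_simps)
  have n3: "E = K \<inter> {x. n \<bullet> x = c}" using a(3) na by (auto simp: n_def c_def field_simps)
  have Pn: "P n c" unfolding P_def using n1 n2 n3 by blast
  have ne: "E \<noteq> {}" using E by (auto simp: facet_of_def)
  have aff: "affine hull E = {x. n \<bullet> x = c}"
  proof (rule affine_dim_equal)
    show "affine hull E \<subseteq> {x. n \<bullet> x = c}"
      by (rule hull_minimal) (use n3 in \<open>auto simp: affine_hyperplane\<close>)
    have "aff_dim K = int DIM(real^'n)"
      using K by (simp add: solid_polytope_def aff_dim_nonempty_interior)
    then show "aff_dim (affine hull E) = aff_dim {x. n \<bullet> x = c}"
      using E n0 by (simp add: facet_of_def aff_dim_hyperplane)
  qed (use ne in \<open>auto simp: affine_hyperplane\<close>)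
  have uniq: "n' = n" if P': "P n' c'" for n' c'
  proof -
    have sub: "{x. n \<bullet> x = c} \<subseteq> {x. n' \<bullet> x = c'}"
      unfolding aff[symmetric] by (rule hull_minimal) (use P' in \<open>auto simp: P_def affine_hyperplane\<close>)
    obtain x0 where x0: "x0 \<in> E" using ne by blast
    \<comment> \<open>The component of \<open>n'\<close> tangential to the facet must vanish, since moving along it stays in the hyperplane.\<close>
    define v where "v = n' - (n' \<bullet> n) *\<^sub>R n"
    have nn: "n \<bullet> n = 1" "n' \<bullet> n' = 1" using n1 P' by (auto simp: P_def dot_square_norm)
    have nv: "n \<bullet> v = 0" using nn by (simp add: v_def inner_diff_right inner_commute)
    have "x0 + v \<in> {x. n \<bullet> x = c}" using x0 n3 nv by (simp add: inner_add_right)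
    moreover have "x0 \<in> {x. n \<bullet> x = c}" using x0 n3 by simp
    ultimately have "n' \<bullet> (x0 + v) = c'" "n' \<bullet> x0 = c'" using sub by blast+
    then have n'v: "n' \<bullet> v = 0" by (simp add: inner_add_right)
    have "v \<bullet> v = n' \<bullet> v - (n' \<bullet> n) * (n \<bullet> v)"
      by (simp add: v_def inner_diff_left)
    then have "v = 0" using nv n'v by simp
    then have n'e: "n' = (n' \<bullet> n) *\<^sub>R n" by (simp add: v_def)
    then have "\<bar>n' \<bullet> n\<bar> = 1" using n1 P' by (metis P_def norm_scaleR mult.right_neutral)
    then consider "n' \<bullet> n = 1" | "n' \<bullet> n = -1" by linarith
    then show ?thesis
    proof cases
      case 1 then show ?thesis using n'e by simp
    next
      case 2
      then have "n' = - n" using n'e by simp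
      moreover have "n \<bullet> x0 = c" "n' \<bullet> x0 = c'" using x0 n3 P' by (auto simp: P_def)
      ultimately have "K \<subseteq> {x. n \<bullet> x = c}"
        using P' n2 by (force simp: P_def)
      then have "interior K \<subseteq> interior {x. n \<bullet> x = c}" by (rule interior_mono)
      also have "\<dots> = {}" using n1 by (intro interior_hyperplane) auto
      finally show ?thesis using K by (simp add: solid_polytope_def)
    qed
  qed
  have on: "outer_normal K E = n"
  proof -
    have "(THE n. \<exists>c. P n c) = n" by (rule the_equality) (use Pn uniq in blast)+
    then show ?thesis unfolding outer_normal_def P_def by simp
  qed
  have "(SOME x. x \<in> E) \<in> E" using ne some_in_eq by blast
  then have "n \<bullet> (SOME x. x \<in> E) = c" using n3 by blast
  then have fl: "facet_level K E = c" by (simp add: facet_level_def on)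
  show "norm (outer_normal K E) = 1" using n1 on by simp
  show "x \<in> K \<Longrightarrow> outer_normal K E \<bullet> x \<le> facet_level K E" using n2 on fl by auto
  show "E = K \<inter> {x. outer_normal K E \<bullet> x = facet_level K E}" unfolding on fl by (rule n3)
qed

lemma facet_compact:
  assumes "solid_polytope K" "E facet_of K" shows "compact E" "convex E"
  using assms by (metis face_of_imp_compact facet_of_imp_face_of polytope_imp_compact 
    polytope_imp_convex solid_polytope_def, metis face_of_imp_convex facet_of_imp_face_of)

text \<open>
  The parameter at which the line through \<open>y\<close> in direction \<open>- e\<close> hits the hyperplane \<open>n \<bullet> x = b\<close>.
\<close>

definition skew_height :: "real^'n \<Rightarrow> real \<Rightarrow> real^'n \<Rightarrow> real^'n \<Rightarrow> real" where
  "skew_height n b e y = (n \<bullet> y - b) / (n \<bullet> e)"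

text \<open>
  The prism on \<open>E\<close> with edges parallel to \<open>e\<close> instead of the normal.
\<close>

definition skew_prism :: "real^'n \<Rightarrow> real \<Rightarrow> real^'n \<Rightarrow> (real^'n) set \<Rightarrow> (real^'n) set" where
  "skew_prism n b e E = {y. 0 \<le> skew_height n b e y \<and> skew_height n b e y \<le> 1 
      \<and> y - skew_height n b e y *\<^sub>R e \<in> E}"

definition prism_fun :: "real^'n \<Rightarrow> real \<Rightarrow> real^'n \<Rightarrow> (real^'n) set \<Rightarrow> (real^'n \<Rightarrow> real) \<Rightarrow> real^'n \<Rightarrow> real" where
  "prism_fun n b e E f y = indicator (skew_prism n b e E) y * f (y - skew_height n b e y *\<^sub>R e)"

lemma continuous_skew_height: "n \<bullet> e \<noteq> 0 \<Longrightarrow> continuous_on S (skew_height n b e)"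
  unfolding skew_height_def by (intro continuous_intros) auto

lemma bdd_supp_borel_prism:
  assumes E: "compact E" and f: "continuous_on E f" and ne: "n \<bullet> e \<noteq> 0"
  shows "bdd_supp_borel (prism_fun n b e E f)"
proof -
  let ?h = "skew_height n b e" let ?P = "skew_prism n b e E"
  have cp: "continuous_on S (\<lambda>y. y - ?h y *\<^sub>R e)" for S
    by (intro continuous_intros continuous_skew_height ne)
  have "?P = {y. 0 \<le> ?h y} \<inter> {y. ?h y \<le> 1} \<inter> (\<lambda>y. y - ?h y *\<^sub>R e) -` E"
    by (auto simp: skew_prism_def)
  moreover have "closed ((\<lambda>y. y - ?h y *\<^sub>R e) -` E)"
    using cp E by (intro closed_vimage) (auto simp: compact_imp_closed)
  ultimately have "closed ?P"
    by (simp add: closed_Int closed_Collect_le continuous_skew_height ne)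
  moreover have "bounded ?P"
  proof -
    obtain R where R: "\<And>x. x \<in> E \<Longrightarrow> norm x \<le> R"
      using compact_imp_bounded[OF E] by (auto simp: bounded_iff)
    have "norm y \<le> R + norm e" if "y \<in> ?P" for y
    proof -
      have "norm y \<le> norm (y - ?h y *\<^sub>R e) + norm (?h y *\<^sub>R e)"
        by (metis diff_add_cancel norm_triangle_ineq)
      also have "\<dots> \<le> R + norm e"
        using that R by (intro add_mono) (auto simp: skew_prism_def mult_left_le_one_le)
      finally show ?thesis .
    qed
    then show ?thesis by (auto simp: bounded_iff)
  qed
  ultimately have "compact ?P" by (simp add: compact_eq_bounded_closed)
  moreover have "continuous_on ?P (\<lambda>y. f (y - ?h y *\<^sub>R e))"
    by (rule continuous_on_compose2[OF f cp]) (auto simp: skew_prism_def)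
  ultimately show ?thesis
    unfolding prism_fun_def[abs_def] by (rule bdd_supp_borel_indicator)
qed

text \<open>
  A point \<open>x + t n\<close> with \<open>x\<close> in the facet has \<open>x\<close> as its closest point in the facet, because its distance
  to the whole hyperplane is already attained there.
\<close>

lemma facet_int_eq_prism:
  assumes K: "solid_polytope K" and E: "E facet_of K" and f: "continuous_on E f"
  defines "n \<equiv> outer_normal K E" and "b \<equiv> facet_level K E"
  shows "facet_int n E f = (LINT y|lborel. prism_fun n b n E f y)"
proof -
  note fn = facet_normal[OF K E, folded n_def b_def]
  have nn: "n \<bullet> n = 1" using fn(1) by (simp add: dot_square_norm)
  have on: "n \<bullet> x = b" if "x \<in> E" for x using that fn(3) by blast
  have P: "{x + t *\<^sub>R n | x t. x \<in> E \<and> 0 \<le> t \<and> t \<le> 1} = skew_prism n b n E" (is "?L = ?R")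
  proof
    show "?L \<subseteq> ?R" by (auto simp: skew_prism_def skew_height_def nn on inner_add_right)
    show "?R \<subseteq> ?L"
    proof
      fix y assume y: "y \<in> ?R"
      have "y = (y - skew_height n b n y *\<^sub>R n) + skew_height n b n y *\<^sub>R n" by simp
      with y show "y \<in> ?L" unfolding skew_prism_def by blast
    qed
  qed
  have cp: "closest_point E y = y - skew_height n b n y *\<^sub>R n" if y: "y \<in> skew_prism n b n E" for y
  proof (rule sym, rule closest_point_unique)
    let ?x = "y - skew_height n b n y *\<^sub>R n"
    show "convex E" "closed E" using facet_compact[OF K E] by (auto simp: compact_imp_closed)
    show x: "?x \<in> E" using y by (simp add: skew_prism_def)
    show "\<forall>z\<in>E. dist y ?x \<le> dist y z"
    proof
      fix z assume z: "z \<in> E"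
      have "dist y ?x = \<bar>n \<bullet> y - b\<bar>" by (simp add: dist_norm skew_height_def nn fn(1))
      also have "\<dots> = \<bar>n \<bullet> (y - z)\<bar>" using on[OF z] by (simp add: inner_diff_right)
      also have "\<dots> \<le> norm n * norm (y - z)" by (rule Cauchy_Schwarz_ineq2)
      finally show "dist y ?x \<le> dist y z" by (simp add: dist_norm fn(1))
    qed
  qed
  have eq: "indicator ?L y *\<^sub>R f (closest_point E y) = prism_fun n b n E f y" for y
    unfolding P prism_fun_def using cp[of y] by (auto simp: indicator_def)
  have "prism_fun n b n E f \<in> borel_measurable lborel"
    using bdd_supp_borel_prism[OF facet_compact(1)[OF K E] f, of n n b] nn by (simp add: bdd_supp_borel_def)
  from integral_completion[OF this] show ?thesis
    unfolding facet_int_def set_lebesgue_integral_def eq .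
qed

text \<open>
  The map \<open>z \<mapsto> z + (n \<bullet> z - b) (e - n)\<close> takes the straight prism to the skew one and moves points only
  in direction \<open>e - n\<close>. On each line in this direction it is affine with slope \<open>n \<bullet> e\<close>, so that a
  one-dimensional change of variables gives the factor.
\<close>

lemma facet_int_eq_skew_prism:
  assumes K: "solid_polytope K" and E: "E facet_of K" and f: "continuous_on E f"
  defines "n \<equiv> outer_normal K E" and "b \<equiv> facet_level K E"
  assumes ne: "n \<bullet> e \<noteq> 0"
  shows "\<bar>n \<bullet> e\<bar> * facet_int n E f = (LINT y|lborel. prism_fun n b e E f y)"
proof -
  note fn = facet_normal[OF K E, folded n_def b_def]
  have nn: "n \<bullet> n = 1" using fn(1) by (simp add: dot_square_norm)
  note fi = facet_int_eq_prism[OF K E f, folded n_def b_def]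
  note cE = facet_compact(1)[OF K E]
  show ?thesis
  proof (cases "e = n")
    case True then show ?thesis using fi nn by simp
  next
    case False
    define w where "w = e - n"
    have w: "w \<noteq> 0" using False by (simp add: w_def)
    have shear: "prism_fun n b n E f z = prism_fun n b e E f (z + (n \<bullet> z - b) *\<^sub>R w)" for z
    proof -
      have h: "skew_height n b e (z + (n \<bullet> z - b) *\<^sub>R w) = skew_height n b n z"
        using ne by (simp add: skew_height_def w_def nn inner_add_right inner_diff_right field_simps)
      have "z + (n \<bullet> z - b) *\<^sub>R w - skew_height n b n z *\<^sub>R e = z - skew_height n b n z *\<^sub>R n"
        by (simp add: skew_height_def nn w_def algebra_simps)
      then show ?thesis
        unfolding prism_fun_def skew_prism_def indicator_def mem_Collect_eq h by presburger
    qed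
    have "(LINT y|lborel. prism_fun n b n E f y) = (1 / \<bar>n \<bullet> e\<bar>) * (LINT y|lborel. prism_fun n b e E f y)"
    proof (rule integral_eq_if_line_integrals_eq[OF _ _ w])
      show "AE y in lborel. (LINT t|lborel. prism_fun n b n E f (y + t *\<^sub>R w)) =
               1 / \<bar>n \<bullet> e\<bar> * (LINT t|lborel. prism_fun n b e E f (y + t *\<^sub>R w))"
      proof (rule AE_I2)
        fix y
        have "prism_fun n b n E f (y + t *\<^sub>R w) = prism_fun n b e E f (y + ((n \<bullet> y - b) + (n \<bullet> e) * t) *\<^sub>R w)" for t
        proof -
          have "y + t *\<^sub>R w + (n \<bullet> (y + t *\<^sub>R w) - b) *\<^sub>R w = y + ((n \<bullet> y - b) + (n \<bullet> e) * t) *\<^sub>R w"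
            by (simp add: w_def nn inner_add_right inner_diff_right algebra_simps)
          then show ?thesis using shear by metis
        qed
        then show "(LINT t|lborel. prism_fun n b n E f (y + t *\<^sub>R w)) =
               1 / \<bar>n \<bullet> e\<bar> * (LINT t|lborel. prism_fun n b e E f (y + t *\<^sub>R w))"
          using lborel_integral_real_affine[OF ne, of "\<lambda>t. prism_fun n b e E f (y + t *\<^sub>R w)" "n \<bullet> y - b"] ne
          by simp
      qed
    qed (auto intro!: bdd_supp_borel_prism cE f simp: ne nn)
    then show ?thesis using fi ne by simp
  qed
qed

text \<open>
  A line in direction \<open>e\<close> stays in the skew prism for exactly one unit of its parameter if it hits
  the facet, and the projected integrand is constant on the line.
\<close>

lemma line_integral_prism:
  fixes n e y :: "real^'n" and b :: real
  assumes "n \<bullet> e \<noteq> 0"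
  defines "s \<equiv> (b - n \<bullet> y) / (n \<bullet> e)"
  shows "(LINT t|lborel. prism_fun n b e E f (y + t *\<^sub>R e)) = (if y + s *\<^sub>R e \<in> E then f (y + s *\<^sub>R e) else 0)"
proof -
  have h: "skew_height n b e (y + t *\<^sub>R e) = t - s" for t
    using assms(1) by (simp add: skew_height_def s_def inner_add_right field_simps)
  have "prism_fun n b e E f (y + t *\<^sub>R e) = indicator {s..s+1} t * (if y + s *\<^sub>R e \<in> E then f (y + s *\<^sub>R e) else 0)" for t
  proof -
    have eq: "y + t *\<^sub>R e - (t - s) *\<^sub>R e = y + s *\<^sub>R e" by (simp add: algebra_simps)
    show ?thesis
      unfolding prism_fun_def skew_prism_def indicator_def mem_Collect_eq h eq by auto
  qed
  then show ?thesis by simp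
qed

lemma AE_notin_negligible: "negligible N \<Longrightarrow> AE x in lborel. x \<notin> N"
  by (metis AE_completion_iff AE_not_in negligible_iff_null_sets)

section \<open>The divergence theorem on a polytope\<close>

text \<open>
  Two distinct unit vectors on the same side of \<open>e\<close> are not parallel. Hence the combination of them
  that is orthogonal to \<open>e\<close> is not zero.
\<close>

lemma negligible_parallel_facets:
  fixes n n' e :: "real^'n"
  assumes "norm n = 1" "norm n' = 1" "n \<noteq> n'" "(n \<bullet> e) * (n' \<bullet> e) > 0"
  shows "negligible {y. (n' \<bullet> e) * (n \<bullet> y) - (n \<bullet> e) * (n' \<bullet> y) = c}"
proof -
  let ?m = "(n' \<bullet> e) *\<^sub>R n - (n \<bullet> e) *\<^sub>R n'"
  have "?m \<noteq> 0"
  proof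
    assume "?m = 0"
    then have eq: "(n' \<bullet> e) *\<^sub>R n = (n \<bullet> e) *\<^sub>R n'" by simp
    then have "norm ((n' \<bullet> e) *\<^sub>R n) = norm ((n \<bullet> e) *\<^sub>R n')" by simp
    then have "\<bar>n' \<bullet> e\<bar> = \<bar>n \<bullet> e\<bar>" using assms by simp
    then have "n' \<bullet> e = n \<bullet> e" using assms(4) by (auto simp: abs_if zero_less_mult_iff split: if_splits)
    then show False using eq assms(3,4) by auto
  qed
  then have "negligible {y. ?m \<bullet> y = c}" by (intro negligible_hyperplane) auto
  then show ?thesis by (simp add: inner_diff_left)
qed

text \<open>
  The lines that touch \<open>K\<close> and avoid its interior sweep out boundary points of the convex set
  \<open>K + \<real> e\<close>, and the boundary of a convex set is a null set.
\<close>

lemma AE_line_meets_interior: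
  fixes K :: "(real^'n) set"
  assumes K: "convex K" and int: "interior K \<noteq> {}"
  shows "AE y in lborel. \<forall>t. y + t *\<^sub>R e \<in> K \<longrightarrow> (\<exists>s. y + s *\<^sub>R e \<in> interior K)"
proof -
  let ?L = "range (\<lambda>t. t *\<^sub>R e)"
  have L: "convex ?L"
    by (metis convex_UNIV convex_scaled)
  have "convex (K + ?L)" using K L by (rule convex_set_plus)
  have sub: "K \<subseteq> K + ?L"
  proof
    fix x assume "x \<in> K"
    then have "x + 0 *\<^sub>R e \<in> K + ?L" by (intro set_plus_intro) auto
    then show "x \<in> K + ?L" by simp
  qed
  then have "interior (K + ?L) \<noteq> {}" using int interior_mono[OF sub] by blast
  then have "interior (K + ?L) = rel_interior (K + ?L)" by (simp add: rel_interior_nonempty_interior)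
  also have "\<dots> = rel_interior K + rel_interior ?L" using K L by (rule rel_interior_sum)
  also have "\<dots> \<subseteq> interior K + ?L"
    unfolding rel_interior_nonempty_interior[OF int] by (intro set_plus_mono2 order_refl rel_interior_subset)
  finally have *: "interior (K + ?L) \<subseteq> interior K + ?L" .
  have "AE y in lborel. y \<notin> frontier (K + ?L)"
    by (intro AE_notin_negligible negligible_convex_frontier) fact
  then show ?thesis
  proof eventually_elim
    case (elim y)
    show ?case
    proof (intro allI impI)
      fix t assume "y + t *\<^sub>R e \<in> K"
      then have "(y + t *\<^sub>R e) + (- t) *\<^sub>R e \<in> K + ?L" by (intro set_plus_intro rangeI)
      then have "y \<in> K + ?L" by simp
      then have "y \<in> interior (K + ?L)" using elim closure_subset by (auto simp: frontier_def)
      then obtain x s where "x \<in> interior K" "y = x + s *\<^sub>R e" using * unfolding set_plus_def by blast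
      then have "y + (- s) *\<^sub>R e \<in> interior K" by simp
      then show "\<exists>s. y + s *\<^sub>R e \<in> interior K" by blast
    qed
  qed
qed

text \<open>
  A generic line enters the interior if it touches \<open>K\<close>, does not lie in the hyperplane of a facet, and does
  not leave (or enter) through two facets at the same time. Each of the three exceptional sets of base points is null.
\<close>

definition generic_line :: "(real^'n) set \<Rightarrow> real^'n \<Rightarrow> real^'n \<Rightarrow> bool" where
  "generic_line K e y \<longleftrightarrow>
     (\<forall>t. y + t *\<^sub>R e \<in> K \<longrightarrow> (\<exists>s. y + s *\<^sub>R e \<in> interior K)) \<and>
     (\<forall>E. E facet_of K \<longrightarrow> outer_normal K E \<bullet> e = 0 \<longrightarrow> outer_normal K E \<bullet> y \<noteq> facet_level K E) \<and>
     (\<forall>E E' t. E facet_of K \<longrightarrow> E' facet_of K \<longrightarrow> y + t *\<^sub>R e \<in> E \<inter> E' \<longrightarrow>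
        (outer_normal K E \<bullet> e) * (outer_normal K E' \<bullet> e) > 0 \<longrightarrow> E = E')"

lemma AE_generic_line:
  fixes K :: "(real^'n) set"
  assumes K: "solid_polytope K"
  shows "AE y in lborel. generic_line K e y"
proof -
  note fin = solid_polytope_finite_facets[OF K]
  let ?n = "outer_normal K" let ?b = "facet_level K"
  have 1: "AE y in lborel. \<forall>t. y + t *\<^sub>R e \<in> K \<longrightarrow> (\<exists>s. y + s *\<^sub>R e \<in> interior K)"
    using K by (intro AE_line_meets_interior) (auto simp: solid_polytope_def polytope_imp_convex)
  have 2: "AE y in lborel. \<forall>E\<in>{E. E facet_of K}. ?n E \<bullet> e = 0 \<longrightarrow> ?n E \<bullet> y \<noteq> ?b E"
  proof (rule AE_finite_allI[OF fin])
    fix E assume "E \<in> {E. E facet_of K}"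
    then have "?n E \<noteq> 0" using facet_normal(1)[OF K, of E] by auto
    then have "AE y in lborel. y \<notin> {y. ?n E \<bullet> y = ?b E}"
      by (intro AE_notin_negligible negligible_hyperplane) auto
    then show "AE y in lborel. ?n E \<bullet> e = 0 \<longrightarrow> ?n E \<bullet> y \<noteq> ?b E" by eventually_elim auto
  qed
  have 3: "AE y in lborel. \<forall>E\<in>{E. E facet_of K}. \<forall>E'\<in>{E. E facet_of K}. \<forall>t.
      y + t *\<^sub>R e \<in> E \<inter> E' \<longrightarrow> (?n E \<bullet> e) * (?n E' \<bullet> e) > 0 \<longrightarrow> E = E'"
  proof (intro AE_finite_allI[OF fin])
    fix E E' assume "E \<in> {E. E facet_of K}" "E' \<in> {E. E facet_of K}"
    then have E: "E facet_of K" and E': "E' facet_of K" by auto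
    note fE = facet_normal[OF K E] note fE' = facet_normal[OF K E']
    show "AE y in lborel. \<forall>t. y + t *\<^sub>R e \<in> E \<inter> E' \<longrightarrow> (?n E \<bullet> e) * (?n E' \<bullet> e) > 0 \<longrightarrow> E = E'"
    proof (cases "(?n E \<bullet> e) * (?n E' \<bullet> e) > 0 \<and> ?n E \<noteq> ?n E'")
      case True
      let ?c = "(?n E' \<bullet> e) * ?b E - (?n E \<bullet> e) * ?b E'"
      have "AE y in lborel. y \<notin> {y. (?n E' \<bullet> e) * (?n E \<bullet> y) - (?n E \<bullet> e) * (?n E' \<bullet> y) = ?c}"
        using True fE(1) fE'(1) by (intro AE_notin_negligible negligible_parallel_facets) auto
      then show ?thesis
      proof eventually_elim
        case (elim y)
        have False if "y + t *\<^sub>R e \<in> E \<inter> E'" for t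
        proof -
          have "?n E \<bullet> (y + t *\<^sub>R e) = ?b E" "?n E' \<bullet> (y + t *\<^sub>R e) = ?b E'"
            using that fE(3) fE'(3) by blast+
          then have "(?n E' \<bullet> e) * (?n E \<bullet> y) - (?n E \<bullet> e) * (?n E' \<bullet> y) = ?c"
            by (simp add: inner_add_right algebra_simps flip: \<open>?n E \<bullet> (y + t *\<^sub>R e) = ?b E\<close> \<open>?n E' \<bullet> (y + t *\<^sub>R e) = ?b E'\<close>)
          then show False using elim by simp
        qed
        then show ?case by blast
      qed
    next
      case False
      show ?thesis
      proof (rule AE_I2, intro allI impI)
        fix y t assume a: "y + t *\<^sub>R e \<in> E \<inter> E'" "(?n E \<bullet> e) * (?n E' \<bullet> e) > 0"
        then have nn: "?n E = ?n E'" using False by auto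
        have "?n E \<bullet> (y + t *\<^sub>R e) = ?b E" "?n E' \<bullet> (y + t *\<^sub>R e) = ?b E'"
          using a fE(3) fE'(3) by blast+
        then have "?b E = ?b E'" using nn by simp
        then show "E = E'" using fE(3) fE'(3) nn by simp
      qed
    qed
  qed
  show ?thesis using 1 2 3 by eventually_elim (auto simp: generic_line_def)
qed

lemma generic_line_minus:
  assumes "generic_line K e y" shows "generic_line K (- e) y"
proof -
  have m: "y + t *\<^sub>R (- e) = y + (- t) *\<^sub>R e" for t by simp
  show ?thesis
    unfolding generic_line_def
  proof (intro conjI allI impI)
    fix t assume "y + t *\<^sub>R (- e) \<in> K"
    then obtain s where "y + s *\<^sub>R e \<in> interior K"
      using assms unfolding generic_line_def m by blast
    then have "y + (- s) *\<^sub>R (- e) \<in> interior K" by simp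
    then show "\<exists>s. y + s *\<^sub>R (- e) \<in> interior K" by blast
  next
    fix E assume "E facet_of K" "outer_normal K E \<bullet> (- e) = 0"
    then show "outer_normal K E \<bullet> y \<noteq> facet_level K E"
      using assms unfolding generic_line_def by simp
  next
    fix E E' t
    assume "E facet_of K" "E' facet_of K" "y + t *\<^sub>R (- e) \<in> E \<inter> E'"
      "(outer_normal K E \<bullet> (- e)) * (outer_normal K E' \<bullet> (- e)) > 0"
    moreover from this have "0 < (outer_normal K E \<bullet> e) * (outer_normal K E' \<bullet> e)" by simp
    ultimately show "E = E'" using assms unfolding generic_line_def m by blast
  qed
qed

lemma generic_line_crossing:
  fixes K :: "(real^'n) set"
  assumes K: "solid_polytope K" and e: "e \<noteq> 0" and gen: "generic_line K e y"
    and meets: "y + t *\<^sub>R e \<in> K"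
  obtains t0 t1 where "t0 < t1" "{t. y + t *\<^sub>R e \<in> K} = {t0..t1}"
proof -
  let ?I = "{t. y + t *\<^sub>R e \<in> K}"
  have I: "?I = (\<lambda>t. y + t *\<^sub>R e) -` K" by auto
  have cont: "continuous_on UNIV (\<lambda>t. y + t *\<^sub>R e)" by (intro continuous_intros)
  have "closed ?I" unfolding I using cont solid_polytope_compact[OF K]
    by (intro closed_vimage) (auto simp: compact_imp_closed)
  moreover have "bounded ?I"
  proof -
    obtain R where R: "\<And>x. x \<in> K \<Longrightarrow> norm x \<le> R"
      using compact_imp_bounded[OF solid_polytope_compact[OF K]] by (auto simp: bounded_iff)
    have "norm t \<le> (R + norm y) / norm e" if "t \<in> ?I" for t
    proof -
      have "norm (t *\<^sub>R e) \<le> norm (y + t *\<^sub>R e) + norm y"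
        by (metis add_diff_cancel_left' norm_triangle_ineq4)
      then have "\<bar>t\<bar> * norm e \<le> R + norm y" using R[of "y + t *\<^sub>R e"] that by simp
      then show ?thesis using e by (simp add: field_simps)
    qed
    then show ?thesis by (auto simp: bounded_iff)
  qed
  ultimately have "compact ?I" by (simp add: compact_eq_bounded_closed)
  moreover have "convex ?I"
  proof (rule convexI)
    fix s t u v :: real assume a: "s \<in> ?I" "t \<in> ?I" "0 \<le> u" "0 \<le> v" "u + v = 1"
    have "y + (u *\<^sub>R s + v *\<^sub>R t) *\<^sub>R e = (u + v) *\<^sub>R y + (u *\<^sub>R s + v *\<^sub>R t) *\<^sub>R e" using a by simp
    also have "\<dots> = u *\<^sub>R (y + s *\<^sub>R e) + v *\<^sub>R (y + t *\<^sub>R e)" by (simp add: algebra_simps)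
    also have "\<dots> \<in> K" using a solid_polytope_convex[OF K] by (auto intro: convexD)
    finally show "u *\<^sub>R s + v *\<^sub>R t \<in> ?I" by simp
  qed
  ultimately obtain t0 t1 where I2: "?I = {t0..t1}"
    using connected_compact_interval_1[of ?I] convex_connected by blast
  obtain s where s: "y + s *\<^sub>R e \<in> interior K" using gen meets by (auto simp: generic_line_def)
  have "open ((\<lambda>t. y + t *\<^sub>R e) -` interior K)" using cont by (intro open_vimage) auto
  then obtain d where d: "d > 0" "ball s d \<subseteq> (\<lambda>t. y + t *\<^sub>R e) -` interior K"
    using s unfolding open_contains_ball by (metis vimageI)
  have "s + d/2 \<in> ball s d" "s - d/2 \<in> ball s d" using d by (auto simp: dist_real_def)
  then have "s + d/2 \<in> ?I" "s - d/2 \<in> ?I" using d(2) interior_subset by blast+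
  then have "t0 < t1" using d(1) by (simp only: I2) simp
  then show ?thesis using I2 that by blast
qed

text \<open>
  A boundary point at an inner parameter would lie on a facet that the line crosses transversally,
  so that the line would violate the inequality of this facet on one of the two sides.
\<close>

lemma generic_line_interior:
  fixes K :: "(real^'n) set"
  assumes K: "solid_polytope K" and gen: "generic_line K e y"
    and I: "{t. y + t *\<^sub>R e \<in> K} = {t0..t1}" and t: "t0 < t" "t < t1"
  shows "y + t *\<^sub>R e \<in> interior K"
proof (rule ccontr)
  have I': "y + u *\<^sub>R e \<in> K \<longleftrightarrow> t0 \<le> u \<and> u \<le> t1" for u
  proof -
    have "u \<in> {t. y + t *\<^sub>R e \<in> K} \<longleftrightarrow> u \<in> {t0..t1}" by (simp only: I)
    then show ?thesis by simp
  qed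
  assume "y + t *\<^sub>R e \<notin> interior K"
  moreover have "y + t *\<^sub>R e \<in> K" using I' t by simp
  ultimately obtain E where E: "E facet_of K" "y + t *\<^sub>R e \<in> E"
    using solid_polytope_boundary[OF K] by blast
  let ?n = "outer_normal K E" let ?b = "facet_level K E"
  note fE = facet_normal[OF K E(1)]
  have nb: "?n \<bullet> (y + t *\<^sub>R e) = ?b" using E(2) fE(3) by blast
  have "?n \<bullet> e \<noteq> 0" using gen E(1) nb by (auto simp: generic_line_def inner_add_right)
  have "y + t0 *\<^sub>R e \<in> K" "y + t1 *\<^sub>R e \<in> K" using I' t by simp_all
  then have "?n \<bullet> (y + t0 *\<^sub>R e) \<le> ?b" "?n \<bullet> (y + t1 *\<^sub>R e) \<le> ?b" by (simp_all only: fE(2))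
  then have "t0 * (?n \<bullet> e) \<le> t * (?n \<bullet> e)" "t1 * (?n \<bullet> e) \<le> t * (?n \<bullet> e)"
    using nb by (simp_all add: inner_add_right)
  then show False using \<open>?n \<bullet> e \<noteq> 0\<close> t by (cases "?n \<bullet> e > 0") (auto simp: mult_le_cancel_right)
qed

text \<open>
  Let \<open>e\<close> point out of the facets that are summed over. At the last parameter \<open>t1\<close> the line is on the
  boundary and hence on a facet; the segment behind it forces the outer normal of this facet to satisfy
  \<open>n \<bullet> e > 0\<close>. Conversely, a facet with \<open>n \<bullet> e > 0\<close> can only be met at \<open>t1\<close>, and on a generic line only one
  such facet contains the exit point. The same statement for \<open>- e\<close> describes the entry point.
\<close>

lemma generic_line_exit:
  fixes K :: "(real^'n) set"
  assumes K: "solid_polytope K" and gen: "generic_line K e y"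
    and I: "{t. y + t *\<^sub>R e \<in> K} = {t0..t1}" and t01: "t0 < t1"
  shows "(\<Sum>E | E facet_of K \<and> outer_normal K E \<bullet> e > 0.
      let s = (facet_level K E - outer_normal K E \<bullet> y) / (outer_normal K E \<bullet> e)
      in if y + s *\<^sub>R e \<in> E then g (y + s *\<^sub>R e) else 0) = (g (y + t1 *\<^sub>R e) :: real)"
proof -
  let ?n = "outer_normal K" let ?b = "facet_level K"
  let ?s = "\<lambda>E. (?b E - ?n E \<bullet> y) / (?n E \<bullet> e)"
  have I': "y + u *\<^sub>R e \<in> K \<longleftrightarrow> t0 \<le> u \<and> u \<le> t1" for u
  proof -
    have "u \<in> {t. y + t *\<^sub>R e \<in> K} \<longleftrightarrow> u \<in> {t0..t1}" by (simp only: I)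
    then show ?thesis by simp
  qed
  have t1K: "y + t1 *\<^sub>R e \<in> K" using I' t01 by simp
  have "y + t1 *\<^sub>R e \<notin> interior K"
  proof
    assume *: "y + t1 *\<^sub>R e \<in> interior K"
    have "open ((\<lambda>t. y + t *\<^sub>R e) -` interior K)"
      by (intro open_vimage continuous_intros) auto
    then obtain d where d: "d > 0" "ball t1 d \<subseteq> (\<lambda>t. y + t *\<^sub>R e) -` interior K"
      using * unfolding open_contains_ball by (metis vimageI)
    have "t1 + d/2 \<in> ball t1 d" using d by (auto simp: dist_real_def)
    then have "y + (t1 + d/2) *\<^sub>R e \<in> K" using d(2) interior_subset by blast
    then show False using d(1) I' by simp
  qed
  then obtain E1 where E1: "E1 facet_of K" "y + t1 *\<^sub>R e \<in> E1"
    using solid_polytope_boundary[OF K t1K] by blast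
  note f1 = facet_normal[OF K E1(1)]
  have nb: "?n E1 \<bullet> (y + t1 *\<^sub>R e) = ?b E1" using E1(2) f1(3) by blast
  have "?n E1 \<bullet> e \<noteq> 0" using gen E1(1) nb by (auto simp: generic_line_def inner_add_right)
  moreover have "?n E1 \<bullet> (y + t0 *\<^sub>R e) \<le> ?b E1" by (rule f1(2)) (use I' t01 in simp)
  then have "t0 * (?n E1 \<bullet> e) \<le> t1 * (?n E1 \<bullet> e)" using nb by (simp add: inner_add_right)
  ultimately have pos: "?n E1 \<bullet> e > 0" using t01 by (auto simp: mult_le_cancel_right)
  have summand: "(let s = ?s E in if y + s *\<^sub>R e \<in> E then g (y + s *\<^sub>R e) else 0) 
       = (if E = E1 then g (y + t1 *\<^sub>R e) else 0)"
    if E: "E facet_of K" "?n E \<bullet> e > 0" for E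
  proof (cases "y + ?s E *\<^sub>R e \<in> E")
    case True
    note fE = facet_normal[OF K E(1)]
    have "y + ?s E *\<^sub>R e \<in> K" using True fE(3) by blast
    then have "?s E \<le> t1" using I' by simp
    moreover have "?n E \<bullet> (y + t1 *\<^sub>R e) \<le> ?b E" by (rule fE(2)[OF t1K])
    then have "t1 \<le> ?s E" using E(2) by (simp add: inner_add_right field_simps)
    ultimately have s: "?s E = t1" by simp
    have "y + t1 *\<^sub>R e \<in> E \<inter> E1" using True E1(2) unfolding s by blast
    then have "E = E1"
      using gen E(1) E1(1) mult_pos_pos[OF E(2) pos] unfolding generic_line_def by metis
    then show ?thesis using True s by (simp add: Let_def)
  next
    case False
    have "E \<noteq> E1"
    proof
      assume "E = E1"
      then have "?s E = t1" using nb pos by (simp add: inner_add_right field_simps)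
      then show False using False E1(2) \<open>E = E1\<close> by simp
    qed
    then show ?thesis using False by (simp add: Let_def)
  qed
  have "(\<Sum>E | E facet_of K \<and> ?n E \<bullet> e > 0. let s = ?s E in if y + s *\<^sub>R e \<in> E then g (y + s *\<^sub>R e) else 0)
      = (\<Sum>E | E facet_of K \<and> ?n E \<bullet> e > 0. if E = E1 then g (y + t1 *\<^sub>R e) else 0)"
    by (rule sum.cong) (use summand in auto)
  also have "\<dots> = g (y + t1 *\<^sub>R e)"
    using E1(1) pos solid_polytope_finite_facets[OF K] by (subst sum.delta) (auto intro: finite_subset)
  finally show ?thesis .
qed

text \<open>
  On a generic line the left-hand side integrates to the value of \<open>g\<close> at the exit point minus that at
  the entry point. The skew prisms on the facets, signed by \<open>n \<bullet> e\<close>, give the same number: exactly one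
  facet with \<open>n \<bullet> e > 0\<close> and one with \<open>n \<bullet> e < 0\<close> is hit. Facets parallel to \<open>e\<close> have weight zero.
\<close>

lemma gauss_direction:
  fixes K :: "(real^'n) set"
  assumes K: "solid_polytope K" and e: "e \<noteq> 0"
    and g: "continuous_on K g" and h: "continuous_on K h"
    and deriv: "\<And>x. x \<in> interior K \<Longrightarrow> ((\<lambda>t. g (x + t *\<^sub>R e)) has_real_derivative h x) (at 0)"
  shows "vol_int K h = (\<Sum>E | E facet_of K. (outer_normal K E \<bullet> e) * facet_int (outer_normal K E) E g)"
proof -
  let ?n = "outer_normal K" let ?b = "facet_level K"
  let ?s = "\<lambda>y E. (?b E - ?n E \<bullet> y) / (?n E \<bullet> e)"
  define \<F> where "\<F> = {E. E facet_of K \<and> ?n E \<bullet> e \<noteq> 0}"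
  note fin = solid_polytope_finite_facets[OF K]
  have fF: "finite \<F>" by (rule finite_subset[OF _ fin]) (auto simp: \<F>_def)
  note cK = solid_polytope_compact[OF K]
  have gE: "continuous_on E g" if "E facet_of K" for E
    using g facet_of_imp_subset[OF that] by (rule continuous_on_subset)
  define \<Phi> where "\<Phi> E y = sgn (?n E \<bullet> e) * prism_fun (?n E) (?b E) e E g y" for E y
  have bP: "bdd_supp_borel (\<Phi> E)" if "E \<in> \<F>" for E
    unfolding \<Phi>_def[abs_def] using that facet_compact(1)[OF K] gE
    by (intro bdd_supp_borel_cmult bdd_supp_borel_prism) (auto simp: \<F>_def)
  have facet: "(?n E \<bullet> e) * facet_int (?n E) E g = (LINT y|lborel. \<Phi> E y)" if "E \<in> \<F>" for E
    using facet_int_eq_skew_prism[OF K _ gE, of E e] that unfolding \<Phi>_def \<F>_def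
    by (simp flip: mult.assoc) (metis (no_types) mult.assoc sgn_mult_abs)
  have bh: "bdd_supp_borel (\<lambda>x. indicator K x * h x)" by (rule bdd_supp_borel_indicator[OF cK h])
  have "vol_int K h = (LINT x|lborel. indicator K x * h x)"
    by (rule vol_int_eq_lborel[OF cK h])
  also have "\<dots> = 1 * (LINT y|lborel. (\<Sum>E\<in>\<F>. \<Phi> E y))"
  proof (rule integral_eq_if_line_integrals_eq[OF bh _ e])
    show "AE y in lborel. (LINT t|lborel. indicator K (y + t *\<^sub>R e) * h (y + t *\<^sub>R e)) =
           1 * (LINT t|lborel. (\<Sum>E\<in>\<F>. \<Phi> E (y + t *\<^sub>R e)))"
      using AE_generic_line[OF K, of e]
    proof eventually_elim
      case (elim y)
      define q where "q E = (let s = ?s y E in if y + s *\<^sub>R e \<in> E then g (y + s *\<^sub>R e) else 0)" for E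
      have "(LINT t|lborel. (\<Sum>E\<in>\<F>. \<Phi> E (y + t *\<^sub>R e))) = (\<Sum>E\<in>\<F>. (LINT t|lborel. \<Phi> E (y + t *\<^sub>R e)))"
        by (intro Bochner_Integration.integral_sum bdd_supp_borel_integrable bdd_supp_borel_line bP e)
      also have "\<dots> = (\<Sum>E\<in>\<F>. sgn (?n E \<bullet> e) * q E)"
      proof (rule sum.cong[OF refl])
        fix E assume "E \<in> \<F>"
        then show "(LINT t|lborel. \<Phi> E (y + t *\<^sub>R e)) = sgn (?n E \<bullet> e) * q E"
          by (simp add: \<Phi>_def line_integral_prism \<F>_def q_def Let_def)
      qed
      finally have R: "(LINT t|lborel. (\<Sum>E\<in>\<F>. \<Phi> E (y + t *\<^sub>R e))) = (\<Sum>E\<in>\<F>. sgn (?n E \<bullet> e) * q E)" .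
      show ?case
      proof (cases "\<exists>t. y + t *\<^sub>R e \<in> K")
        case False
        then have "q E = 0" if "E \<in> \<F>" for E
          using that facet_of_imp_subset[of E K] unfolding q_def \<F>_def by (auto simp: Let_def)
        then show ?thesis using False unfolding R by simp
      next
        case True
        then obtain t0 t1 where t01: "t0 < t1" and I: "{t. y + t *\<^sub>R e \<in> K} = {t0..t1}"
          using generic_line_crossing[OF K e elim] by metis
        have I': "y + u *\<^sub>R e \<in> K \<longleftrightarrow> t0 \<le> u \<and> u \<le> t1" for u
          proof -
            have "u \<in> {t. y + t *\<^sub>R e \<in> K} \<longleftrightarrow> u \<in> {t0..t1}" by (simp only: I)
            then show ?thesis by simp
          qed
        have L: "(LINT t|lborel. indicator K (y + t *\<^sub>R e) * h (y + t *\<^sub>R e)) = g (y + t1 *\<^sub>R e) - g (y + t0 *\<^sub>R e)"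
        proof (rule integral_of_derivative_off_finite[where S = "{}" and g = "\<lambda>t. g (y + t *\<^sub>R e)" and a = t0 and b = t1])
          show "bdd_supp_borel (\<lambda>t. indicator K (y + t *\<^sub>R e) * h (y + t *\<^sub>R e))"
            by (rule bdd_supp_borel_line[OF bh e])
          show "continuous_on {t0..t1} (\<lambda>t. g (y + t *\<^sub>R e))"
            by (rule continuous_on_compose2[OF g]) (auto intro!: continuous_intros simp: I')
          fix t assume t: "t0 < t" "t < t1"
          have "((\<lambda>u. g ((y + t *\<^sub>R e) + u *\<^sub>R e)) has_real_derivative h (y + t *\<^sub>R e)) (at 0)"
            by (rule deriv[OF generic_line_interior[OF K elim I t]])
          then have "((\<lambda>u. g (y + (u + t) *\<^sub>R e)) has_real_derivative h (y + t *\<^sub>R e)) (at 0)"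
            by (simp add: algebra_simps)
          then show "((\<lambda>t. g (y + t *\<^sub>R e)) has_real_derivative indicator K (y + t *\<^sub>R e) * h (y + t *\<^sub>R e)) (at t)"
            using DERIV_shift[of "\<lambda>u. g (y + u *\<^sub>R e)" "h (y + t *\<^sub>R e)" 0 t] t by (simp add: I')
        qed (use t01 I' in auto)
        have exit: "(\<Sum>E | E facet_of K \<and> ?n E \<bullet> e > 0. q E) = g (y + t1 *\<^sub>R e)"
          unfolding q_def by (rule generic_line_exit[OF K elim I t01])
        \<comment> \<open>The entry point is the exit point of the reversed line.\<close>
        have In: "{t. y + t *\<^sub>R (- e) \<in> K} = {- t1 .. - t0}"
        proof (rule set_eqI)
          fix t
          have "y + t *\<^sub>R (- e) = y + (- t) *\<^sub>R e" by simp
          then have "y + t *\<^sub>R (- e) \<in> K \<longleftrightarrow> t0 \<le> - t \<and> - t \<le> t1" by (simp only: I')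
          then show "t \<in> {t. y + t *\<^sub>R (- e) \<in> K} \<longleftrightarrow> t \<in> {- t1 .. - t0}"
            unfolding mem_Collect_eq atLeastAtMost_iff by linarith
        qed
        have "(\<Sum>E | E facet_of K \<and> ?n E \<bullet> (- e) > 0.
            let s = (?b E - ?n E \<bullet> y) / (?n E \<bullet> (- e)) in if y + s *\<^sub>R (- e) \<in> E then g (y + s *\<^sub>R (- e)) else 0)
            = g (y + (- t0) *\<^sub>R (- e))"
          by (rule generic_line_exit[OF K generic_line_minus[OF elim] In]) (use t01 in simp)
        then have entry: "(\<Sum>E | E facet_of K \<and> ?n E \<bullet> e < 0. q E) = g (y + t0 *\<^sub>R e)"
          by (simp add: q_def Let_def cong: if_cong)
        have "\<F> = {E. E facet_of K \<and> ?n E \<bullet> e > 0} \<union> {E. E facet_of K \<and> ?n E \<bullet> e < 0}"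
          by (auto simp: \<F>_def)
        then have "(\<Sum>E\<in>\<F>. sgn (?n E \<bullet> e) * q E) 
            = (\<Sum>E | E facet_of K \<and> ?n E \<bullet> e > 0. sgn (?n E \<bullet> e) * q E)
            + (\<Sum>E | E facet_of K \<and> ?n E \<bullet> e < 0. sgn (?n E \<bullet> e) * q E)"
          using fF by (simp add: sum.union_disjoint disjoint_iff)
        also have "\<dots> = (\<Sum>E | E facet_of K \<and> ?n E \<bullet> e > 0. q E) - (\<Sum>E | E facet_of K \<and> ?n E \<bullet> e < 0. q E)"
          by (simp add: sum_negf)
        finally show ?thesis unfolding R L exit entry by simp
      qed
    qed
  qed (rule bdd_supp_borel_sum[OF fF bP])
  also have "\<dots> = (\<Sum>E\<in>\<F>. (LINT y|lborel. \<Phi> E y))"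
    by (simp add: Bochner_Integration.integral_sum bdd_supp_borel_integrable bP)
  also have "\<dots> = (\<Sum>E\<in>\<F>. (?n E \<bullet> e) * facet_int (?n E) E g)"
    by (simp add: facet)
  also have "\<dots> = (\<Sum>E | E facet_of K. (?n E \<bullet> e) * facet_int (?n E) E g)"
    by (rule sum.mono_neutral_left[OF fin]) (auto simp: \<F>_def)
  finally show ?thesis .
qed


lemma vol_int_cong: "(\<And>x. x \<in> K \<Longrightarrow> f x = g x) \<Longrightarrow> vol_int K f = vol_int K g"
  unfolding set_lebesgue_integral_def by (rule Bochner_Integration.integral_cong) (auto simp: indicator_def)

lemma vol_int_add:
  assumes "compact K" "continuous_on K f" "continuous_on K g"
  shows "vol_int K (\<lambda>x. f x + g x) = vol_int K f + vol_int K g"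
  using assms bdd_supp_borel_integrable[OF bdd_supp_borel_indicator[OF assms(1,2)]]
    bdd_supp_borel_integrable[OF bdd_supp_borel_indicator[OF assms(1,3)]]
  by (simp add: vol_int_eq_lborel continuous_on_add distrib_left)

lemma vol_int_cmult: "vol_int K (\<lambda>x. c * f x) = c * vol_int K f"
  by simp

lemma vol_int_sum:
  assumes "compact K" "finite I" "\<And>i. i \<in> I \<Longrightarrow> continuous_on K (f i)"
  shows "vol_int K (\<lambda>x. \<Sum>i\<in>I. f i x) = (\<Sum>i\<in>I. vol_int K (f i))"
  using assms(2,3)
proof (induction I rule: finite_induct)
  case empty then show ?case by (simp add: set_lebesgue_integral_def)
next
  case (insert i I)
  then show ?case by (simp add: vol_int_add[OF assms(1)] continuous_on_sum)
qed

lemma vol_int_nonneg: "(\<And>x. x \<in> K \<Longrightarrow> f x \<ge> 0) \<Longrightarrow> vol_int K f \<ge> 0"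
  unfolding set_lebesgue_integral_def
  by (rule Bochner_Integration.integral_nonneg) (auto simp: indicator_def)

lemma facet_closest_point:
  assumes "solid_polytope K" "E facet_of K" shows "closest_point E y \<in> E"
  using facet_compact[OF assms] assms(2)
  by (intro closest_point_in_set) (auto simp: compact_imp_closed facet_of_def)

lemma bdry_int_cong:
  assumes K: "solid_polytope K" and eq: "\<And>n x. x \<in> K \<Longrightarrow> f n x = g n x"
  shows "bdry_int K f = bdry_int K g"
  unfolding bdry_int_def
proof (rule sum.cong[OF refl])
  fix E assume "E \<in> {E. E facet_of K}"
  then have E: "E facet_of K" by simp
  have "f n (closest_point E y) = g n (closest_point E y)" for n y
    using facet_closest_point[OF K E] facet_of_imp_subset[OF E] by (intro eq) blast
  then show "facet_int (outer_normal K E) E (f (outer_normal K E)) = facet_int (outer_normal K E) E (g (outer_normal K E))"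
    by (simp add: facet_int_def)
qed

text \<open>
  The first argument of the integrand is a unit vector on every facet, which the estimates of \<open>a \<bullet> n\<close> use.
\<close>

lemma bdry_int_nonneg:
  assumes K: "solid_polytope K" and nn: "\<And>n x. norm n = 1 \<Longrightarrow> x \<in> K \<Longrightarrow> f n x \<ge> 0"
  shows "bdry_int K f \<ge> 0"
  unfolding bdry_int_def
proof (rule sum_nonneg)
  fix E assume "E \<in> {E. E facet_of K}"
  then have E: "E facet_of K" by simp
  have "f (outer_normal K E) (closest_point E y) \<ge> 0" for y
    using facet_closest_point[OF K E] facet_of_imp_subset[OF E] by (intro nn facet_normal(1)[OF K E]) blast
  then show "facet_int (outer_normal K E) E (f (outer_normal K E)) \<ge> 0"
    unfolding facet_int_def by (rule vol_int_nonneg)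
qed

lemma facet_int_add:
  assumes K: "solid_polytope K" and E: "E facet_of K"
    and f: "continuous_on K f" and g: "continuous_on K g"
  shows "facet_int (outer_normal K E) E (\<lambda>x. f x + g x)
       = facet_int (outer_normal K E) E f + facet_int (outer_normal K E) E g"
proof -
  note sub = facet_of_imp_subset[OF E]
  note fE = continuous_on_subset[OF f sub] and gE = continuous_on_subset[OF g sub]
  note cE = facet_compact(1)[OF K E]
  have nn: "outer_normal K E \<bullet> outer_normal K E \<noteq> 0"
    using facet_normal(1)[OF K E] by auto
  have "prism_fun n b n E (\<lambda>x. f x + g x) = (\<lambda>y. prism_fun n b n E f y + prism_fun n b n E g y)" for n b
    by (simp add: prism_fun_def fun_eq_iff distrib_left)
  then show ?thesis
    by (simp add: facet_int_eq_prism[OF K E] fE gE continuous_on_add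
        bdd_supp_borel_integrable bdd_supp_borel_prism[OF cE _ nn])
qed

lemma facet_int_cmult: "facet_int n E (\<lambda>x. c * f x) = c * facet_int n E f"
  unfolding facet_int_def by simp

lemma facet_int_sum:
  assumes K: "solid_polytope K" and E: "E facet_of K"
    and I: "finite I" and f: "\<And>i. i \<in> I \<Longrightarrow> continuous_on K (f i)"
  shows "facet_int (outer_normal K E) E (\<lambda>x. \<Sum>i\<in>I. f i x) = (\<Sum>i\<in>I. facet_int (outer_normal K E) E (f i))"
  using I f
proof (induction I rule: finite_induct)
  case empty then show ?case by (simp add: facet_int_def set_lebesgue_integral_def)
next
  case (insert i I)
  then show ?case by (simp add: facet_int_add[OF K E] continuous_on_sum)
qed

lemma bdry_int_add:
  assumes K: "solid_polytope K" and f: "\<And>n. continuous_on K (f n)" and g: "\<And>n. continuous_on K (g n)"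
  shows "bdry_int K (\<lambda>n x. f n x + g n x) = bdry_int K f + bdry_int K g"
  unfolding bdry_int_def using facet_int_add[OF K _ f g] by (simp add: sum.distrib)

lemma bdry_int_cmult: "bdry_int K (\<lambda>n x. c * f n x) = c * bdry_int K f"
  unfolding bdry_int_def by (simp add: facet_int_cmult sum_distrib_left)

theorem gauss_polytope:
  fixes K :: "(real^'n) set"
  assumes K: "solid_polytope K"
    and G: "continuous_on K G" and H: "\<And>i. continuous_on K (H i)"
    and deriv: "\<And>x i. x \<in> interior K \<Longrightarrow> ((\<lambda>t. G (x + t *\<^sub>R axis i 1) $ i) has_real_derivative H i x) (at 0)"
  shows "vol_int K (\<lambda>x. \<Sum>i\<in>UNIV. H i x) = bdry_int K (\<lambda>n x. G x \<bullet> n)"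
proof -
  let ?n = "outer_normal K"
  have Gi: "continuous_on K (\<lambda>x. G x $ i)" for i by (intro continuous_intros G)
  have "vol_int K (\<lambda>x. \<Sum>i\<in>UNIV. H i x) = (\<Sum>i\<in>UNIV. vol_int K (H i))"
    by (intro vol_int_sum solid_polytope_compact K H finite)
  also have "\<dots> = (\<Sum>i\<in>UNIV. \<Sum>E | E facet_of K. ?n E $ i * facet_int (?n E) E (\<lambda>x. G x $ i))"
  proof (rule sum.cong[OF refl])
    fix i :: 'n
    have "vol_int K (H i) = (\<Sum>E | E facet_of K. (?n E \<bullet> axis i 1) * facet_int (?n E) E (\<lambda>x. G x $ i))"
      by (rule gauss_direction[OF K _ Gi H deriv]) (auto simp: axis_eq_0_iff)
    then show "vol_int K (H i) = (\<Sum>E | E facet_of K. ?n E $ i * facet_int (?n E) E (\<lambda>x. G x $ i))"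
      by (simp add: inner_axis)
  qed
  also have "\<dots> = (\<Sum>E | E facet_of K. \<Sum>i\<in>UNIV. ?n E $ i * facet_int (?n E) E (\<lambda>x. G x $ i))"
    by (rule sum.swap)
  also have "\<dots> = (\<Sum>E | E facet_of K. facet_int (?n E) E (\<lambda>x. G x \<bullet> ?n E))"
  proof (rule sum.cong[OF refl])
    fix E assume "E \<in> {E. E facet_of K}"
    then have E: "E facet_of K" by simp
    have "facet_int (?n E) E (\<lambda>x. G x \<bullet> ?n E) = facet_int (?n E) E (\<lambda>x. \<Sum>i\<in>UNIV. ?n E $ i * G x $ i)"
      by (simp add: inner_vec_def mult.commute)
    also have "\<dots> = (\<Sum>i\<in>UNIV. facet_int (?n E) E (\<lambda>x. ?n E $ i * G x $ i))"
      by (rule facet_int_sum[OF K E]) (auto intro!: continuous_intros Gi)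
    finally show "(\<Sum>i\<in>UNIV. ?n E $ i * facet_int (?n E) E (\<lambda>x. G x $ i)) = facet_int (?n E) E (\<lambda>x. G x \<bullet> ?n E)"
      by (simp add: facet_int_cmult)
  qed
  finally show ?thesis by (simp add: bdry_int_def)
qed

section \<open>Polynomials on an element\<close>

text \<open>
  On a line through a point of the open set the polynomial has infinitely many zeros.
\<close>

lemma real_polynomial_zero_on_open:
  fixes q :: "'a::euclidean_space \<Rightarrow> real"
  assumes q: "real_polynomial_function q" and U: "open U" "U \<noteq> {}" and z: "\<And>x. x \<in> U \<Longrightarrow> q x = 0"
  shows "q = (\<lambda>_. 0)"
proof
  fix y
  obtain x where x: "x \<in> U" using U by blast
  define L where "L t = x + t *\<^sub>R (y - x)" for t :: real
  have "polynomial_function L" unfolding L_def[abs_def]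
    by (intro polynomial_function_add polynomial_function_const polynomial_function_mult polynomial_function_id)
  then have "real_polynomial_function (q \<circ> L)" using q by (rule real_polynomial_function_compose)
  then obtain a n where a: "q \<circ> L = (\<lambda>t. \<Sum>i\<le>n. a i * t ^ i)"
    using real_polynomial_function_imp_sum by blast
  have "open (L -` U)" unfolding L_def[abs_def] using U by (intro open_vimage continuous_intros) auto
  moreover have "0 \<in> L -` U" using x by (simp add: L_def)
  ultimately have "infinite (L -` U)" using finite_imp_not_open by blast
  moreover have "L -` U \<subseteq> {t. (\<Sum>i\<le>n. a i * t ^ i) = 0}"
  proof
    fix t assume "t \<in> L -` U"
    then have "(q \<circ> L) t = 0" using z by simp
    then show "t \<in> {t. (\<Sum>i\<le>n. a i * t ^ i) = 0}" unfolding a by simp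
  qed
  ultimately have "infinite {t. (\<Sum>i\<le>n. a i * t ^ i) = 0}" using finite_subset by blast
  then have "\<forall>k\<le>n. a k = 0" using polyfun_finite_roots[of a n] by blast
  then have "(q \<circ> L) 1 = 0" unfolding a by simp
  then show "q y = 0" by (simp add: L_def)
qed

lemma real_polynomial_gradient:
  fixes q :: "real^'n \<Rightarrow> real"
  assumes "real_polynomial_function q"
  shows "\<exists>G. (\<forall>i. real_polynomial_function (\<lambda>x. G x $ i)) \<and> (\<forall>x. (q has_derivative (\<lambda>v. G x \<bullet> v)) (at x))"
  using assms
proof (induction q rule: real_polynomial_function.induct)
  case (linear f)
  define g where "g = (\<chi> i. f (axis i 1))"
  have "f v = g \<bullet> v" for v
  proof -
    have "f v = f (\<Sum>i\<in>UNIV. v $ i *\<^sub>R axis i 1)" by (simp add: basis_expansion[of v, unfolded scalar_mult_eq_scaleR])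
    also have "\<dots> = (\<Sum>i\<in>UNIV. v $ i * f (axis i 1))"
      using linear by (simp add: bounded_linear.linear linear_sum linear_scale)
    finally show ?thesis by (simp add: g_def inner_vec_def mult.commute)
  qed
  then have "f = (\<lambda>v. g \<bullet> v)" by auto
  moreover have "(f has_derivative f) (at x)" for x
    using linear by (rule bounded_linear_imp_has_derivative)
  ultimately show ?case
    by (intro exI[of _ "\<lambda>_. g"]) (auto intro: real_polynomial_function.intros(2))
next
  case (const c)
  show ?case by (intro exI[of _ "\<lambda>_. 0"]) (auto intro: real_polynomial_function.intros(2))
next
  case (add f g)
  then obtain F G where "\<forall>i. real_polynomial_function (\<lambda>x. F x $ i)" "\<forall>x. (f has_derivative (\<lambda>v. F x \<bullet> v)) (at x)"
    "\<forall>i. real_polynomial_function (\<lambda>x. G x $ i)" "\<forall>x. (g has_derivative (\<lambda>v. G x \<bullet> v)) (at x)" by blast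
  then show ?case
    by (intro exI[of _ "\<lambda>x. F x + G x"])
       (auto intro!: real_polynomial_function.intros(3) has_derivative_add simp: inner_add_left)
next
  case (mult f g)
  then obtain F G where FG: "\<forall>i. real_polynomial_function (\<lambda>x. F x $ i)" "\<forall>x. (f has_derivative (\<lambda>v. F x \<bullet> v)) (at x)"
    "\<forall>i. real_polynomial_function (\<lambda>x. G x $ i)" "\<forall>x. (g has_derivative (\<lambda>v. G x \<bullet> v)) (at x)" by blast
  have "((\<lambda>x. f x * g x) has_derivative (\<lambda>v. (f x *\<^sub>R G x + g x *\<^sub>R F x) \<bullet> v)) (at x)" for x
  proof -
    have "((\<lambda>x. f x * g x) has_derivative (\<lambda>v. f x * (G x \<bullet> v) + (F x \<bullet> v) * g x)) (at x)"
      using FG by (intro has_derivative_mult) auto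
    then show ?thesis by (simp add: inner_add_left mult.commute)
  qed
  then show ?case using FG mult
    by (intro exI[of _ "\<lambda>x. f x *\<^sub>R G x + g x *\<^sub>R F x"])
       (auto intro!: real_polynomial_function.intros(3) real_polynomial_function.intros(4))
qed

text \<open>
  At a corner of \<open>K\<close> the coordinate directions may leave \<open>K\<close>. The derivative is
  determined in the directions \<open>z - x\<close> with \<open>z \<in> K\<close> by convexity, and differences of these fill a ball, as \<open>K\<close> has
  interior points.
\<close>

lemma has_derivative_unique_solid:
  fixes f :: "'a::euclidean_space \<Rightarrow> real"
  assumes K: "convex K" "interior K \<noteq> {}" and x: "x \<in> K"
    and D: "(f has_derivative D) (at x within K)" "(f has_derivative D') (at x within K)"
  shows "D = D'"
proof -
  have eq: "D (z - x) = D' (z - x)" if z: "z \<in> K" for z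
  proof -
    let ?L = "\<lambda>t::real. x + t *\<^sub>R (z - x)"
    have sub: "?L ` cbox 0 1 \<subseteq> K"
    proof
      fix w assume "w \<in> ?L ` cbox 0 1"
      then obtain t where t: "0 \<le> t" "t \<le> 1" "w = ?L t" by auto
      have "w = (1 - t) *\<^sub>R x + t *\<^sub>R z" using t by (simp add: algebra_simps)
      then show "w \<in> K" using K(1) x z t by (simp add: convexD_alt)
    qed
    have L: "(?L has_derivative (\<lambda>t. t *\<^sub>R (z - x))) (at 0 within cbox 0 1)"
      by (auto intro!: derivative_eq_intros)
    have *: "((f \<circ> ?L) has_vector_derivative E (z - x)) (at 0 within cbox 0 1)"
      if E: "(f has_derivative E) (at x within K)" for E
    proof -
      have lin: "linear E" using E has_derivative_linear by blast
      have "(f has_derivative E) (at (?L 0) within ?L ` cbox 0 1)"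
        using has_derivative_subset[OF E sub] by simp
      from diff_chain_within[OF L this] have "((f \<circ> ?L) has_derivative (\<lambda>t. E (t *\<^sub>R (z - x)))) (at 0 within cbox 0 1)"
        by (simp add: o_def)
      then show ?thesis by (simp add: has_vector_derivative_def linear_scale[OF lin])
    qed
    show ?thesis
      by (rule vector_derivative_unique_within_closed_interval[OF _ _ *[OF D(1)] *[OF D(2)]]) auto
  qed
  have lin: "linear D" "linear D'" using D has_derivative_linear by blast+
  obtain z where "z \<in> interior K" using K by blast
  then obtain r where r: "r > 0" "ball z r \<subseteq> K" using mem_interior by metis
  show ?thesis
  proof
    fix v :: 'a
    define w where "w = (r / (2 * (norm v + 1))) *\<^sub>R v"
    have nv: "norm v + 1 > 0" by (rule add_nonneg_pos) auto
    have "norm w = r * (norm v / (2 * (norm v + 1)))" using r(1) by (simp add: w_def)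
    also have "\<dots> < r * 1" using r(1) nv by (intro mult_strict_left_mono) (auto simp: divide_less_eq)
    finally have nw: "norm w < r" by simp
    have "z + w \<in> ball z r" using nw by (simp add: dist_norm)
    moreover have "z \<in> ball z r" using r(1) by simp
    ultimately have "z + w \<in> K" "z \<in> K" using r(2) by auto
    then have "D (z + w - x) = D' (z + w - x)" "D (z - x) = D' (z - x)" using eq by blast+
    moreover have "w = (z + w - x) - (z - x)" by simp
    ultimately have "D w = D' w" using lin by (metis linear_diff)
    moreover have "v = (2 * (norm v + 1) / r) *\<^sub>R w" using r(1) nv by (simp add: w_def)
    ultimately show "D v = D' v" using lin by (metis linear_scale)
  qed
qed

lemma grad_eqI:
  fixes K :: "(real^'n) set"
  assumes K: "solid_polytope K" and x: "x \<in> K"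
    and D: "(f has_derivative (\<lambda>v. G \<bullet> v)) (at x within K)"
  shows "grad K f x = G"
proof -
  have "(f has_derivative frechet_derivative f (at x within K)) (at x within K)"
    using D frechet_derivative_works differentiable_def by blast
  then have "frechet_derivative f (at x within K) = (\<lambda>v. G \<bullet> v)"
    using has_derivative_unique_solid[OF solid_polytope_convex[OF K] _ x _ D] K
    by (auto simp: solid_polytope_def)
  then show ?thesis by (simp add: grad_def inner_axis vec_eq_iff)
qed

text \<open>
  A function in the continuous space is a different polynomial on each element. Derivatives relative
  to \<open>K\<close> depend only on the values on \<open>K\<close>, so that agreement on \<open>K\<close> suffices.
\<close>

definition poly_on :: "(real^'n) set \<Rightarrow> (real^'n \<Rightarrow> real) \<Rightarrow> bool" where
  "poly_on K f \<longleftrightarrow> (\<exists>q. real_polynomial_function q \<and> (\<forall>x\<in>K. f x = q x))"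

lemma poly_onI: "real_polynomial_function f \<Longrightarrow> poly_on K f"
  by (auto simp: poly_on_def)

lemma poly_on_const: "poly_on K (\<lambda>_. c)"
  by (intro poly_onI real_polynomial_function.intros(2))

lemma poly_on_add: "poly_on K f \<Longrightarrow> poly_on K g \<Longrightarrow> poly_on K (\<lambda>x. f x + g x)"
  unfolding poly_on_def
  by (elim exE) (rule_tac x = "\<lambda>x. q x + qa x" in exI, auto intro: real_polynomial_function.intros(3))

lemma poly_on_mult: "poly_on K f \<Longrightarrow> poly_on K g \<Longrightarrow> poly_on K (\<lambda>x. f x * g x)"
  unfolding poly_on_def
  by (elim exE) (rule_tac x = "\<lambda>x. q x * qa x" in exI, auto intro: real_polynomial_function.intros(4))

lemma poly_on_cmult: "poly_on K f \<Longrightarrow> poly_on K (\<lambda>x. c * f x)"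
  by (intro poly_on_mult poly_on_const)

lemma poly_on_sum: "finite I \<Longrightarrow> (\<And>i. i \<in> I \<Longrightarrow> poly_on K (f i)) \<Longrightarrow> poly_on K (\<lambda>x. \<Sum>i\<in>I. f i x)"
  by (induction I rule: finite_induct) (auto intro: poly_on_add poly_on_const)

lemma continuous_real_polynomial: "real_polynomial_function q \<Longrightarrow> continuous_on S q"
  by (simp add: continuous_on_polymonial_function real_polynomial_function_eq)

lemma poly_on_continuous: "poly_on K f \<Longrightarrow> continuous_on K f"
  unfolding poly_on_def by (metis continuous_on_cong continuous_real_polynomial)

text \<open>
  Uniqueness of the derivative relative to \<open>K\<close> identifies the gradient with that of the polynomial, on the
  boundary as well; hence its components are polynomials again.
\<close>

lemma poly_on_gradient:
  fixes K :: "(real^'n) set"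
  assumes K: "solid_polytope K" and f: "poly_on K f"
  shows "x \<in> K \<Longrightarrow> (f has_derivative (\<lambda>v. grad K f x \<bullet> v)) (at x within K)"
    and "poly_on K (\<lambda>x. grad K f x $ i)"
proof -
  obtain q where q: "real_polynomial_function q" "\<And>x. x \<in> K \<Longrightarrow> f x = q x" using f by (auto simp: poly_on_def)
  obtain G where G: "\<And>i. real_polynomial_function (\<lambda>x. G x $ i)" "\<And>x. (q has_derivative (\<lambda>v. G x \<bullet> v)) (at x)"
    using real_polynomial_gradient[OF q(1)] by blast
  have D: "(f has_derivative (\<lambda>v. G x \<bullet> v)) (at x within K)" if "x \<in> K" for x
    using that q(2) has_derivative_at_withinI[OF G(2)] by (rule has_derivative_transform)
  have eq: "grad K f x = G x" if "x \<in> K" for x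
    using grad_eqI[OF K that D[OF that]] .
  show "x \<in> K \<Longrightarrow> (f has_derivative (\<lambda>v. grad K f x \<bullet> v)) (at x within K)"
    using D eq by simp
  show "poly_on K (\<lambda>x. grad K f x $ i)"
    unfolding poly_on_def using G(1)[of i] eq by (intro exI[of _ "\<lambda>x. G x $ i"]) auto
qed

lemma continuous_on_grad:
  assumes K: "solid_polytope K" and f: "poly_on K f"
  shows "continuous_on K (grad K f)"
proof -
  have "continuous_on K (\<lambda>x. \<chi> i. grad K f x $ i)"
    by (intro continuous_on_vec_lambda poly_on_continuous poly_on_gradient(2)[OF K f])
  then show ?thesis by simp
qed

lemma grad_add:
  assumes K: "solid_polytope K" and f: "poly_on K f" and g: "poly_on K g" and x: "x \<in> K"
  shows "grad K (\<lambda>x. f x + g x) x = grad K f x + grad K g x"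
  using has_derivative_add[OF poly_on_gradient(1)[OF K f x] poly_on_gradient(1)[OF K g x]]
  by (intro grad_eqI[OF K x]) (simp add: inner_add_left)

lemma grad_mult:
  assumes K: "solid_polytope K" and f: "poly_on K f" and g: "poly_on K g" and x: "x \<in> K"
  shows "grad K (\<lambda>x. f x * g x) x = f x *\<^sub>R grad K g x + g x *\<^sub>R grad K f x"
  using has_derivative_mult[OF poly_on_gradient(1)[OF K f x] poly_on_gradient(1)[OF K g x]]
  by (intro grad_eqI[OF K x]) (simp add: inner_add_left mult.commute)

lemma grad_cmult:
  assumes K: "solid_polytope K" and f: "poly_on K f" and x: "x \<in> K"
  shows "grad K (\<lambda>x. c * f x) x = c *\<^sub>R grad K f x"
proof -
  have "grad K (\<lambda>_. c) x = 0" by (rule grad_eqI[OF K x]) simp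
  then show ?thesis using grad_mult[OF K poly_on_const f x, of c] by simp
qed

lemma divg_grad_cmult:
  assumes K: "solid_polytope K" and f: "poly_on K f" and x: "x \<in> K"
  shows "divg K (\<lambda>y. c *\<^sub>R grad K f y) x = c * laplacian K f x"
  unfolding laplacian_def divg_def
  using grad_cmult[OF K poly_on_gradient(2)[OF K f] x, where c = c] by (simp add: sum_distrib_left)

lemma poly_on_laplacian:
  assumes K: "solid_polytope K" and f: "poly_on K f"
  shows "poly_on K (laplacian K f)"
  unfolding laplacian_def[abs_def] divg_def
  by (intro poly_on_sum finite poly_on_gradient(2)[OF K] f)

lemma directional_derivative_interior:
  assumes K: "solid_polytope K" and f: "poly_on K f" and x: "x \<in> interior K"
  shows "((\<lambda>t. f (x + t *\<^sub>R e)) has_real_derivative grad K f x \<bullet> e) (at 0)"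
proof -
  have "x \<in> K" using x interior_subset by blast
  then have "(f has_derivative (\<lambda>v. grad K f x \<bullet> v)) (at x)"
    using poly_on_gradient(1)[OF K f, of x] at_within_interior[OF x] by simp
  then have "(f has_derivative (\<lambda>v. grad K f x \<bullet> v)) (at (x + 0 *\<^sub>R e))" by simp
  moreover have "((\<lambda>t. x + t *\<^sub>R e) has_derivative (\<lambda>t. t *\<^sub>R e)) (at 0)"
    by (auto intro!: derivative_eq_intros)
  ultimately have "((f \<circ> (\<lambda>t. x + t *\<^sub>R e)) has_derivative ((\<lambda>v. grad K f x \<bullet> v) \<circ> (\<lambda>t. t *\<^sub>R e))) (at 0)"
    by (intro diff_chain_at) auto
  then show ?thesis by (simp add: has_field_derivative_def o_def mult_commute_abs)
qed

text \<open>
  \<open>D i\<close> is the partial derivative of the component \<open>b i\<close> in the \<open>i\<close>-th coordinate on \<open>U\<close>, extended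
  continuously to \<open>S\<close>. Only these derivatives enter the divergence.
\<close>

definition C1_field :: "(real^'n) set \<Rightarrow> (real^'n) set \<Rightarrow> (real^'n \<Rightarrow> real^'n) \<Rightarrow> ('n \<Rightarrow> real^'n \<Rightarrow> real) \<Rightarrow> bool" where
  "C1_field S U b D \<longleftrightarrow> continuous_on S b \<and> (\<forall>i. continuous_on S (D i)) \<and>
     (\<forall>x\<in>U. \<forall>i. ((\<lambda>t. b (x + t *\<^sub>R axis i 1) $ i) has_real_derivative D i x) (at 0))"

lemma gauss_poly_field:
  fixes K :: "(real^'n) set"
  assumes K: "solid_polytope K" and w: "poly_on K w" and b: "C1_field K (interior K) b D"
  shows "vol_int K (\<lambda>x. grad K w x \<bullet> b x + w x * (\<Sum>i\<in>UNIV. D i x)) = bdry_int K (\<lambda>n x. w x * (b x \<bullet> n))"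
proof -
  have cw: "continuous_on K w" using w by (rule poly_on_continuous)
  have cb: "continuous_on K b" "\<And>i. continuous_on K (D i)" using b by (auto simp: C1_field_def)
  have "vol_int K (\<lambda>x. \<Sum>i\<in>UNIV. grad K w x $ i * b x $ i + w x * D i x) = bdry_int K (\<lambda>n x. (w x *\<^sub>R b x) \<bullet> n)"
  proof (rule gauss_polytope[OF K])
    show "continuous_on K (\<lambda>x. w x *\<^sub>R b x)" by (intro continuous_intros cw cb)
    show "continuous_on K (\<lambda>x. grad K w x $ i * b x $ i + w x * D i x)" for i
      by (intro continuous_intros cw cb continuous_on_grad K w)
    fix x i assume x: "x \<in> interior K"
    have "((\<lambda>t. b (x + t *\<^sub>R axis i 1) $ i) has_real_derivative D i x) (at 0)"
      using b x by (auto simp: C1_field_def)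
    from DERIV_mult[OF directional_derivative_interior[OF K w x, of "axis i 1"] this]
    show "((\<lambda>t. (w (x + t *\<^sub>R axis i 1) *\<^sub>R b (x + t *\<^sub>R axis i 1)) $ i) has_real_derivative
             grad K w x $ i * b x $ i + w x * D i x) (at 0)"
      by (simp add: inner_axis mult.commute add.commute)
  qed
  then show ?thesis by (simp add: sum.distrib inner_vec_def sum_distrib_left mult.assoc)
qed

lemma C1_field_grad:
  fixes K :: "(real^'n) set"
  assumes K: "solid_polytope K" and f: "poly_on K f"
  shows "C1_field K (interior K) (grad K f) (\<lambda>i x. grad K (\<lambda>y. grad K f y $ i) x $ i)"
  unfolding C1_field_def
proof (intro conjI allI ballI)
  fix i :: 'n
  note fi = poly_on_gradient(2)[OF K f, of i]
  show "continuous_on K (\<lambda>x. grad K (\<lambda>y. grad K f y $ i) x $ i)"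
    by (intro poly_on_continuous poly_on_gradient(2)[OF K] fi)
  fix x assume "x \<in> interior K"
  from directional_derivative_interior[OF K fi this, of "axis i 1"]
  show "((\<lambda>t. grad K f (x + t *\<^sub>R axis i 1) $ i) has_real_derivative grad K (\<lambda>y. grad K f y $ i) x $ i) (at 0)"
    by (simp add: inner_axis)
qed (rule continuous_on_grad[OF K f])

lemma green_poly:
  assumes K: "solid_polytope K" and w: "poly_on K w" and f: "poly_on K f"
  shows "vol_int K (\<lambda>x. grad K w x \<bullet> grad K f x + w x * laplacian K f x) = bdry_int K (\<lambda>n x. w x * (grad K f x \<bullet> n))"
  using gauss_poly_field[OF K w C1_field_grad[OF K f]] by (simp add: laplacian_def divg_def)

section \<open>Continuous functions on an element and the projection to local polynomials\<close>

text \<open>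
  A nonempty open set is not a null set.
\<close>

lemma open_AE_imp_all:
  fixes U :: "'a::euclidean_space set"
  assumes U: "open U" and c: "open {x \<in> U. \<not> P x}" and ae: "AE x in lebesgue. x \<in> U \<longrightarrow> P x" and x: "x \<in> U"
  shows "P x"
proof -
  have "{x \<in> U. \<not> P x} \<in> null_sets lebesgue"
    using ae completion.AE_iff_null_sets[of "\<lambda>x. x \<in> U \<longrightarrow> P x" lborel] by (simp add: not_imp)
  then have "negligible {x \<in> U. \<not> P x}" by (simp add: negligible_iff_null_sets)
  then have "{x \<in> U. \<not> P x} = {}" using open_not_negligible[OF c] by blast
  then show ?thesis using x by blast
qed

lemma solid_polytope_closure_interior: "solid_polytope K \<Longrightarrow> closure (interior K) = K"
  using convex_closure_interior[of K] solid_polytope_compact[of K] solid_polytope_convex[of K]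
  by (simp add: solid_polytope_def compact_imp_closed)

lemma le_on_solid_polytope:
  fixes f :: "real^'n \<Rightarrow> real"
  assumes K: "solid_polytope K" and f: "continuous_on K f" and le: "\<And>x. x \<in> interior K \<Longrightarrow> f x \<le> c" and x: "x \<in> K"
  shows "f x \<le> c"
  using continuous_le_on_closure[of "interior K" f x c] solid_polytope_closure_interior[OF K] f le x by simp

text \<open>
  The set where \<open>f > 0\<close> is open inside the element and null, hence empty; the interior is dense in \<open>K\<close>.
\<close>

lemma vol_int_eq_0_imp_zero:
  fixes f :: "real^'n \<Rightarrow> real"
  assumes K: "solid_polytope K" and f: "continuous_on K f" and nn: "\<And>x. x \<in> K \<Longrightarrow> f x \<ge> 0"
    and z: "vol_int K f = 0" and x: "x \<in> K"
  shows "f x = 0"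
proof -
  have cK: "compact K" by (rule solid_polytope_compact[OF K])
  have "(LINT x|lborel. indicator K x * f x) = 0" using z by (simp add: vol_int_eq_lborel[OF cK f])
  then have "AE x in lborel. indicator K x * f x = 0"
    using integral_nonneg_eq_0_iff_AE[OF bdd_supp_borel_integrable[OF bdd_supp_borel_indicator[OF cK f]]] nn
    by (auto simp: indicator_def)
  then have "AE x in lebesgue. indicator K x * f x = 0" by (rule AE_completion)
  then have ae: "AE x in lebesgue. x \<in> interior K \<longrightarrow> f x \<le> 0"
  proof eventually_elim
    case (elim y) then show ?case using interior_subset[of K] by (auto simp: indicator_def split: if_splits)
  qed
  have "open {x \<in> interior K. \<not> f x \<le> 0}"
  proof -
    have "open (interior K \<inter> f -` {0<..})"
      using continuous_on_subset[OF f interior_subset] by (intro continuous_open_preimage) auto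
    then show ?thesis by (simp add: Int_def vimage_def not_le)
  qed
  then have "f x \<le> 0" if "x \<in> interior K" for x using open_AE_imp_all[OF open_interior _ ae that] by simp
  then have "f x \<le> 0" using le_on_solid_polytope[OF K f _ x] by blast
  then show ?thesis using nn[OF x] by simp
qed

text \<open>
  For a continuous field the essential supremum bounds every value, also on the boundary, where
  traces of \<open>a\<close> are taken. It is finite because \<open>K\<close> is compact.
\<close>

lemma norm_le_norm_inf:
  fixes a :: "real^'n \<Rightarrow> real^'n"
  assumes K: "solid_polytope K" and a: "continuous_on K a" and x: "x \<in> K"
  shows "norm (a x) \<le> norm_inf K a"
proof -
  have cK: "compact K" by (rule solid_polytope_compact[OF K])
  have mK: "K \<in> sets lebesgue" using cK by (simp add: borel_compact)
  have cn: "continuous_on K (\<lambda>x. norm (a x))" by (intro continuous_intros a)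
  obtain B where B: "\<And>x. x \<in> K \<Longrightarrow> norm (a x) \<le> B"
    using compact_imp_bounded[OF compact_continuous_image[OF a cK]] by (auto simp: bounded_iff)
  define e where "e = esssup (lebesgue_on K) (\<lambda>x. ereal (norm (a x)))"
  have meas: "(\<lambda>x. ereal (norm (a x))) \<in> borel_measurable (lebesgue_on K)"
    using continuous_imp_measurable_on_sets_lebesgue[OF cn mK] by simp
  have "AE x in lebesgue_on K. ereal (norm (a x)) \<le> ereal B"
    using B by (intro AE_I2) simp
  then have eB: "e \<le> ereal B" unfolding e_def using meas by blast
  have "AE x in lebesgue_on K. ereal (norm (a x)) \<le> e" unfolding e_def by (rule esssup_AE)
  then have "AE x in lebesgue. x \<in> K \<longrightarrow> ereal (norm (a x)) \<le> e"
    using AE_restrict_space_iff[of K lebesgue] mK by simp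
  then have ae: "AE x in lebesgue. x \<in> interior K \<longrightarrow> ereal (norm (a x)) \<le> e"
    by eventually_elim (use interior_subset in blast)
  have "open {x \<in> interior K. \<not> ereal (norm (a x)) \<le> e}"
  proof -
    have "continuous_on (interior K) (\<lambda>x. ereal (norm (a x)))"
      using continuous_on_subset[OF cn interior_subset] by (rule continuous_on_ereal)
    then have "open (interior K \<inter> (\<lambda>x. ereal (norm (a x))) -` {e<..})"
      by (intro continuous_open_preimage) auto
    then show ?thesis by (simp add: Int_def vimage_def not_le)
  qed
  then have le: "ereal (norm (a x)) \<le> e" if "x \<in> interior K" for x
    using open_AE_imp_all[OF open_interior _ ae that] by simp
  obtain x0 where "x0 \<in> interior K" using K by (auto simp: solid_polytope_def)
  then have "e \<ge> ereal (norm (a x0))" by (rule le)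
  then obtain r where r: "e = ereal r" using eB by (cases e) auto
  have "norm (a x) \<le> r"
    by (rule le_on_solid_polytope[OF K cn _ x]) (use le r in auto)
  then show ?thesis by (simp add: norm_inf_def e_def[symmetric] r)
qed

lemma finite_multi_indices: "finite {\<alpha>::'n::finite \<Rightarrow> nat. \<forall>i. \<alpha> i \<le> p}"
proof -
  have "{\<alpha>::'n \<Rightarrow> nat. \<forall>i. \<alpha> i \<le> p} = PiE UNIV (\<lambda>_. {..p})" by (auto simp: PiE_def extensional_def)
  then show ?thesis by (simp add: finite_PiE)
qed

lemma monomial_polynomial: "real_polynomial_function (\<lambda>x::real^'n. \<Prod>i\<in>UNIV. (x $ i) ^ \<alpha> i)"
  by (intro real_polynomial_function_prod real_polynomial_function_power finite
      real_polynomial_function.intros(1) bounded_linear_vec_nth)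

lemma affine_iso_inverse:
  fixes F :: "real^'n \<Rightarrow> real^'n"
  assumes "affine_iso F"
  obtains G where "polynomial_function G" "\<And>x. F (G x) = x" "\<And>x. G (F x) = x"
proof -
  obtain A b where A: "linear A" "inj A" "F = (\<lambda>x. A x + b)" using assms by (auto simp: affine_iso_def)
  obtain B where B: "linear B" "\<And>x. B (A x) = x" "\<And>x. A (B x) = x"
    using linear_injective_isomorphism[OF A(1,2)] by auto
  show ?thesis
  proof
    show "polynomial_function (\<lambda>x. B (x - b))"
    proof -
      have "polynomial_function B"
        using B(1) by (intro polynomial_function_bounded_linear) (rule linear_conv_bounded_linear[THEN iffD1])
      then have "polynomial_function (B \<circ> (\<lambda>x. x - b))" by (intro polynomial_function_compose) auto
      then show ?thesis by (simp add: o_def)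
    qed
  qed (simp_all add: A B)
qed

text \<open>
  A spanning family of polynomials. On a parallelotope it consists of the monomials in the reference coordinates.
\<close>

definition poly_span :: "'i set \<Rightarrow> ('i \<Rightarrow> real^'n \<Rightarrow> real) \<Rightarrow> (real^'n \<Rightarrow> real) set \<Rightarrow> bool" where
  "poly_span A \<phi> W \<longleftrightarrow> finite A \<and> (\<forall>\<alpha>. real_polynomial_function (\<phi> \<alpha>)) \<and>
     W = {q. \<exists>c. q = (\<lambda>x. \<Sum>\<alpha>\<in>A. c \<alpha> * \<phi> \<alpha> x)}"

text \<open>
  Composition with the inverse of the affine map turns a tensor-product polynomial in the reference
  coordinates into a polynomial in space.
\<close>

lemma local_polys_span:
  fixes FK :: "real^'n \<Rightarrow> real^'n"
  assumes F: "affine_iso FK"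
  shows "\<exists>(A :: ('n \<Rightarrow> nat) set) \<phi>. poly_span A \<phi> (local_polys et p FK)"
proof (cases et)
  case Simplex
  have "{\<alpha>::'n \<Rightarrow> nat. (\<Sum>i\<in>UNIV. \<alpha> i) \<le> p} \<subseteq> {\<alpha>. \<forall>i. \<alpha> i \<le> p}"
  proof (intro subsetI CollectI allI)
    fix \<alpha> :: "'n \<Rightarrow> nat" and i
    assume "\<alpha> \<in> {\<alpha>. (\<Sum>i\<in>UNIV. \<alpha> i) \<le> p}"
    then show "\<alpha> i \<le> p" using member_le_sum[of i UNIV \<alpha>] by simp
  qed
  then have "finite {\<alpha>::'n \<Rightarrow> nat. (\<Sum>i\<in>UNIV. \<alpha> i) \<le> p}"
    using finite_multi_indices finite_subset by blast
  then show ?thesis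
    unfolding poly_span_def
    by (intro exI conjI allI) (auto simp: local_polys_def Simplex total_degree_polys_def monomial_polynomial)
next
  case Parallelotope
  obtain G where G: "polynomial_function G" "\<And>x. FK (G x) = x" "\<And>x. G (FK x) = x"
    using affine_iso_inverse[OF F] by metis
  let ?m = "\<lambda>(\<alpha>::'n \<Rightarrow> nat) (x::real^'n). \<Prod>i\<in>UNIV. (x $ i) ^ \<alpha> i"
  let ?A = "{\<alpha>::'n \<Rightarrow> nat. \<forall>i. \<alpha> i \<le> p}"
  show ?thesis
    unfolding poly_span_def
  proof (intro exI[of _ ?A] exI[of _ "\<lambda>\<alpha>. ?m \<alpha> \<circ> G"] conjI allI)
    show "finite ?A" by (rule finite_multi_indices)
    show "real_polynomial_function (?m \<alpha> \<circ> G)" for \<alpha>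
      by (rule real_polynomial_function_compose[OF G(1) monomial_polynomial])
    have "q \<circ> FK = (\<lambda>x. \<Sum>\<alpha>\<in>?A. c \<alpha> * ?m \<alpha> x) \<longleftrightarrow> q = (\<lambda>x. \<Sum>\<alpha>\<in>?A. c \<alpha> * (?m \<alpha> \<circ> G) x)" for q c
    proof
      assume "q \<circ> FK = (\<lambda>x. \<Sum>\<alpha>\<in>?A. c \<alpha> * ?m \<alpha> x)"
      then have "(q \<circ> FK) (G x) = (\<Sum>\<alpha>\<in>?A. c \<alpha> * ?m \<alpha> (G x))" for x by simp
      then show "q = (\<lambda>x. \<Sum>\<alpha>\<in>?A. c \<alpha> * (?m \<alpha> \<circ> G) x)" by (simp add: G(2) fun_eq_iff)
    qed (simp add: G(3) fun_eq_iff)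
    then show "local_polys et p FK = {q. \<exists>c. q = (\<lambda>x. \<Sum>\<alpha>\<in>?A. c \<alpha> * (?m \<alpha> \<circ> G) x)}"
      by (simp add: local_polys_def Parallelotope tensor_polys_def)
  qed
qed

lemma local_polys_polynomial:
  fixes FK :: "real^'n \<Rightarrow> real^'n"
  assumes "affine_iso FK" "q \<in> local_polys et p FK" shows "real_polynomial_function q"
proof -
  obtain A :: "('n \<Rightarrow> nat) set" and \<phi> where A0: "poly_span A \<phi> (local_polys et p FK)"
    using local_polys_span[OF assms(1)] by blast
  have A: "finite A" "\<And>\<alpha>. real_polynomial_function (\<phi> \<alpha>)"
    "local_polys et p FK = {q. \<exists>c. q = (\<lambda>x. \<Sum>\<alpha>\<in>A. c \<alpha> * \<phi> \<alpha> x)}"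
    using A0 unfolding poly_span_def by auto
  then show ?thesis using assms(2)
    by (auto intro!: real_polynomial_function_sum real_polynomial_function.intros(2,4))
qed

lemma local_polys_lincomb:
  fixes FK :: "real^'n \<Rightarrow> real^'n"
  assumes "affine_iso FK" "q \<in> local_polys et p FK" "r \<in> local_polys et p FK"
  shows "(\<lambda>x. q x + s * r x) \<in> local_polys et p FK"
proof -
  obtain A :: "('n \<Rightarrow> nat) set" and \<phi> where A0: "poly_span A \<phi> (local_polys et p FK)"
    using local_polys_span[OF assms(1)] by blast
  have A': "finite A" "\<And>\<alpha>. real_polynomial_function (\<phi> \<alpha>)"
    and A: "local_polys et p FK = {q. \<exists>c. q = (\<lambda>x. \<Sum>\<alpha>\<in>A. c \<alpha> * \<phi> \<alpha> x)}"
    using A0 unfolding poly_span_def by auto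
  have "\<exists>c. q = (\<lambda>x. \<Sum>\<alpha>\<in>A. c \<alpha> * \<phi> \<alpha> x)" "\<exists>d. r = (\<lambda>x. \<Sum>\<alpha>\<in>A. d \<alpha> * \<phi> \<alpha> x)"
    using assms(2,3) unfolding A mem_Collect_eq .
  then obtain c d where "q = (\<lambda>x. \<Sum>\<alpha>\<in>A. c \<alpha> * \<phi> \<alpha> x)" "r = (\<lambda>x. \<Sum>\<alpha>\<in>A. d \<alpha> * \<phi> \<alpha> x)"
    by (elim exE)
  then have "(\<lambda>x. q x + s * r x) = (\<lambda>x. \<Sum>\<alpha>\<in>A. (c \<alpha> + s * d \<alpha>) * \<phi> \<alpha> x)"
    by (auto simp: sum_distrib_left sum.distrib[symmetric] algebra_simps)
  then show ?thesis unfolding A mem_Collect_eq by (rule exI[of _ "\<lambda>\<alpha>. c \<alpha> + s * d \<alpha>"])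
qed

lemma local_polys_zero:
  fixes FK :: "real^'n \<Rightarrow> real^'n"
  assumes "affine_iso FK" shows "(\<lambda>_. 0) \<in> local_polys et p FK"
proof -
  obtain A :: "('n \<Rightarrow> nat) set" and \<phi> where A0: "poly_span A \<phi> (local_polys et p FK)"
    using local_polys_span[OF assms] by blast
  have A': "finite A" "\<And>\<alpha>. real_polynomial_function (\<phi> \<alpha>)"
    and A: "local_polys et p FK = {q. \<exists>c. q = (\<lambda>x. \<Sum>\<alpha>\<in>A. c \<alpha> * \<phi> \<alpha> x)}"
    using A0 unfolding poly_span_def by auto
  show ?thesis unfolding A mem_Collect_eq by (rule exI[of _ "\<lambda>_. 0"]) simp
qed

text \<open>
  Gram-Schmidt by induction on the family. The new function is first made orthogonal to the old ones; if
  the remainder \<open>\<psi>\<close> vanishes, the old approximation is already orthogonal to the new function, otherwise the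
  component of the residual along \<open>\<psi>\<close> is subtracted.
\<close>

lemma l2_best_approximation_exists:
  fixes K :: "(real^'n) set"
  assumes K: "solid_polytope K" and A: "finite A" and \<phi>: "\<And>\<alpha>. \<alpha> \<in> A \<Longrightarrow> continuous_on K (\<phi> \<alpha>)"
    and f: "continuous_on K f"
  shows "\<exists>c. \<forall>\<beta>\<in>A. vol_int K (\<lambda>x. (f x - (\<Sum>\<alpha>\<in>A. c \<alpha> * \<phi> \<alpha> x)) * \<phi> \<beta> x) = 0"
  using A \<phi> f
proof (induction A arbitrary: f rule: finite_induct)
  case empty
  then show ?case by simp
next
  case (insert k A)
  note cK = solid_polytope_compact[OF K]
  have c\<phi>: "continuous_on K (\<phi> \<alpha>)" if "\<alpha> \<in> insert k A" for \<alpha> using insert.prems that by blast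
  have cf: "continuous_on K f" by fact
  obtain c where c: "\<And>\<beta>. \<beta> \<in> A \<Longrightarrow> vol_int K (\<lambda>x. (f x - (\<Sum>\<alpha>\<in>A. c \<alpha> * \<phi> \<alpha> x)) * \<phi> \<beta> x) = 0"
    using insert.IH[of f] insert.prems by auto
  obtain d where d: "\<And>\<beta>. \<beta> \<in> A \<Longrightarrow> vol_int K (\<lambda>x. (\<phi> k x - (\<Sum>\<alpha>\<in>A. d \<alpha> * \<phi> \<alpha> x)) * \<phi> \<beta> x) = 0"
    using insert.IH[of "\<phi> k"] insert.prems by auto
  define r where "r x = f x - (\<Sum>\<alpha>\<in>A. c \<alpha> * \<phi> \<alpha> x)" for x
  define \<psi> where "\<psi> x = \<phi> k x - (\<Sum>\<alpha>\<in>A. d \<alpha> * \<phi> \<alpha> x)" for x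
  have cr: "continuous_on K r" unfolding r_def by (intro continuous_intros cf c\<phi>) auto
  have c\<psi>: "continuous_on K \<psi>" unfolding \<psi>_def by (intro continuous_intros c\<phi>) auto
  have orth: "vol_int K (\<lambda>x. g x * (\<Sum>\<alpha>\<in>A. d \<alpha> * \<phi> \<alpha> x)) = 0"
    if g: "continuous_on K g" and o: "\<And>\<beta>. \<beta> \<in> A \<Longrightarrow> vol_int K (\<lambda>x. g x * \<phi> \<beta> x) = 0" for g
  proof -
    have "vol_int K (\<lambda>x. g x * (\<Sum>\<alpha>\<in>A. d \<alpha> * \<phi> \<alpha> x)) = vol_int K (\<lambda>x. \<Sum>\<alpha>\<in>A. d \<alpha> * (g x * \<phi> \<alpha> x))"
      by (simp add: sum_distrib_left mult.left_commute)
    also have "\<dots> = (\<Sum>\<alpha>\<in>A. vol_int K (\<lambda>x. d \<alpha> * (g x * \<phi> \<alpha> x)))"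
      by (rule vol_int_sum[OF cK insert.hyps(1)]) (auto intro!: continuous_intros g c\<phi>)
    also have "\<dots> = 0" using o by simp
    finally show ?thesis .
  qed
  have ck: "continuous_on K (\<lambda>x. \<Sum>\<alpha>\<in>A. d \<alpha> * \<phi> \<alpha> x)" by (intro continuous_intros c\<phi>) auto
  have tok: "vol_int K (\<lambda>x. g x * \<phi> k x) = vol_int K (\<lambda>x. g x * \<psi> x)"
    if g: "continuous_on K g" and o: "\<And>\<beta>. \<beta> \<in> A \<Longrightarrow> vol_int K (\<lambda>x. g x * \<phi> \<beta> x) = 0" for g
  proof -
    have "vol_int K (\<lambda>x. g x * \<phi> k x) = vol_int K (\<lambda>x. g x * \<psi> x + g x * (\<Sum>\<alpha>\<in>A. d \<alpha> * \<phi> \<alpha> x))"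
      by (simp add: \<psi>_def algebra_simps)
    also have "\<dots> = vol_int K (\<lambda>x. g x * \<psi> x) + vol_int K (\<lambda>x. g x * (\<Sum>\<alpha>\<in>A. d \<alpha> * \<phi> \<alpha> x))"
      by (rule vol_int_add[OF cK]) (intro continuous_intros g c\<psi> ck)+
    finally show ?thesis using orth[OF g o] by simp
  qed
  define t where "t = vol_int K (\<lambda>x. r x * \<psi> x) / vol_int K (\<lambda>x. \<psi> x * \<psi> x)"
  have t: "vol_int K (\<lambda>x. r x * \<psi> x) = t * vol_int K (\<lambda>x. \<psi> x * \<psi> x)"
  proof (cases "vol_int K (\<lambda>x. \<psi> x * \<psi> x) = 0")
    case True
    have "\<psi> x * \<psi> x = 0" if "x \<in> K" for x
      by (rule vol_int_eq_0_imp_zero[OF K _ _ True that]) (auto intro!: continuous_intros c\<psi>)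
    then have "vol_int K (\<lambda>x. r x * \<psi> x) = vol_int K (\<lambda>x. 0)" by (intro vol_int_cong) auto
    then show ?thesis using True by simp
  qed (simp add: t_def)
  define g where "g x = r x - t * \<psi> x" for x
  have cg: "continuous_on K g" unfolding g_def by (intro continuous_intros cr c\<psi>)
  have gmul: "vol_int K (\<lambda>x. g x * w x) = vol_int K (\<lambda>x. r x * w x) - t * vol_int K (\<lambda>x. \<psi> x * w x)"
    if w: "continuous_on K w" for w
  proof -
    have "vol_int K (\<lambda>x. g x * w x) = vol_int K (\<lambda>x. r x * w x + (- t) * (\<psi> x * w x))"
      by (simp add: g_def algebra_simps)
    also have "\<dots> = vol_int K (\<lambda>x. r x * w x) + vol_int K (\<lambda>x. (- t) * (\<psi> x * w x))"
      by (rule vol_int_add[OF cK]) (intro continuous_intros cr c\<psi> w)+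
    finally show ?thesis by (simp only: vol_int_cmult)
  qed
  have gA: "vol_int K (\<lambda>x. g x * \<phi> \<beta> x) = 0" if "\<beta> \<in> A" for \<beta>
    using gmul[OF c\<phi>, of \<beta>] c[OF that] d[OF that] that by (simp add: r_def \<psi>_def)
  have gk: "vol_int K (\<lambda>x. g x * \<phi> k x) = 0"
  proof -
    have "vol_int K (\<lambda>x. g x * \<phi> k x) = vol_int K (\<lambda>x. g x * \<psi> x)" by (rule tok[OF cg gA])
    also have "\<dots> = vol_int K (\<lambda>x. r x * \<psi> x) - t * vol_int K (\<lambda>x. \<psi> x * \<psi> x)" by (rule gmul[OF c\<psi>])
    finally show ?thesis using t by simp
  qed
  \<comment> \<open>The coefficients of the old approximation plus \<open>t \<psi>\<close>, expanded in the family.\<close>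
  define c' where "c' \<alpha> = (if \<alpha> = k then t else c \<alpha> - t * d \<alpha>)" for \<alpha>
  have "f x - (\<Sum>\<alpha>\<in>insert k A. c' \<alpha> * \<phi> \<alpha> x) = g x" for x
  proof -
    have "(\<Sum>\<alpha>\<in>A. c' \<alpha> * \<phi> \<alpha> x) = (\<Sum>\<alpha>\<in>A. c \<alpha> * \<phi> \<alpha> x - t * (d \<alpha> * \<phi> \<alpha> x))"
      using insert.hyps(2) by (intro sum.cong) (auto simp: c'_def algebra_simps)
    then have "(\<Sum>\<alpha>\<in>A. c' \<alpha> * \<phi> \<alpha> x) = (\<Sum>\<alpha>\<in>A. c \<alpha> * \<phi> \<alpha> x) - t * (\<Sum>\<alpha>\<in>A. d \<alpha> * \<phi> \<alpha> x)"
      by (simp add: sum_subtractf sum_distrib_left)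
    then show ?thesis using insert.hyps by (simp add: c'_def g_def r_def \<psi>_def algebra_simps)
  qed
  then show ?case using gA gk by (intro exI[of _ c']) simp
qed

text \<open>
  Two solutions differ by a polynomial of norm zero on \<open>K\<close>. It vanishes on the interior of \<open>K\<close> and hence
  everywhere, so that the description which defines the projector has exactly one solution.
\<close>

lemma l2_projector:
  fixes K :: "(real^'n) set" and p :: nat and et :: element_type
  assumes K: "solid_polytope K" and F: "affine_iso FK" and f: "continuous_on K f"
  defines "W \<equiv> local_polys et p FK"
  shows "l2_projector K W f \<in> W" 
    and "w \<in> W \<Longrightarrow> vol_int K (\<lambda>x. (f x - l2_projector K W f x) * w x) = 0"
proof -
  note cK = solid_polytope_compact[OF K]
  define P where "P g \<longleftrightarrow> g \<in> W \<and> (\<forall>w\<in>W. vol_int K (\<lambda>x. (f x - g x) * w x) = 0)" for g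
  obtain A :: "('n \<Rightarrow> nat) set" and \<phi> where A0: "poly_span A \<phi> (local_polys et p FK)"
    using local_polys_span[OF F] by blast
  have A: "finite A" "\<And>\<alpha>. real_polynomial_function (\<phi> \<alpha>)"
    "W = {q. \<exists>c. q = (\<lambda>x. \<Sum>\<alpha>\<in>A. c \<alpha> * \<phi> \<alpha> x)}"
    using A0 unfolding poly_span_def W_def by auto
  have c\<phi>: "continuous_on K (\<phi> \<alpha>)" for \<alpha> using A(2) by (rule continuous_real_polynomial)
  have cW: "continuous_on K w" if "w \<in> W" for w
    using that local_polys_polynomial[OF F] unfolding W_def by (blast intro: continuous_real_polynomial)
  obtain c where c: "\<And>\<beta>. \<beta> \<in> A \<Longrightarrow> vol_int K (\<lambda>x. (f x - (\<Sum>\<alpha>\<in>A. c \<alpha> * \<phi> \<alpha> x)) * \<phi> \<beta> x) = 0"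
    using l2_best_approximation_exists[of K A \<phi> f] K A(1) c\<phi> f by blast
  define g where "g = (\<lambda>x. \<Sum>\<alpha>\<in>A. c \<alpha> * \<phi> \<alpha> x)"
  have cg: "continuous_on K g" unfolding g_def by (intro continuous_intros c\<phi>)
  have "P g"
    unfolding P_def
  proof (intro conjI ballI)
    show "g \<in> W" unfolding A(3) g_def by blast
    fix w assume "w \<in> W"
    then obtain d where w: "w = (\<lambda>x. \<Sum>\<alpha>\<in>A. d \<alpha> * \<phi> \<alpha> x)" unfolding A(3) by blast
    have "vol_int K (\<lambda>x. (f x - g x) * w x) = vol_int K (\<lambda>x. \<Sum>\<alpha>\<in>A. d \<alpha> * ((f x - g x) * \<phi> \<alpha> x))"
      by (simp add: w sum_distrib_left mult.left_commute)
    also have "\<dots> = (\<Sum>\<alpha>\<in>A. vol_int K (\<lambda>x. d \<alpha> * ((f x - g x) * \<phi> \<alpha> x)))"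
      by (rule vol_int_sum[OF cK A(1)]) (intro continuous_intros f cg c\<phi>)
    also have "\<dots> = 0" using c by (simp add: g_def)
    finally show "vol_int K (\<lambda>x. (f x - g x) * w x) = 0" .
  qed
  moreover have "g' = g" if "P g'" for g'
  proof -
    have g': "g' \<in> W" and g: "g \<in> W" using that \<open>P g\<close> by (auto simp: P_def)
    define w where "w x = g' x - g x" for x
    have wW: "w \<in> W" using local_polys_lincomb[OF F g'[unfolded W_def] g[unfolded W_def], of "-1"]
      by (simp add: w_def[abs_def] W_def)
    have cw: "continuous_on K w" "continuous_on K g'" using cW wW g' by blast+
    have "vol_int K (\<lambda>x. w x * w x) = vol_int K (\<lambda>x. (f x - g x) * w x + (-1) * ((f x - g' x) * w x))"
      by (simp add: w_def algebra_simps)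
    also have "\<dots> = vol_int K (\<lambda>x. (f x - g x) * w x) + vol_int K (\<lambda>x. (-1) * ((f x - g' x) * w x))"
      by (rule vol_int_add[OF cK]) (intro continuous_intros f cg cw)+
    also have "\<dots> = 0" using that \<open>P g\<close> wW unfolding P_def by (simp only: vol_int_cmult)
    finally have z: "vol_int K (\<lambda>x. w x * w x) = 0" .
    have "w x * w x = 0" if "x \<in> K" for x
      by (rule vol_int_eq_0_imp_zero[OF K _ _ z that]) (auto intro!: continuous_intros cw)
    then have "w x = 0" if "x \<in> interior K" for x using that interior_subset[of K] by auto
    then have "w = (\<lambda>_. 0)"
      using K local_polys_polynomial[OF F wW[unfolded W_def]]
      by (intro real_polynomial_zero_on_open[of w "interior K"]) (auto simp: solid_polytope_def)
    then show "g' = g" by (simp add: w_def fun_eq_iff)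
  qed
  ultimately have "(THE g. P g) = g" by (intro the_equality)
  then have "l2_projector K W f = g" by (simp add: l2_projector_def P_def)
  then show "l2_projector K W f \<in> W" 
    and "w \<in> W \<Longrightarrow> vol_int K (\<lambda>x. (f x - l2_projector K W f x) * w x) = 0"
    using \<open>P g\<close> by (auto simp: P_def)
qed

section \<open>Integration over a mesh\<close>

text \<open>
  The Lebesgue measure is complete, so that \<open>f\<close> inherits measurability from \<open>g\<close>. This is what allows
  integrands such as gradients on the domain, whose values on the faces of the mesh are arbitrary.
\<close>

lemma lebesgue_integral_cong_AE:
  fixes f g :: "'a::euclidean_space \<Rightarrow> real"
  assumes g: "g \<in> borel_measurable borel" and ae: "AE x in lborel. f x = g x"
  shows "integral\<^sup>L lebesgue f = integral\<^sup>L lborel g"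
proof -
  have ae': "AE x in lebesgue. f x = g x" using ae by (rule AE_completion)
  have g': "g \<in> borel_measurable lebesgue" using g by (intro measurable_completion) simp
  have f': "f \<in> borel_measurable lebesgue"
  proof (rule measurableI)
    fix B :: "real set" assume B: "B \<in> sets borel"
    show "f -` B \<inter> space lebesgue \<in> sets lebesgue"
    proof (rule completion.in_sets_AE)
      show "AE x in lebesgue. x \<in> g -` B \<inter> space lebesgue \<longleftrightarrow> x \<in> f -` B \<inter> space lebesgue"
        using ae' by eventually_elim simp
      show "g -` B \<inter> space lebesgue \<in> sets lebesgue" using g' B by (rule measurable_sets)
    qed simp
  qed simp
  have "integral\<^sup>L lebesgue f = integral\<^sup>L lebesgue g" by (rule integral_cong_AE[OF f' g' ae'])
  also have "\<dots> = integral\<^sup>L lborel g" using g by (intro integral_completion) simp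
  finally show ?thesis .
qed

text \<open>
  The consequences of conformity for integration: the elements overlap only in their boundaries.
\<close>

definition solid_mesh :: "(real^'n) set \<Rightarrow> (real^'n) set set \<Rightarrow> bool" where
  "solid_mesh \<Omega> M \<longleftrightarrow> finite M \<and> closure \<Omega> = \<Union>M \<and> (\<forall>K\<in>M. solid_polytope K) \<and>
     (\<forall>K\<in>M. \<forall>L\<in>M. K \<noteq> L \<longrightarrow> interior K \<inter> interior L = {}) \<and> open \<Omega> \<and> interior (closure \<Omega>) = \<Omega>"

lemma solid_mesh_open: "solid_mesh \<Omega> M \<Longrightarrow> open \<Omega>"
  unfolding solid_mesh_def by (elim conjE)

lemma solid_mesh_element: "solid_mesh \<Omega> M \<Longrightarrow> K \<in> M \<Longrightarrow> solid_polytope K"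
  unfolding solid_mesh_def by (elim conjE) (rule bspec)

lemma solid_mesh_finite: "solid_mesh \<Omega> M \<Longrightarrow> finite M"
  unfolding solid_mesh_def by (elim conjE)

lemma solid_mesh_cover: "solid_mesh \<Omega> M \<Longrightarrow> closure \<Omega> = \<Union>M"
  unfolding solid_mesh_def by (elim conjE)

lemma solid_polytope_reference_element: "solid_polytope (reference_element et :: (real^'n) set)"
proof (cases et)
  case Simplex
  have "polytope (convex hull (insert 0 Basis :: (real^'n) set))" 
    unfolding polytope_def by (intro exI[of _ "insert 0 Basis"]) simp
  moreover obtain a :: "real^'n" where "a \<in> interior (convex hull (insert 0 Basis))"
    by (rule interior_std_simplex_nonempty)
  ultimately show ?thesis by (auto simp: solid_polytope_def reference_element_def Simplex)
next
  case Parallelotope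
  have "box 0 (One :: real^'n) \<noteq> {}" by (simp add: box_ne_empty)
  then show ?thesis
    by (simp add: solid_polytope_def reference_element_def Parallelotope polytope_interval)
qed

lemma solid_polytope_affine_image:
  fixes F :: "real^'n \<Rightarrow> real^'n"
  assumes F: "affine_iso F" and S: "solid_polytope S"
  shows "solid_polytope (F ` S)"
proof -
  obtain A b where A: "linear A" "inj A" "F = (\<lambda>x. A x + b)" using F by (auto simp: affine_iso_def)
  have eq: "F ` S = (+) b ` (A ` S)" by (auto simp: A(3) image_image add.commute)
  have "polytope (A ` S)" using A(1) S by (simp add: polytope_linear_image solid_polytope_def)
  moreover have "interior (A ` S) \<noteq> {}"
    using interior_injective_linear_image[OF A(1,2)] S by (simp add: solid_polytope_def)
  ultimately show ?thesis
    unfolding eq solid_polytope_def by (simp add: polytope_translation_eq interior_translation)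
qed

text \<open>
  The intersection of two elements is a face of both. If it contains an interior point of each, then
  it is equal to each.
\<close>

lemma conforming_mesh_solid:
  assumes dom: "polytopal_domain \<Omega>" and mesh: "conforming_mesh et \<Omega> M F"
  shows "solid_mesh \<Omega> M"
proof -
  have sol: "solid_polytope K" if "K \<in> M" for K
    using mesh that solid_polytope_affine_image[of "F K", OF _ solid_polytope_reference_element, of et]
    by (auto simp: conforming_mesh_def)
  have "interior K \<inter> interior L = {}" if KL: "K \<in> M" "L \<in> M" "K \<noteq> L" for K L
  proof (rule ccontr)
    assume "interior K \<inter> interior L \<noteq> {}"
    then obtain x where x: "x \<in> interior K" "x \<in> interior L" by blast
    then have "x \<in> K \<inter> L" using interior_subset by blast
    have f: "(K \<inter> L) face_of K" "(K \<inter> L) face_of L" using mesh KL by (auto simp: conforming_mesh_def)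
    have "K \<inter> L = K" using face_of_disjoint_interior[OF f(1)] x(1) \<open>x \<in> K \<inter> L\<close> by blast
    moreover have "K \<inter> L = L" using face_of_disjoint_interior[OF f(2)] x(2) \<open>x \<in> K \<inter> L\<close> by blast
    ultimately show False using KL(3) by blast
  qed
  then show ?thesis using dom mesh sol
    by (auto simp: solid_mesh_def conforming_mesh_def polytopal_domain_def)
qed

lemma solid_mesh_interior_subset:
  assumes "solid_mesh \<Omega> M" "K \<in> M" shows "interior K \<subseteq> \<Omega>"
proof -
  have "K \<subseteq> closure \<Omega>" using assms by (auto simp: solid_mesh_def)
  then have "interior K \<subseteq> interior (closure \<Omega>)" by (rule interior_mono)
  moreover have "interior (closure \<Omega>) = \<Omega>" using assms(1) unfolding solid_mesh_def by (elim conjE)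
  ultimately show ?thesis by (simp only:)
qed

lemma solid_mesh_subset:
  assumes "solid_mesh \<Omega> M" "K \<in> M" shows "K \<subseteq> closure \<Omega>"
  using assms by (auto simp: solid_mesh_def)

lemma solid_mesh_element_unique:
  assumes m: "solid_mesh \<Omega> M" and K: "K \<in> M" "x \<in> interior K" and L: "L \<in> M" "x \<in> L"
    and skel: "\<And>L. L \<in> M \<Longrightarrow> x \<in> L \<Longrightarrow> x \<in> interior L"
  shows "L = K"
  using m K L skel[OF L] unfolding solid_mesh_def by blast

lemma sum_over_elements:
  fixes g :: "(real^'n) set \<Rightarrow> real^'n \<Rightarrow> real"
  assumes m: "solid_mesh \<Omega> M" and K: "K \<in> M" "x \<in> interior K"
    and skel: "\<And>L. L \<in> M \<Longrightarrow> x \<in> L \<Longrightarrow> x \<in> interior L"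
  shows "(\<Sum>L\<in>M. indicator L x * g L x) = g K x"
proof -
  have "(\<Sum>L\<in>M. indicator L x * g L x) = (\<Sum>L\<in>M. if L = K then g K x else 0)"
  proof (rule sum.cong[OF refl])
    fix L assume L: "L \<in> M"
    show "indicator L x * g L x = (if L = K then g K x else 0)"
      using solid_mesh_element_unique[OF m K L _ skel] K(2) interior_subset[of K]
      by (auto simp: indicator_def)
  qed
  also have "\<dots> = g K x" using m K(1) by (simp add: solid_mesh_def)
  finally show ?thesis .
qed

text \<open>
  Outside the null set of element boundaries every point of the domain lies in exactly one element.
\<close>

lemma vol_int_mesh:
  assumes m: "solid_mesh \<Omega> M" and g: "\<And>K. K \<in> M \<Longrightarrow> continuous_on K (g K)"
    and eq: "\<And>K x. K \<in> M \<Longrightarrow> x \<in> interior K \<Longrightarrow> f x = g K x"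
  shows "vol_int \<Omega> f = (\<Sum>K\<in>M. vol_int K (g K))"
proof -
  note fin = solid_mesh_finite[OF m] and cov = solid_mesh_cover[OF m] and sol = solid_mesh_element[OF m]
  have bK: "bdd_supp_borel (\<lambda>x. indicator K x * g K x)" if "K \<in> M" for K
    by (rule bdd_supp_borel_indicator[OF solid_polytope_compact[OF sol[OF that]] g[OF that]])
  let ?h = "\<lambda>x. \<Sum>K\<in>M. indicator K x * g K x"
  have bh: "bdd_supp_borel ?h" by (rule bdd_supp_borel_sum[OF fin bK])
  have "AE x in lborel. \<forall>K\<in>M. x \<notin> frontier K"
  proof (rule AE_finite_allI[OF fin])
    fix K assume "K \<in> M"
    then show "AE x in lborel. x \<notin> frontier K"
      by (intro AE_notin_negligible negligible_convex_frontier solid_polytope_convex sol)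
  qed
  then have ae: "AE x in lborel. indicator \<Omega> x *\<^sub>R f x = ?h x"
  proof eventually_elim
    case (elim x)
    have skel: "x \<in> interior L" if "L \<in> M" "x \<in> L" for L
      using elim that closure_subset by (auto simp: frontier_def)
    show ?case
    proof (cases "\<exists>K\<in>M. x \<in> K")
      case True
      then obtain K where K: "K \<in> M" "x \<in> interior K" using skel by blast
      then have "x \<in> \<Omega>" using solid_mesh_interior_subset[OF m] by blast
      then show ?thesis using sum_over_elements[OF m K skel, of g] eq[OF K] by simp
    next
      case False
      then have "x \<notin> \<Omega>" using cov closure_subset by blast
      then show ?thesis using False by simp
    qed
  qed
  have "vol_int \<Omega> f = integral\<^sup>L lborel ?h"
    unfolding set_lebesgue_integral_def
    by (rule lebesgue_integral_cong_AE[OF _ ae]) (use bh in \<open>auto simp: bdd_supp_borel_def\<close>)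
  also have "\<dots> = (\<Sum>K\<in>M. (LINT x|lborel. indicator K x * g K x))"
    by (intro Bochner_Integration.integral_sum bdd_supp_borel_integrable bK)
  also have "\<dots> = (\<Sum>K\<in>M. vol_int K (g K))"
    by (intro sum.cong refl vol_int_eq_lborel[symmetric] solid_polytope_compact sol g)
  finally show ?thesis .
qed

text \<open>
  A generic line passes the boundary of a polytope at most twice.
\<close>

lemma generic_line_finite_boundary:
  assumes K: "solid_polytope K" and e: "e \<noteq> 0" and gen: "generic_line K e y"
  shows "\<exists>S. finite S \<and> (\<forall>t. y + t *\<^sub>R e \<in> K \<longrightarrow> t \<notin> S \<longrightarrow> y + t *\<^sub>R e \<in> interior K)"
proof (cases "\<exists>t. y + t *\<^sub>R e \<in> K")
  case True
  then obtain t0 t1 where t01: "t0 < t1" and I: "{t. y + t *\<^sub>R e \<in> K} = {t0..t1}"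
    using generic_line_crossing[OF K e gen] by metis
  have "y + t *\<^sub>R e \<in> interior K" if "y + t *\<^sub>R e \<in> K" "t \<notin> {t0, t1}" for t
  proof -
    have "t \<in> {t0..t1}" using that(1) unfolding I[symmetric] by simp
    then show ?thesis using that(2) by (intro generic_line_interior[OF K gen I]) auto
  qed
  then show ?thesis by (intro exI[of _ "{t0, t1}"]) auto
qed auto

text \<open>
  Extended by zero, \<open>G\<close> is continuous on the whole space and has bounded support. Along a generic line it is
  differentiable off the finitely many crossings of element boundaries, so that its derivative integrates to zero.
\<close>

lemma mesh_line_integral_zero:
  fixes \<Omega> :: "(real^'n) set"
  assumes m: "solid_mesh \<Omega> M" and bd: "bounded \<Omega>" and e: "e \<noteq> 0"
    and gen: "\<And>K. K \<in> M \<Longrightarrow> generic_line K e y"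
    and G: "continuous_on (closure \<Omega>) G" and G0: "\<And>x. x \<notin> \<Omega> \<Longrightarrow> G x = 0"
    and h: "\<And>K. K \<in> M \<Longrightarrow> continuous_on K (h K)"
    and deriv: "\<And>K x. K \<in> M \<Longrightarrow> x \<in> interior K \<Longrightarrow> ((\<lambda>t. G (x + t *\<^sub>R e)) has_real_derivative h K x) (at 0)"
  shows "(LINT t|lborel. (\<Sum>K\<in>M. indicator K (y + t *\<^sub>R e) * h K (y + t *\<^sub>R e))) = (0::real)"
proof -
  note fin = solid_mesh_finite[OF m] and cov = solid_mesh_cover[OF m] and sol = solid_mesh_element[OF m]
  let ?L = "\<lambda>t. y + t *\<^sub>R e"
  let ?\<phi> = "\<lambda>x. \<Sum>K\<in>M. indicator K x * h K x"
  have cL: "continuous_on S ?L" for S by (intro continuous_intros)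
  have cG: "continuous_on UNIV G"
  proof -
    have "continuous_on (closure \<Omega> \<union> - \<Omega>) (\<lambda>x. if x \<in> \<Omega> then G x else 0)"
    proof (rule continuous_on_cases)
      have "open \<Omega>" using m by (simp add: solid_mesh_def)
      then show "closed (- \<Omega>)" by (rule closed_Compl)
    qed (use G G0 in auto)
    moreover have "closure \<Omega> \<union> - \<Omega> = UNIV" using closure_subset by blast
    moreover have "(\<lambda>x. if x \<in> \<Omega> then G x else 0) = G" using G0 by auto
    ultimately show ?thesis by (simp only:)
  qed
  have "\<forall>K\<in>M. \<exists>S. finite S \<and> (\<forall>t. ?L t \<in> K \<longrightarrow> t \<notin> S \<longrightarrow> ?L t \<in> interior K)"
    using generic_line_finite_boundary[OF sol e gen] by blast
  then obtain S where S: "\<And>K. K \<in> M \<Longrightarrow> finite (S K)"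
    "\<And>K t. K \<in> M \<Longrightarrow> ?L t \<in> K \<Longrightarrow> t \<notin> S K \<Longrightarrow> ?L t \<in> interior K" by metis
  have "bounded (closure \<Omega>)" using bd by (rule bounded_closure)
  then obtain R where R: "\<And>x. x \<in> closure \<Omega> \<Longrightarrow> norm x \<le> R" by (auto simp: bounded_iff)
  \<comment> \<open>Beyond this parameter the line is outside the domain, where \<open>G\<close> is zero.\<close>
  define T where "T = \<bar>R + norm y\<bar> / norm e + 1"
  have T: "T > 0" unfolding T_def by (rule add_nonneg_pos) auto
  have out: "?L t \<notin> closure \<Omega>" if "\<bar>t\<bar> \<ge> T" for t
  proof
    assume "?L t \<in> closure \<Omega>"
    then have "norm (?L t) \<le> R" by (rule R)
    moreover have "norm (t *\<^sub>R e) \<le> norm (?L t) + norm y"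
      by (metis add_diff_cancel_left' norm_triangle_ineq4)
    ultimately have "\<bar>t\<bar> * norm e \<le> \<bar>R + norm y\<bar>" by simp
    then have "\<bar>t\<bar> \<le> \<bar>R + norm y\<bar> / norm e" using e by (simp add: field_simps)
    then show False using that by (simp add: T_def)
  qed
  have b\<phi>: "bdd_supp_borel ?\<phi>"
    by (intro bdd_supp_borel_sum fin bdd_supp_borel_indicator solid_polytope_compact sol h)
  have zero: "?\<phi> x = 0" if "x \<notin> closure \<Omega>" for x using that by (auto simp: cov intro!: sum.neutral)
  have "(LINT t|lborel. ?\<phi> (?L t)) = G (?L T) - G (?L (- T))"
  proof (rule integral_of_derivative_off_finite[where S = "\<Union>(S ` M)" and g = "\<lambda>t. G (?L t)"])
    show "bdd_supp_borel (\<lambda>t. ?\<phi> (?L t))" by (rule bdd_supp_borel_line[OF b\<phi> e])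
    show "- T \<le> T" using T by simp
    show "finite (\<Union>(S ` M))" using fin S(1) by blast
    show "?\<phi> (?L t) = 0" if "t < - T \<or> T < t" for t
      by (rule zero[OF out]) (use that in auto)
    show "continuous_on {- T..T} (\<lambda>t. G (?L t))"
      by (rule continuous_on_compose2[OF cG cL]) auto
    fix t assume tS: "t \<notin> \<Union>(S ` M)"
    have sh: "((\<lambda>u. G (?L t + u *\<^sub>R e)) has_real_derivative d) (at 0) \<Longrightarrow> ((\<lambda>t. G (?L t)) has_real_derivative d) (at t)" for d
    proof -
      assume "((\<lambda>u. G (?L t + u *\<^sub>R e)) has_real_derivative d) (at 0)"
      then have "((\<lambda>u. G (?L (u + t))) has_real_derivative d) (at 0)" by (simp add: algebra_simps)
      then show ?thesis using DERIV_shift[of "\<lambda>u. G (?L u)" d 0 t] by simp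
    qed
    have skel: "?L t \<in> interior L" if "L \<in> M" "?L t \<in> L" for L
      using S(2)[OF that] tS that(1) by blast
    show "((\<lambda>t. G (?L t)) has_real_derivative ?\<phi> (?L t)) (at t)"
    proof (cases "?L t \<in> closure \<Omega>")
      case True
      then obtain K where K: "K \<in> M" "?L t \<in> interior K" using skel cov by blast
      have "?\<phi> (?L t) = h K (?L t)" by (rule sum_over_elements[OF m K skel])
      then show ?thesis using sh[OF deriv[OF K]] by simp
    next
      case False
      have "open (?L -` (- closure \<Omega>))" by (intro open_vimage cL) auto
      moreover have "t \<in> ?L -` (- closure \<Omega>)" using False by simp
      moreover have "G (?L u) = 0" if "u \<in> ?L -` (- closure \<Omega>)" for u
        using that closure_subset by (intro G0) auto
      ultimately have "((\<lambda>t. G (?L t)) has_real_derivative 0) (at t)"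
        by (intro has_field_derivative_transform_within_open[OF DERIV_const[of 0]]) auto
      then show ?thesis using zero[OF False] by simp
    qed
  qed
  moreover have "G (?L T) = 0" "G (?L (- T)) = 0"
    using out[of T] out[of "- T"] T closure_subset by (auto intro!: G0)
  ultimately show ?thesis by simp
qed

text \<open>
  The divergence theorem on the domain for a field \<open>w b\<close> that vanishes on the boundary. It is proved
  by lines in each coordinate direction, so that continuity of \<open>w\<close> replaces the cancellation of facet
  integrals between neighbouring elements.
\<close>

lemma mesh_divergence_zero:
  fixes \<Omega> :: "(real^'n) set"
  assumes m: "solid_mesh \<Omega> M" and bd: "bounded \<Omega>"
    and w: "continuous_on (closure \<Omega>) w" "\<And>x. x \<notin> \<Omega> \<Longrightarrow> w x = 0" "\<And>K. K \<in> M \<Longrightarrow> poly_on K w"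
    and b: "C1_field (closure \<Omega>) \<Omega> b D"
  shows "(\<Sum>K\<in>M. vol_int K (\<lambda>x. grad K w x \<bullet> b x + w x * (\<Sum>i\<in>UNIV. D i x))) = 0"
proof -
  note fin = solid_mesh_finite[OF m] and cov = solid_mesh_cover[OF m] and sol = solid_mesh_element[OF m]
  have cb: "continuous_on (closure \<Omega>) b" "\<And>i. continuous_on (closure \<Omega>) (D i)" using b by (auto simp: C1_field_def)
  have sub: "K \<subseteq> closure \<Omega>" if "K \<in> M" for K using solid_mesh_subset[OF m that] .
  define h where "h K i x = grad K w x $ i * b x $ i + w x * D i x" for K i x
  have ch: "continuous_on K (h K i)" if "K \<in> M" for K i
    unfolding h_def
    by (intro continuous_intros continuous_on_grad sol w(3) that continuous_on_subset[OF w(1)]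
        continuous_on_subset[OF cb(1)] continuous_on_subset[OF cb(2)] sub)
  have bK: "bdd_supp_borel (\<lambda>x. indicator K x * h K i x)" if "K \<in> M" for K i
    by (rule bdd_supp_borel_indicator[OF solid_polytope_compact[OF sol[OF that]] ch[OF that]])
  have zero: "(\<Sum>K\<in>M. vol_int K (h K i)) = 0" for i
  proof -
    let ?e = "axis i 1 :: real^'n"
    have e: "?e \<noteq> 0" by (simp add: axis_eq_0_iff)
    have z: "bdd_supp_borel (\<lambda>x::real^'n. 0)" by (auto simp: bdd_supp_borel_def)
    have "(LINT x|lborel. (\<Sum>K\<in>M. indicator K x * h K i x)) = 0 * integral\<^sup>L lborel (\<lambda>x::real^'n. 0::real)"
    proof (rule integral_eq_if_line_integrals_eq[OF _ z e])
      show "bdd_supp_borel (\<lambda>x. \<Sum>K\<in>M. indicator K x * h K i x)" by (rule bdd_supp_borel_sum[OF fin bK])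
      have "AE y in lborel. \<forall>K\<in>M. generic_line K ?e y"
        by (rule AE_finite_allI[OF fin AE_generic_line[OF sol]])
      then show "AE y in lborel. (LINT t|lborel. (\<Sum>K\<in>M. indicator K (y + t *\<^sub>R ?e) * h K i (y + t *\<^sub>R ?e)))
           = 0 * (LINT t|lborel. 0::real)"
      proof eventually_elim
        case (elim y)
        have "(LINT t|lborel. (\<Sum>K\<in>M. indicator K (y + t *\<^sub>R ?e) * h K i (y + t *\<^sub>R ?e))) = 0"
        proof (rule mesh_line_integral_zero[OF m bd e, where G = "\<lambda>x. w x * b x $ i"])
          show "continuous_on (closure \<Omega>) (\<lambda>x. w x * b x $ i)" by (intro continuous_intros w cb)
          fix K x assume K: "K \<in> M" and x: "x \<in> interior K"
          have "x \<in> \<Omega>" using solid_mesh_interior_subset[OF m K] x by blast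
          then have "((\<lambda>t. b (x + t *\<^sub>R axis i 1) $ i) has_real_derivative D i x) (at 0)"
            using b by (auto simp: C1_field_def)
          from DERIV_mult[OF directional_derivative_interior[OF sol[OF K] w(3)[OF K] x, of ?e] this]
          show "((\<lambda>t. w (x + t *\<^sub>R ?e) * b (x + t *\<^sub>R ?e) $ i) has_real_derivative h K i x) (at 0)"
            by (simp add: inner_axis h_def mult.commute add.commute)
        qed (use elim w(2) ch in auto)
        then show ?case by simp
      qed
    qed
    then have "(\<Sum>K\<in>M. (LINT x|lborel. indicator K x * h K i x)) = 0"
      by (simp add: Bochner_Integration.integral_sum bdd_supp_borel_integrable bK)
    moreover have "vol_int K (h K i) = (LINT x|lborel. indicator K x * h K i x)" if "K \<in> M" for K
      by (rule vol_int_eq_lborel[OF solid_polytope_compact[OF sol[OF that]] ch[OF that]])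
    ultimately show ?thesis by simp
  qed
  have "(\<Sum>K\<in>M. vol_int K (\<lambda>x. grad K w x \<bullet> b x + w x * (\<Sum>i\<in>UNIV. D i x)))
      = (\<Sum>K\<in>M. vol_int K (\<lambda>x. \<Sum>i\<in>UNIV. h K i x))"
    by (simp add: h_def inner_vec_def sum.distrib sum_distrib_left)
  also have "\<dots> = (\<Sum>K\<in>M. \<Sum>i\<in>UNIV. vol_int K (h K i))"
    by (intro sum.cong refl vol_int_sum finite solid_polytope_compact sol ch)
  also have "\<dots> = (\<Sum>i\<in>UNIV. \<Sum>K\<in>M. vol_int K (h K i))" by (rule sum.swap)
  also have "\<dots> = 0" by (simp add: zero)
  finally show ?thesis .
qed

section \<open>Cauchy-Schwarz inequalities and the form on an element\<close>

text \<open>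
  All Cauchy-Schwarz inequalities below apply this to the square of \<open>f + t g\<close>.
\<close>

lemma nonneg_quadratic_discriminant:
  fixes A B C :: real
  assumes q: "\<And>t. A + t * (2 * B) + t\<^sup>2 * C \<ge> 0" and C: "C \<ge> 0"
  shows "\<bar>B\<bar> \<le> sqrt A * sqrt C"
proof -
  have A: "A \<ge> 0" using q[of 0] by simp
  have "B\<^sup>2 \<le> A * C"
  proof (cases "C = 0")
    case True
    have "B = 0"
    proof (rule ccontr)
      assume "B \<noteq> 0"
      then show False using q[of "- (A + 1) / (2 * B)"] True by simp
    qed
    then show ?thesis using True by simp
  next
    case False
    then have "0 \<le> (A + (- B / C) * (2 * B) + (- B / C)\<^sup>2 * C) * C" using C q[of "- B / C"] by simp
    also have "\<dots> = A * C - B\<^sup>2" using False by (simp add: power2_eq_square field_simps)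
    finally show ?thesis by simp
  qed
  then have "\<bar>B\<bar> \<le> sqrt (A * C)" using real_sqrt_le_mono by fastforce
  then show ?thesis by (simp add: real_sqrt_mult)
qed

lemma norm0_nonneg: "norm0 D f \<ge> 0" and seminorm1_nonneg: "seminorm1 D f \<ge> 0"
  by (auto simp: norm0_def seminorm1_def intro!: vol_int_nonneg)

lemma norm0_bdry_nonneg: "solid_polytope K \<Longrightarrow> norm0_bdry K g \<ge> 0"
  by (auto simp: norm0_bdry_def intro!: bdry_int_nonneg)

lemma norm0_sq: "(norm0 D f)\<^sup>2 = vol_int D (\<lambda>x. (f x)\<^sup>2)"
  by (simp add: norm0_def vol_int_nonneg)

lemma seminorm1_sq: "(seminorm1 D f)\<^sup>2 = vol_int D (\<lambda>x. (norm (grad D f x))\<^sup>2)"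
  by (simp add: seminorm1_def vol_int_nonneg)

lemma norm0_bdry_sq: "solid_polytope K \<Longrightarrow> (norm0_bdry K g)\<^sup>2 = bdry_int K (\<lambda>n x. (g n x)\<^sup>2)"
  by (simp add: norm0_bdry_def bdry_int_nonneg)

lemma vol_int_lincomb:
  assumes "compact K" "continuous_on K f" "continuous_on K g"
  shows "vol_int K (\<lambda>x. f x + s * g x) = vol_int K f + s * vol_int K g"
  using vol_int_add[OF assms(1,2), of "\<lambda>x. s * g x"] assms(3) by (simp add: continuous_on_mult_left)

lemma bdry_int_lincomb:
  assumes K: "solid_polytope K" and f: "\<And>n. continuous_on K (f n)" and g: "\<And>n. continuous_on K (g n)"
  shows "bdry_int K (\<lambda>n x. f n x + s * g n x) = bdry_int K f + s * bdry_int K g"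
  using bdry_int_add[OF K f, of "\<lambda>n x. s * g n x"] g by (simp add: continuous_on_mult_left bdry_int_cmult)

lemma vol_int_mono:
  assumes "compact K" "continuous_on K f" "continuous_on K g" "\<And>x. x \<in> K \<Longrightarrow> f x \<le> g x"
  shows "vol_int K f \<le> vol_int K g"
proof -
  have "0 \<le> vol_int K (\<lambda>x. g x + (-1) * f x)" using assms(4) by (intro vol_int_nonneg) auto
  then show ?thesis using vol_int_lincomb[OF assms(1,3,2), of "-1"] by simp
qed

lemma bdry_int_mono:
  assumes K: "solid_polytope K" and f: "\<And>n. continuous_on K (f n)" and g: "\<And>n. continuous_on K (g n)"
    and le: "\<And>n x. norm n = 1 \<Longrightarrow> x \<in> K \<Longrightarrow> f n x \<le> g n x"
  shows "bdry_int K f \<le> bdry_int K g"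
proof -
  have "0 \<le> bdry_int K (\<lambda>n x. g n x + (-1) * f n x)" using le by (intro bdry_int_nonneg K) auto
  then show ?thesis using bdry_int_lincomb[OF K, of g f "-1"] f g by simp
qed

lemma norm_add_scaleR_sq:
  fixes x y :: "'a::real_inner"
  shows "(norm (x + t *\<^sub>R y))\<^sup>2 = ((norm x)\<^sup>2 + t * (2 * (x \<bullet> y))) + t\<^sup>2 * (norm y)\<^sup>2"
  unfolding power2_norm_eq_inner
  by (simp add: inner_add_left inner_add_right inner_commute power2_eq_square algebra_simps)

lemma vol_int_Cauchy_Schwarz_vec:
  fixes F G :: "real^'n \<Rightarrow> 'b::real_inner"
  assumes K: "compact K" and F: "continuous_on K F" and G: "continuous_on K G"
  shows "\<bar>vol_int K (\<lambda>x. F x \<bullet> G x)\<bar> \<le> sqrt (vol_int K (\<lambda>x. (norm (F x))\<^sup>2)) * sqrt (vol_int K (\<lambda>x. (norm (G x))\<^sup>2))"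
proof (rule nonneg_quadratic_discriminant)
  fix t
  have "0 \<le> vol_int K (\<lambda>x. (norm (F x + t *\<^sub>R G x))\<^sup>2)" by (rule vol_int_nonneg) simp
  also have "\<dots> = vol_int K (\<lambda>x. ((norm (F x))\<^sup>2 + t * (2 * (F x \<bullet> G x))) + t\<^sup>2 * (norm (G x))\<^sup>2)"
    by (simp only: norm_add_scaleR_sq)
  also have "\<dots> = vol_int K (\<lambda>x. (norm (F x))\<^sup>2 + t * (2 * (F x \<bullet> G x))) + t\<^sup>2 * vol_int K (\<lambda>x. (norm (G x))\<^sup>2)"
    by (rule vol_int_lincomb[OF K]) (intro continuous_intros F G)+
  also have "vol_int K (\<lambda>x. (norm (F x))\<^sup>2 + t * (2 * (F x \<bullet> G x)))
      = vol_int K (\<lambda>x. (norm (F x))\<^sup>2) + t * vol_int K (\<lambda>x. 2 * (F x \<bullet> G x))"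
    by (rule vol_int_lincomb[OF K]) (intro continuous_intros F G)+
  finally show "0 \<le> vol_int K (\<lambda>x. (norm (F x))\<^sup>2) + t * (2 * vol_int K (\<lambda>x. F x \<bullet> G x)) 
      + t\<^sup>2 * vol_int K (\<lambda>x. (norm (G x))\<^sup>2)" by simp
qed (rule vol_int_nonneg, simp)

lemma vol_int_Cauchy_Schwarz:
  assumes "compact K" "continuous_on K f" "continuous_on K g"
  shows "\<bar>vol_int K (\<lambda>x. f x * g x)\<bar> \<le> norm0 K f * norm0 K g"
  using vol_int_Cauchy_Schwarz_vec[OF assms] by (simp add: norm0_def)

lemma bdry_int_Cauchy_Schwarz:
  assumes K: "solid_polytope K" and f: "\<And>n. continuous_on K (f n)" and g: "\<And>n. continuous_on K (g n)"
  shows "\<bar>bdry_int K (\<lambda>n x. f n x * g n x)\<bar> \<le> norm0_bdry K f * norm0_bdry K g"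
  unfolding norm0_bdry_def
proof (rule nonneg_quadratic_discriminant)
  fix t
  have "0 \<le> bdry_int K (\<lambda>n x. (f n x + t * g n x)\<^sup>2)" by (rule bdry_int_nonneg[OF K]) simp
  also have "\<dots> = bdry_int K (\<lambda>n x. ((f n x)\<^sup>2 + t * (2 * (f n x * g n x))) + t\<^sup>2 * (g n x)\<^sup>2)"
    by (simp add: power2_eq_square algebra_simps)
  also have "\<dots> = bdry_int K (\<lambda>n x. (f n x)\<^sup>2 + t * (2 * (f n x * g n x))) + t\<^sup>2 * bdry_int K (\<lambda>n x. (g n x)\<^sup>2)"
    by (rule bdry_int_lincomb[OF K]) (intro continuous_intros f g)+
  also have "bdry_int K (\<lambda>n x. (f n x)\<^sup>2 + t * (2 * (f n x * g n x)))
      = bdry_int K (\<lambda>n x. (f n x)\<^sup>2) + t * bdry_int K (\<lambda>n x. 2 * (f n x * g n x))"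
    by (rule bdry_int_lincomb[OF K]) (intro continuous_intros f g)+
  finally show "0 \<le> bdry_int K (\<lambda>n x. (f n x)\<^sup>2) + t * (2 * bdry_int K (\<lambda>n x. f n x * g n x)) 
      + t\<^sup>2 * bdry_int K (\<lambda>n x. (g n x)\<^sup>2)" by (simp add: bdry_int_cmult)
qed (rule bdry_int_nonneg[OF K], simp)

text \<open>
  The bounds \<open>(f + s g)\<^sup>2 \<le> 2 f\<^sup>2 + 2 s\<^sup>2 g\<^sup>2\<close> replace the triangle inequality of the SUPG norm.
\<close>

lemma norm0_sq_add_le:
  assumes K: "compact K" and f: "continuous_on K f" and g: "continuous_on K g"
  shows "(norm0 K (\<lambda>x. f x + s * g x))\<^sup>2 \<le> 2 * (norm0 K f)\<^sup>2 + 2 * s\<^sup>2 * (norm0 K g)\<^sup>2"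
proof -
  have "vol_int K (\<lambda>x. (f x + s * g x)\<^sup>2) \<le> vol_int K (\<lambda>x. 2 * (f x)\<^sup>2 + (2 * s\<^sup>2) * (g x)\<^sup>2)"
  proof (rule vol_int_mono[OF K])
    fix x show "(f x + s * g x)\<^sup>2 \<le> 2 * (f x)\<^sup>2 + 2 * s\<^sup>2 * (g x)\<^sup>2"
      using zero_le_power2[of "f x - s * g x"] by (simp add: power2_eq_square algebra_simps)
  qed (intro continuous_intros f g)+
  also have "\<dots> = vol_int K (\<lambda>x. 2 * (f x)\<^sup>2) + (2 * s\<^sup>2) * vol_int K (\<lambda>x. (g x)\<^sup>2)"
    by (rule vol_int_lincomb[OF K]) (intro continuous_intros f g)+
  finally show ?thesis by (simp add: norm0_sq)
qed

lemma norm0_bdry_sq_add_le: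
  assumes K: "solid_polytope K" and f: "\<And>n. continuous_on K (f n)" and g: "\<And>n. continuous_on K (g n)"
  shows "(norm0_bdry K (\<lambda>n x. f n x + s * g n x))\<^sup>2 \<le> 2 * (norm0_bdry K f)\<^sup>2 + 2 * s\<^sup>2 * (norm0_bdry K g)\<^sup>2"
proof -
  have "bdry_int K (\<lambda>n x. (f n x + s * g n x)\<^sup>2) \<le> bdry_int K (\<lambda>n x. 2 * (f n x)\<^sup>2 + (2 * s\<^sup>2) * (g n x)\<^sup>2)"
  proof (rule bdry_int_mono[OF K])
    fix n x show "(f n x + s * g n x)\<^sup>2 \<le> 2 * (f n x)\<^sup>2 + 2 * s\<^sup>2 * (g n x)\<^sup>2"
      using zero_le_power2[of "f n x - s * g n x"] by (simp add: power2_eq_square algebra_simps)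
  qed (intro continuous_intros f g)+
  also have "\<dots> = bdry_int K (\<lambda>n x. 2 * (f n x)\<^sup>2) + (2 * s\<^sup>2) * bdry_int K (\<lambda>n x. (g n x)\<^sup>2)"
    by (rule bdry_int_lincomb[OF K]) (intro continuous_intros f g)+
  finally show ?thesis by (simp add: norm0_bdry_sq[OF K] bdry_int_cmult)
qed

lemma seminorm1_sq_add_le:
  assumes K: "solid_polytope K" and f: "poly_on K f" and g: "poly_on K g"
  shows "(seminorm1 K (\<lambda>x. f x + s * g x))\<^sup>2 \<le> 2 * (seminorm1 K f)\<^sup>2 + 2 * s\<^sup>2 * (seminorm1 K g)\<^sup>2"
proof -
  note cK = solid_polytope_compact[OF K]
  note cf = continuous_on_grad[OF K f] and cg = continuous_on_grad[OF K g]
  have gr: "grad K (\<lambda>x. f x + s * g x) x = grad K f x + s *\<^sub>R grad K g x" if "x \<in> K" for x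
    using grad_add[OF K f poly_on_cmult[OF g] that] grad_cmult[OF K g that] by simp
  have "vol_int K (\<lambda>x. (norm (grad K (\<lambda>x. f x + s * g x) x))\<^sup>2) = vol_int K (\<lambda>x. (norm (grad K f x + s *\<^sub>R grad K g x))\<^sup>2)"
    by (rule vol_int_cong) (simp add: gr)
  also have "\<dots> \<le> vol_int K (\<lambda>x. 2 * (norm (grad K f x))\<^sup>2 + (2 * s\<^sup>2) * (norm (grad K g x))\<^sup>2)"
  proof (rule vol_int_mono[OF cK])
    fix x show "(norm (grad K f x + s *\<^sub>R grad K g x))\<^sup>2 \<le> 2 * (norm (grad K f x))\<^sup>2 + 2 * s\<^sup>2 * (norm (grad K g x))\<^sup>2"
      using zero_le_power2[of "norm (grad K f x + (- s) *\<^sub>R grad K g x)"]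
      unfolding norm_add_scaleR_sq by simp
  qed (intro continuous_intros cf cg)+
  also have "\<dots> = vol_int K (\<lambda>x. 2 * (norm (grad K f x))\<^sup>2) + (2 * s\<^sup>2) * vol_int K (\<lambda>x. (norm (grad K g x))\<^sup>2)"
    by (rule vol_int_lincomb[OF cK]) (intro continuous_intros cf cg)+
  finally show ?thesis by (simp add: seminorm1_sq)
qed

text \<open>
  The contribution of one element to the forms that are tested with the discontinuous component.
\<close>

definition elem_form :: "(real^'n) set \<Rightarrow> real \<Rightarrow> (real^'n \<Rightarrow> real^'n) \<Rightarrow> real \<Rightarrow> real \<Rightarrow> real
    \<Rightarrow> (real^'n \<Rightarrow> real) \<Rightarrow> (real^'n \<Rightarrow> real) \<Rightarrow> (real^'n \<Rightarrow> real) \<Rightarrow> real" where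
  "elem_form K h a \<kappa> \<kappa>a Cpen u u' v' =
     vol_int K (\<lambda>x. v' x * (a x \<bullet> grad K u x - divg K (\<lambda>y. \<kappa> *\<^sub>R grad K u y) x))
     + (- vol_int K (\<lambda>x. u' x * (a x \<bullet> grad K v' x))
        + vol_int K (\<lambda>x. (\<kappa> + \<kappa>a) * (grad K u' x \<bullet> grad K v' x))
        + bdry_int K (\<lambda>n x. u' x * v' x * max (a x \<bullet> n) 0)
        - bdry_int K (\<lambda>n x. \<kappa> * (grad K u' x \<bullet> n) * v' x)
        - bdry_int K (\<lambda>n x. u' x * (\<kappa> * (grad K v' x \<bullet> n)))
        + bdry_int K (\<lambda>n x. Cpen * \<kappa> / h * u' x * v' x))"

lemma elem_form_expand:
  assumes K: "solid_polytope K" and u: "poly_on K u" and v': "poly_on K v'" and a: "continuous_on K a"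
  shows "elem_form K h a \<kappa> \<kappa>a Cpen u u' v' =
     vol_int K (\<lambda>x. v' x * (a x \<bullet> grad K u x)) - \<kappa> * vol_int K (\<lambda>x. v' x * laplacian K u x)
     - vol_int K (\<lambda>x. u' x * (a x \<bullet> grad K v' x))
     + (\<kappa> + \<kappa>a) * vol_int K (\<lambda>x. grad K u' x \<bullet> grad K v' x)
     + bdry_int K (\<lambda>n x. u' x * v' x * max (a x \<bullet> n) 0)
     - \<kappa> * bdry_int K (\<lambda>n x. (grad K u' x \<bullet> n) * v' x)
     - \<kappa> * bdry_int K (\<lambda>n x. u' x * (grad K v' x \<bullet> n))
     + Cpen * \<kappa> / h * bdry_int K (\<lambda>n x. u' x * v' x)"
proof -
  note cK = solid_polytope_compact[OF K]
  note cont = poly_on_continuous[OF v'] continuous_on_grad[OF K u] poly_on_continuous[OF poly_on_laplacian[OF K u]] a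
  have "vol_int K (\<lambda>x. v' x * (a x \<bullet> grad K u x - divg K (\<lambda>y. \<kappa> *\<^sub>R grad K u y) x))
      = vol_int K (\<lambda>x. v' x * (a x \<bullet> grad K u x) + (- \<kappa>) * (v' x * laplacian K u x))"
    by (rule vol_int_cong) (simp add: divg_grad_cmult[OF K u] algebra_simps)
  also have "\<dots> = vol_int K (\<lambda>x. v' x * (a x \<bullet> grad K u x)) + (- \<kappa>) * vol_int K (\<lambda>x. v' x * laplacian K u x)"
    by (rule vol_int_lincomb[OF cK]) (intro continuous_intros cont)+
  finally have 1: "vol_int K (\<lambda>x. v' x * (a x \<bullet> grad K u x - divg K (\<lambda>y. \<kappa> *\<^sub>R grad K u y) x))
      = vol_int K (\<lambda>x. v' x * (a x \<bullet> grad K u x)) - \<kappa> * vol_int K (\<lambda>x. v' x * laplacian K u x)" by simp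
  have 2: "bdry_int K (\<lambda>n x. \<kappa> * (grad K u' x \<bullet> n) * v' x) = \<kappa> * bdry_int K (\<lambda>n x. (grad K u' x \<bullet> n) * v' x)"
    by (simp add: bdry_int_cmult[symmetric] mult.assoc)
  have 3: "bdry_int K (\<lambda>n x. u' x * (\<kappa> * (grad K v' x \<bullet> n))) = \<kappa> * bdry_int K (\<lambda>n x. u' x * (grad K v' x \<bullet> n))"
    by (simp add: bdry_int_cmult[symmetric] mult.left_commute)
  have 4: "bdry_int K (\<lambda>n x. Cpen * \<kappa> / h * u' x * v' x) = Cpen * \<kappa> / h * bdry_int K (\<lambda>n x. u' x * v' x)"
    unfolding bdry_int_cmult[symmetric] by (simp add: mult.assoc)
  show ?thesis unfolding elem_form_def 1 2 3 4 by simp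
qed

lemma elem_form_lincomb:
  assumes K: "solid_polytope K" and u: "poly_on K u" and u': "poly_on K u'"
    and v': "poly_on K v'" and w': "poly_on K w'" and a: "continuous_on K a"
  shows "elem_form K h a \<kappa> \<kappa>a Cpen u u' (\<lambda>x. v' x + s * w' x)
       = elem_form K h a \<kappa> \<kappa>a Cpen u u' v' + s * elem_form K h a \<kappa> \<kappa>a Cpen u u' w'"
proof -
  note cK = solid_polytope_compact[OF K]
  let ?z = "\<lambda>x. v' x + s * w' x"
  have z: "poly_on K ?z" by (intro poly_on_add poly_on_cmult v' w')
  have gz: "grad K ?z x = grad K v' x + s *\<^sub>R grad K w' x" if "x \<in> K" for x
    using grad_add[OF K v' poly_on_cmult[OF w'] that] grad_cmult[OF K w' that] by simp
  note cont = a poly_on_continuous[OF v'] poly_on_continuous[OF w'] poly_on_continuous[OF u'] 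
    continuous_on_grad[OF K u] continuous_on_grad[OF K u'] continuous_on_grad[OF K v'] continuous_on_grad[OF K w']
    poly_on_continuous[OF poly_on_laplacian[OF K u]]
  have L: "vol_int K f = vol_int K g + s * vol_int K h" 
    if "\<And>x. x \<in> K \<Longrightarrow> f x = g x + s * h x" "continuous_on K g" "continuous_on K h" for f g h
    using vol_int_cong[of K f "\<lambda>x. g x + s * h x"] vol_int_lincomb[OF cK that(2,3), of s] that(1) by simp
  have Lb: "bdry_int K f = bdry_int K g + s * bdry_int K h" 
    if "\<And>n x. x \<in> K \<Longrightarrow> f n x = g n x + s * h n x" "\<And>n. continuous_on K (g n)" "\<And>n. continuous_on K (h n)" for f g h
    using bdry_int_cong[OF K, of f "\<lambda>n x. g n x + s * h n x"] bdry_int_lincomb[OF K, of g h s] that by simp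
  have 1: "vol_int K (\<lambda>x. ?z x * (a x \<bullet> grad K u x)) = vol_int K (\<lambda>x. v' x * (a x \<bullet> grad K u x)) + s * vol_int K (\<lambda>x. w' x * (a x \<bullet> grad K u x))"
    by (rule L) (auto intro!: continuous_intros cont simp: algebra_simps)
  have 2: "vol_int K (\<lambda>x. ?z x * laplacian K u x) = vol_int K (\<lambda>x. v' x * laplacian K u x) + s * vol_int K (\<lambda>x. w' x * laplacian K u x)"
    by (rule L) (auto intro!: continuous_intros cont simp: algebra_simps)
  have 3: "vol_int K (\<lambda>x. u' x * (a x \<bullet> grad K ?z x)) = vol_int K (\<lambda>x. u' x * (a x \<bullet> grad K v' x)) + s * vol_int K (\<lambda>x. u' x * (a x \<bullet> grad K w' x))"
    by (rule L) (auto intro!: continuous_intros cont simp: gz inner_add_right algebra_simps)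
  have 4: "vol_int K (\<lambda>x. grad K u' x \<bullet> grad K ?z x) = vol_int K (\<lambda>x. grad K u' x \<bullet> grad K v' x) + s * vol_int K (\<lambda>x. grad K u' x \<bullet> grad K w' x)"
    by (rule L) (auto intro!: continuous_intros cont simp: gz inner_add_right algebra_simps)
  have 5: "bdry_int K (\<lambda>n x. u' x * ?z x * max (a x \<bullet> n) 0) = bdry_int K (\<lambda>n x. u' x * v' x * max (a x \<bullet> n) 0) + s * bdry_int K (\<lambda>n x. u' x * w' x * max (a x \<bullet> n) 0)"
    by (rule Lb) (auto intro!: continuous_intros cont simp: algebra_simps)
  have 6: "bdry_int K (\<lambda>n x. (grad K u' x \<bullet> n) * ?z x) = bdry_int K (\<lambda>n x. (grad K u' x \<bullet> n) * v' x) + s * bdry_int K (\<lambda>n x. (grad K u' x \<bullet> n) * w' x)"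
    by (rule Lb) (auto intro!: continuous_intros cont simp: algebra_simps)
  have 7: "bdry_int K (\<lambda>n x. u' x * (grad K ?z x \<bullet> n)) = bdry_int K (\<lambda>n x. u' x * (grad K v' x \<bullet> n)) + s * bdry_int K (\<lambda>n x. u' x * (grad K w' x \<bullet> n))"
    by (rule Lb) (auto intro!: continuous_intros cont simp: gz inner_add_left algebra_simps)
  have 8: "bdry_int K (\<lambda>n x. u' x * ?z x) = bdry_int K (\<lambda>n x. u' x * v' x) + s * bdry_int K (\<lambda>n x. u' x * w' x)"
    by (rule Lb) (auto intro!: continuous_intros cont simp: algebra_simps)
  show ?thesis
    unfolding elem_form_expand[OF K u z a] elem_form_expand[OF K u v' a] elem_form_expand[OF K u w' a] 1 2 3 4 5 6 7 8
    by algebra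
qed

section \<open>Coercivity and test function bounds on an element\<close>

text \<open>
  The partial derivatives extend continuously to the closed element, so that a divergence which
  vanishes in the interior vanishes on all of \<open>K\<close>.
\<close>

definition div_free_field :: "(real^'n) set \<Rightarrow> (real^'n \<Rightarrow> real^'n) \<Rightarrow> bool" where
  "div_free_field K a \<longleftrightarrow> (\<exists>D. C1_field K (interior K) a D \<and> (\<forall>x\<in>K. (\<Sum>i\<in>UNIV. D i x) = 0))"

lemma div_free_field_continuous: "div_free_field K a \<Longrightarrow> continuous_on K a"
  by (auto simp: div_free_field_def C1_field_def)

lemma advection_by_parts:
  assumes K: "solid_polytope K" and v: "poly_on K v" and w: "poly_on K w" and a: "div_free_field K a"
  shows "vol_int K (\<lambda>x. v x * (a x \<bullet> grad K w x)) =
     bdry_int K (\<lambda>n x. v x * w x * (a x \<bullet> n)) - vol_int K (\<lambda>x. w x * (a x \<bullet> grad K v x))"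
proof -
  note cK = solid_polytope_compact[OF K]
  obtain D where D: "C1_field K (interior K) a D" "\<And>x. x \<in> K \<Longrightarrow> (\<Sum>i\<in>UNIV. D i x) = 0"
    using a by (auto simp: div_free_field_def)
  note cont = div_free_field_continuous[OF a] poly_on_continuous[OF v] poly_on_continuous[OF w]
    continuous_on_grad[OF K v] continuous_on_grad[OF K w]
  have "bdry_int K (\<lambda>n x. v x * w x * (a x \<bullet> n))
      = vol_int K (\<lambda>x. grad K (\<lambda>x. v x * w x) x \<bullet> a x + v x * w x * (\<Sum>i\<in>UNIV. D i x))"
    using gauss_poly_field[OF K poly_on_mult[OF v w] D(1)] by simp
  also have "\<dots> = vol_int K (\<lambda>x. v x * (a x \<bullet> grad K w x) + w x * (a x \<bullet> grad K v x))"
    by (rule vol_int_cong) (simp add: D(2) grad_mult[OF K v w] inner_commute[of _ "a _"] inner_add_right)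
  also have "\<dots> = vol_int K (\<lambda>x. v x * (a x \<bullet> grad K w x)) + vol_int K (\<lambda>x. w x * (a x \<bullet> grad K v x))"
    by (rule vol_int_add[OF cK]) (intro continuous_intros cont)+
  finally show ?thesis by simp
qed

abbreviation adv_trace_norm :: "(real^'n) set \<Rightarrow> (real^'n \<Rightarrow> real^'n) \<Rightarrow> (real^'n \<Rightarrow> real) \<Rightarrow> real" where
  "adv_trace_norm K a v \<equiv> norm0_bdry K (\<lambda>n x. sqrt \<bar>a x \<bullet> n\<bar> * v x)"

text \<open>
  The part of the SUPG norm on one element that belongs to the discontinuous component, without the
  streamline derivative.
\<close>

definition elem_energy :: "(real^'n) set \<Rightarrow> real \<Rightarrow> (real^'n \<Rightarrow> real^'n) \<Rightarrow> real \<Rightarrow> real \<Rightarrow> real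
    \<Rightarrow> (real^'n \<Rightarrow> real) \<Rightarrow> real" where
  "elem_energy K h a \<kappa> \<kappa>a Cpen u' = (\<kappa> + \<kappa>a) * (seminorm1 K u')\<^sup>2
     + Cpen * \<kappa> / h * (norm0_bdry K (\<lambda>n. u'))\<^sup>2
     + (adv_trace_norm K a u')\<^sup>2"

lemma sq_le_scaled_imp_le:
  fixes y x c :: real
  assumes "y\<^sup>2 \<le> c * x\<^sup>2" "c \<ge> 0" "x \<ge> 0" shows "y \<le> sqrt c * x"
proof (rule power2_le_imp_le)
  show "y\<^sup>2 \<le> (sqrt c * x)\<^sup>2" using assms by (simp add: power_mult_distrib)
  show "0 \<le> sqrt c * x" using assms by simp
qed

text \<open>
  Here \<open>x\<close> and \<open>y\<close> are the gradient norms of the two components, \<open>q\<close> is the squared penalty norm and \<open>p\<close> the factor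
  in the bounds for the boundary fluxes. Young's inequality spends \<open>x\<^sup>2/2 + y\<^sup>2/2\<close> on \<open>g\<close>, \<open>x\<^sup>2/4 + p\<^sup>2\<close> on \<open>b1\<close>
  and \<open>y\<^sup>2/4 + 4 p\<^sup>2\<close> on \<open>2 b2\<close>; this leaves a quarter of each square, since \<open>5 p\<^sup>2 \<le> 5 q/8\<close>.
\<close>

lemma coercivity_arithmetic:
  fixes x y p q g b1 b2 :: real
  assumes "\<bar>g\<bar> \<le> x * y" "\<bar>b1\<bar> \<le> p * x" "\<bar>b2\<bar> \<le> p * y" "8 * p\<^sup>2 \<le> q"
  shows "x\<^sup>2 + g - b1 + y\<^sup>2 - 2 * b2 + q \<ge> (x\<^sup>2 + y\<^sup>2 + q) / 4"
proof -
  have "x * y \<le> (x\<^sup>2 + y\<^sup>2) / 2" using zero_le_power2[of "x - y"] by (simp add: power2_diff)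
  moreover have "p * x \<le> x\<^sup>2 / 4 + p\<^sup>2" using zero_le_power2[of "x / 2 - p"] by (simp add: power2_diff power_divide mult.commute)
  moreover have "2 * (p * y) \<le> y\<^sup>2 / 4 + 4 * p\<^sup>2"
    using zero_le_power2[of "y / 2 - 2 * p"] by (simp add: power2_diff power_divide power_mult_distrib mult_ac)
  moreover have "p\<^sup>2 \<ge> 0" by simp
  ultimately show ?thesis using assms unfolding abs_le_iff by argo
qed

text \<open>
  The advective terms reduce to \<open>u'\<^sup>2 ((a \<bullet> n)\<^sup>+ - a \<bullet> n / 2) = u'\<^sup>2 \<bar>a \<bullet> n\<bar> / 2\<close> on the boundary. An
  inverse inequality for \<open>\<kappa> u' \<Delta>u\<close> would leave the volume norm of \<open>u'\<close>, which the energy does not contain;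
  after integration by parts only a product of gradients and one more boundary flux remain.
\<close>

lemma element_coercivity:
  fixes K :: "(real^'n) set"
  assumes K: "solid_polytope K" and u: "poly_on K u" and u': "poly_on K u'" and a: "div_free_field K a"
    and pos: "\<kappa> > 0" "\<kappa>a \<ge> 0" "h > 0" "Ctrace > 0" "Cpen \<ge> 8 * Ctrace"
    and tr: "(norm0_bdry K (\<lambda>n x. grad K u x \<bullet> n))\<^sup>2 \<le> Ctrace / h * (seminorm1 K u)\<^sup>2"
    and tr': "(norm0_bdry K (\<lambda>n x. grad K u' x \<bullet> n))\<^sup>2 \<le> Ctrace / h * (seminorm1 K u')\<^sup>2"
  shows "\<kappa> * (seminorm1 K u)\<^sup>2 - vol_int K (\<lambda>x. u' x * (a x \<bullet> grad K u x)) + elem_form K h a \<kappa> \<kappa>a Cpen u u' u'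
     \<ge> (\<kappa> * (seminorm1 K u)\<^sup>2 + elem_energy K h a \<kappa> \<kappa>a Cpen u') / 4"
proof -
  note cK = solid_polytope_compact[OF K]
  note ca = div_free_field_continuous[OF a]
  note cont = ca poly_on_continuous[OF u'] continuous_on_grad[OF K u] continuous_on_grad[OF K u']
    poly_on_continuous[OF poly_on_laplacian[OF K u]]
  define x y B where "x = seminorm1 K u" and "y = seminorm1 K u'" and "B = norm0_bdry K (\<lambda>n. u')"
  have nn: "x \<ge> 0" "y \<ge> 0" "B \<ge> 0" by (simp_all add: x_def y_def B_def seminorm1_nonneg norm0_bdry_nonneg[OF K])
  define g where "g = vol_int K (\<lambda>x. grad K u' x \<bullet> grad K u x)"
  define b1 where "b1 = bdry_int K (\<lambda>n x. u' x * (grad K u x \<bullet> n))"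
  define b2 where "b2 = bdry_int K (\<lambda>n x. u' x * (grad K u' x \<bullet> n))"
  define W where "W = (adv_trace_norm K a u')\<^sup>2"
  define p where "p = B * sqrt (Ctrace / h)"
  have Ch: "Ctrace / h \<ge> 0" using pos by simp
  have lap: "vol_int K (\<lambda>x. u' x * laplacian K u x) = b1 - g"
  proof -
    have "b1 = g + vol_int K (\<lambda>x. u' x * laplacian K u x)"
      unfolding b1_def g_def green_poly[OF K u' u, symmetric]
      by (rule vol_int_add[OF cK]) (intro continuous_intros cont)+
    then show ?thesis by simp
  qed
  have conv: "vol_int K (\<lambda>x. u' x * (a x \<bullet> grad K u' x)) = bdry_int K (\<lambda>n x. u' x * u' x * (a x \<bullet> n)) / 2"
    using advection_by_parts[OF K u' u' a] by simp
  have W2: "bdry_int K (\<lambda>n x. u' x * u' x * max (a x \<bullet> n) 0) - bdry_int K (\<lambda>n x. u' x * u' x * (a x \<bullet> n)) / 2 = W / 2"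
  proof -
    have "W = bdry_int K (\<lambda>n x. 2 * (u' x * u' x * max (a x \<bullet> n) 0) + (-1) * (u' x * u' x * (a x \<bullet> n)))"
      unfolding W_def norm0_bdry_sq[OF K]
    proof (rule bdry_int_cong[OF K])
      fix n x
      have "(sqrt \<bar>t\<bar> * w)\<^sup>2 = 2 * (w * w * max t 0) + (-1) * (w * w * t)" for t w :: real
        unfolding power_mult_distrib by (simp add: max_def power2_eq_square)
      then show "(sqrt \<bar>a x \<bullet> n\<bar> * u' x)\<^sup>2 = 2 * (u' x * u' x * max (a x \<bullet> n) 0) + (-1) * (u' x * u' x * (a x \<bullet> n))" .
    qed
    also have "\<dots> = bdry_int K (\<lambda>n x. 2 * (u' x * u' x * max (a x \<bullet> n) 0)) + (-1) * bdry_int K (\<lambda>n x. u' x * u' x * (a x \<bullet> n))"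
      by (rule bdry_int_lincomb[OF K]) (intro continuous_intros cont)+
    finally show ?thesis by (simp add: bdry_int_cmult)
  qed
  have b2': "bdry_int K (\<lambda>n x. (grad K u' x \<bullet> n) * u' x) = b2"
    unfolding b2_def by (simp add: mult.commute)
  have y2: "vol_int K (\<lambda>x. grad K u' x \<bullet> grad K u' x) = y\<^sup>2"
    by (simp add: y_def seminorm1_sq power2_norm_eq_inner)
  have B2: "bdry_int K (\<lambda>n x. u' x * u' x) = B\<^sup>2"
    unfolding B_def norm0_bdry_sq[OF K] by (simp add: power2_eq_square)
  have eq: "\<kappa> * x\<^sup>2 - vol_int K (\<lambda>x. u' x * (a x \<bullet> grad K u x)) + elem_form K h a \<kappa> \<kappa>a Cpen u u' u'
      = \<kappa> * (x\<^sup>2 + g - b1 + y\<^sup>2 - 2 * b2 + Cpen / h * B\<^sup>2) + \<kappa>a * y\<^sup>2 + W / 2"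
    unfolding elem_form_expand[OF K u u' ca] lap b2' y2 B2 b2_def[symmetric] conv W2[symmetric]
    by (simp add: algebra_simps)
  have "\<bar>g\<bar> \<le> x * y"
    using vol_int_Cauchy_Schwarz_vec[OF cK continuous_on_grad[OF K u'] continuous_on_grad[OF K u]]
    by (simp add: g_def x_def y_def seminorm1_def mult.commute)
  moreover have "\<bar>b1\<bar> \<le> p * x"
  proof -
    have "\<bar>b1\<bar> \<le> B * norm0_bdry K (\<lambda>n x. grad K u x \<bullet> n)"
      unfolding b1_def B_def by (rule bdry_int_Cauchy_Schwarz[OF K]) (intro continuous_intros cont)+
    also have "\<dots> \<le> B * (sqrt (Ctrace / h) * x)"
      by (intro mult_left_mono sq_le_scaled_imp_le nn Ch) (use tr in \<open>simp add: x_def\<close>)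
    finally show ?thesis by (simp add: p_def)
  qed
  moreover have "\<bar>b2\<bar> \<le> p * y"
  proof -
    have "\<bar>b2\<bar> \<le> B * norm0_bdry K (\<lambda>n x. grad K u' x \<bullet> n)"
      unfolding b2_def B_def by (rule bdry_int_Cauchy_Schwarz[OF K]) (intro continuous_intros cont)+
    also have "\<dots> \<le> B * (sqrt (Ctrace / h) * y)"
      by (intro mult_left_mono sq_le_scaled_imp_le nn Ch) (use tr' in \<open>simp add: y_def\<close>)
    finally show ?thesis by (simp add: p_def)
  qed
  moreover have "8 * p\<^sup>2 \<le> Cpen / h * B\<^sup>2"
  proof -
    have "8 * p\<^sup>2 = (8 * Ctrace) / h * B\<^sup>2" using Ch by (simp add: p_def power_mult_distrib)
    also have "\<dots> \<le> Cpen / h * B\<^sup>2" using pos by (intro mult_right_mono divide_right_mono) auto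
    finally show ?thesis .
  qed
  ultimately have "(x\<^sup>2 + y\<^sup>2 + Cpen / h * B\<^sup>2) / 4 \<le> x\<^sup>2 + g - b1 + y\<^sup>2 - 2 * b2 + Cpen / h * B\<^sup>2"
    by (rule coercivity_arithmetic)
  then have "\<kappa> * ((x\<^sup>2 + y\<^sup>2 + Cpen / h * B\<^sup>2) / 4) \<le> \<kappa> * (x\<^sup>2 + g - b1 + y\<^sup>2 - 2 * b2 + Cpen / h * B\<^sup>2)"
    using pos by (intro mult_left_mono) auto
  moreover have "\<kappa>a * y\<^sup>2 \<ge> 0" "W \<ge> 0" using pos by (auto simp: W_def)
  ultimately have "\<kappa> * ((x\<^sup>2 + y\<^sup>2 + Cpen / h * B\<^sup>2) / 4) + (\<kappa>a * y\<^sup>2) / 4 + W / 4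
      \<le> \<kappa> * (x\<^sup>2 + g - b1 + y\<^sup>2 - 2 * b2 + Cpen / h * B\<^sup>2) + \<kappa>a * y\<^sup>2 + W / 2" by linarith
  moreover have "(\<kappa> * x\<^sup>2 + elem_energy K h a \<kappa> \<kappa>a Cpen u') / 4
      = \<kappa> * ((x\<^sup>2 + y\<^sup>2 + Cpen / h * B\<^sup>2) / 4) + (\<kappa>a * y\<^sup>2) / 4 + W / 4"
    unfolding elem_energy_def y_def[symmetric] B_def[symmetric] W_def[symmetric]
    by (simp add: algebra_simps add_divide_distrib)
  ultimately show ?thesis using eq unfolding x_def[symmetric] by linarith
qed

text \<open>
  The weight \<open>(a \<bullet> n)\<^sup>+ - a \<bullet> n\<close> is the negative part of \<open>a \<bullet> n\<close>, and lies between \<open>0\<close> and \<open>\<bar>a \<bullet> n\<bar>\<close>.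
\<close>

lemma advective_boundary_bound:
  fixes K :: "(real^'n) set"
  assumes K: "solid_polytope K" and u: "poly_on K u" and v: "poly_on K v" and a: "continuous_on K a"
  shows "\<bar>bdry_int K (\<lambda>n x. u x * v x * (max (a x \<bullet> n) 0 - a x \<bullet> n))\<bar>
    \<le> adv_trace_norm K a u * adv_trace_norm K a v"
proof -
  let ?s = "\<lambda>n x. sqrt (max (a x \<bullet> n) 0 - a x \<bullet> n)"
  note cont = a poly_on_continuous[OF u] poly_on_continuous[OF v]
  have le: "norm0_bdry K (\<lambda>n x. ?s n x * w x) \<le> adv_trace_norm K a w"
    if w: "continuous_on K w" for w
  proof -
    have "bdry_int K (\<lambda>n x. (?s n x * w x)\<^sup>2) \<le> bdry_int K (\<lambda>n x. (sqrt \<bar>a x \<bullet> n\<bar> * w x)\<^sup>2)"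
    proof (rule bdry_int_mono[OF K])
      fix n x
      have "(max (a x \<bullet> n) 0 - a x \<bullet> n) * (w x)\<^sup>2 \<le> \<bar>a x \<bullet> n\<bar> * (w x)\<^sup>2"
        by (rule mult_right_mono) auto
      then show "(?s n x * w x)\<^sup>2 \<le> (sqrt \<bar>a x \<bullet> n\<bar> * w x)\<^sup>2"
        by (simp add: power_mult_distrib)
    qed (intro continuous_intros cont w)+
    then show ?thesis by (simp add: norm0_bdry_def)
  qed
  have eq: "bdry_int K (\<lambda>n x. u x * v x * (max (a x \<bullet> n) 0 - a x \<bullet> n)) = bdry_int K (\<lambda>n x. (?s n x * u x) * (?s n x * v x))"
  proof (rule bdry_int_cong[OF K])
    fix n x
    have gen: "p * r * X = (q * p) * (q * r)" if "q * q = X" for p q r X :: real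
      unfolding that[symmetric] by simp
    have "sqrt X * sqrt X = X" if "X \<ge> 0" for X :: real using that by simp
    from this[of "max (a x \<bullet> n) 0 - a x \<bullet> n"] have "?s n x * ?s n x = max (a x \<bullet> n) 0 - a x \<bullet> n" by simp
    then show "u x * v x * (max (a x \<bullet> n) 0 - a x \<bullet> n) = (?s n x * u x) * (?s n x * v x)"
      by (rule gen)
  qed
  have "\<bar>bdry_int K (\<lambda>n x. (?s n x * u x) * (?s n x * v x))\<bar> \<le> norm0_bdry K (\<lambda>n x. ?s n x * u x) * norm0_bdry K (\<lambda>n x. ?s n x * v x)"
    by (rule bdry_int_Cauchy_Schwarz[OF K]) (intro continuous_intros cont)+
  also have "\<dots> \<le> adv_trace_norm K a u * adv_trace_norm K a v"
    by (intro mult_mono le cont norm0_bdry_nonneg K)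
  finally show ?thesis unfolding eq .
qed

text \<open>
  The numbers \<open>A1, ..., A4\<close> are the parts of the coercive norm of the trial function and the \<open>z\<close> those of the
  test function. Each \<open>z\<close> is at most \<open>c S\<close>, and the weights give \<open>(A1 + 2 A2 + 2 A3 + A4)\<^sup>2 \<le> 10 (A1\<^sup>2 + A2\<^sup>2 + A3\<^sup>2 + A4\<^sup>2)\<close>.
\<close>

lemma test_arithmetic:
  fixes S c A1 A2 A3 A4 z0 z1 z2 z3 :: real
  assumes z: "z0 \<le> c * S" "z1 \<le> c * S" "z2 \<le> c * S" "z3 \<le> c * S" and A: "A1 \<ge> 0" "A2 \<ge> 0" "A3 \<ge> 0" "A4 \<ge> 0"
  shows "S\<^sup>2 - A1 * z0 - A2 * z1 - A4 * z3 - A2 * z2 - A3 * z1 - A3 * z2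
     \<ge> S\<^sup>2 / 2 - 5 * c\<^sup>2 * (A1\<^sup>2 + A2\<^sup>2 + A3\<^sup>2 + A4\<^sup>2)"
proof -
  let ?A = "A1 + 2 * A2 + 2 * A3 + A4"
  have "A1 * z0 + A2 * z1 + A4 * z3 + A2 * z2 + A3 * z1 + A3 * z2
     \<le> A1 * (c * S) + A2 * (c * S) + A4 * (c * S) + A2 * (c * S) + A3 * (c * S) + A3 * (c * S)"
    by (intro add_mono mult_left_mono z A)
  also have "\<dots> = S * (c * ?A)" by (simp add: algebra_simps)
  finally have 1: "A1 * z0 + A2 * z1 + A4 * z3 + A2 * z2 + A3 * z1 + A3 * z2 \<le> S * (c * ?A)" .
  have 2: "S * (c * ?A) \<le> S\<^sup>2 / 2 + (c * ?A)\<^sup>2 / 2"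
    using zero_le_power2[of "S - c * ?A"] unfolding power2_diff by linarith
  have 3: "(c * ?A)\<^sup>2 = c\<^sup>2 * ?A\<^sup>2" by (rule power_mult_distrib)
  have 4: "c\<^sup>2 * ?A\<^sup>2 \<le> c\<^sup>2 * (10 * (A1\<^sup>2 + A2\<^sup>2 + A3\<^sup>2 + A4\<^sup>2))"
  proof (rule mult_left_mono)
    \<comment> \<open>Lagrange's identity for the vectors \<open>(1, 2, 2, 1)\<close> and \<open>(A1, A2, A3, A4)\<close>.\<close>
    have "10 * (A1\<^sup>2 + A2\<^sup>2 + A3\<^sup>2 + A4\<^sup>2) - ?A\<^sup>2
       = (2 * A1 - A2)\<^sup>2 + (2 * A1 - A3)\<^sup>2 + (A1 - A4)\<^sup>2 + 4 * (A2 - A3)\<^sup>2 + (A2 - 2 * A4)\<^sup>2 + (A3 - 2 * A4)\<^sup>2"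
      by (simp add: power2_eq_square algebra_simps)
    also have "\<dots> \<ge> 0" by (intro add_nonneg_nonneg) auto
    finally show "?A\<^sup>2 \<le> 10 * (A1\<^sup>2 + A2\<^sup>2 + A3\<^sup>2 + A4\<^sup>2)" by simp
  qed simp
  have 5: "c\<^sup>2 * (10 * (A1\<^sup>2 + A2\<^sup>2 + A3\<^sup>2 + A4\<^sup>2)) = 2 * (5 * c\<^sup>2 * (A1\<^sup>2 + A2\<^sup>2 + A3\<^sup>2 + A4\<^sup>2))" by simp
  show ?thesis using 1 2 4 unfolding 3 5 by linarith
qed

text \<open>
  Moving the advective derivative from \<open>v'\<close> to \<open>u'\<close> completes the product of \<open>v'\<close> with the streamline
  derivative of \<open>u + u'\<close>, which is \<open>S\<^sup>2\<close> by assumption, and leaves a boundary term with the negative part of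
  \<open>a \<bullet> n\<close>. Every remaining term is a product of a part of the norm of the trial function and one of the
  test function.
\<close>

lemma element_test_bound:
  fixes K :: "(real^'n) set"
  assumes K: "solid_polytope K" and u: "poly_on K u" and u': "poly_on K u'" and v': "poly_on K v'"
    and a: "div_free_field K a"
    and pos: "\<kappa> > 0" "\<kappa>a \<ge> 0" "h > 0" "Ctrace > 0" "Cinv > 0" "Cpen \<ge> Ctrace" "c \<ge> 0" "S \<ge> 0"
    and tru': "(norm0_bdry K (\<lambda>n x. grad K u' x \<bullet> n))\<^sup>2 \<le> Ctrace / h * (seminorm1 K u')\<^sup>2"
    and trv': "(norm0_bdry K (\<lambda>n x. grad K v' x \<bullet> n))\<^sup>2 \<le> Ctrace / h * (seminorm1 K v')\<^sup>2"
    and lap: "(norm0 K (laplacian K u))\<^sup>2 \<le> Cinv / h\<^sup>2 * (seminorm1 K u)\<^sup>2"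
    and S: "vol_int K (\<lambda>x. v' x * (a x \<bullet> grad K u x)) + vol_int K (\<lambda>x. v' x * (a x \<bullet> grad K u' x)) = S\<^sup>2"
    and B0: "\<kappa> * (Cinv / h\<^sup>2) * (norm0 K v')\<^sup>2 \<le> c\<^sup>2 * S\<^sup>2"
    and B1: "(\<kappa> + \<kappa>a) * (seminorm1 K v')\<^sup>2 \<le> c\<^sup>2 * S\<^sup>2"
    and B2: "Cpen * \<kappa> / h * (norm0_bdry K (\<lambda>n. v'))\<^sup>2 \<le> c\<^sup>2 * S\<^sup>2"
    and B3: "(adv_trace_norm K a v')\<^sup>2 \<le> c\<^sup>2 * S\<^sup>2"
  shows "elem_form K h a \<kappa> \<kappa>a Cpen u u' v'
     \<ge> S\<^sup>2 / 2 - 5 * c\<^sup>2 * (\<kappa> * (seminorm1 K u)\<^sup>2 + elem_energy K h a \<kappa> \<kappa>a Cpen u')"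
proof -
  note cK = solid_polytope_compact[OF K]
  note ca = div_free_field_continuous[OF a]
  note cont = ca poly_on_continuous[OF u'] poly_on_continuous[OF v'] continuous_on_grad[OF K u] 
    continuous_on_grad[OF K u'] continuous_on_grad[OF K v'] poly_on_continuous[OF poly_on_laplacian[OF K u]]
  define s0 s1 s2 s3 where "s0 = sqrt \<kappa>" and "s1 = sqrt (\<kappa> + \<kappa>a)" and "s2 = sqrt (Cpen * \<kappa> / h)"
    and "s3 = sqrt (Cinv / h\<^sup>2)"
  have s: "s0 \<ge> 0" "s1 \<ge> 0" "s2 \<ge> 0" "s3 \<ge> 0" "s0 \<le> s1"
    "s0\<^sup>2 = \<kappa>" "s1\<^sup>2 = \<kappa> + \<kappa>a" "s2\<^sup>2 = Cpen * \<kappa> / h" "s3\<^sup>2 = Cinv / h\<^sup>2"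
    using pos by (auto simp: s0_def s1_def s2_def s3_def)
  \<comment> \<open>One power of the trace constant is traded for the penalty constant, so that boundary fluxes are measured in the penalty norm.\<close>
  have s02: "\<kappa> * sqrt (Ctrace / h) \<le> s0 * s2"
  proof -
    have "\<kappa> * sqrt (Ctrace / h) \<le> \<kappa> * sqrt (Cpen / h)"
      using pos by (intro mult_left_mono) (auto simp: divide_right_mono)
    also have "\<dots> = sqrt (\<kappa>\<^sup>2 * (Cpen / h))" unfolding real_sqrt_mult using pos by simp
    also have "\<kappa>\<^sup>2 * (Cpen / h) = \<kappa> * (Cpen * \<kappa> / h)" by (simp add: power2_eq_square)
    finally show ?thesis unfolding s0_def s2_def by (simp only: real_sqrt_mult)
  qed
  define x y B E where "x = seminorm1 K u" and "y = seminorm1 K u'" and "B = norm0_bdry K (\<lambda>n. u')"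
    and "E = adv_trace_norm K a u'"
  define m z b f where "m = norm0 K v'" and "z = seminorm1 K v'" and "b = norm0_bdry K (\<lambda>n. v')"
    and "f = adv_trace_norm K a v'"
  have nn: "x \<ge> 0" "y \<ge> 0" "B \<ge> 0" "E \<ge> 0" "m \<ge> 0" "z \<ge> 0" "b \<ge> 0" "f \<ge> 0"
    by (simp_all add: x_def y_def B_def E_def m_def z_def b_def f_def seminorm1_nonneg norm0_nonneg norm0_bdry_nonneg[OF K])
  have Ch: "Ctrace / h \<ge> 0" "Cinv / h\<^sup>2 \<ge> 0" using pos by simp_all
  have cS: "c * S \<ge> 0" using pos by simp
  have Z: "s0 * s3 * m \<le> c * S" "s1 * z \<le> c * S" "s2 * b \<le> c * S" "f \<le> c * S"
  proof -
    have le: "w \<le> c * S" if "w\<^sup>2 \<le> c\<^sup>2 * S\<^sup>2" for w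
      by (rule power2_le_imp_le[OF _ cS]) (use that in \<open>simp add: power_mult_distrib\<close>)
    show "s0 * s3 * m \<le> c * S" "s1 * z \<le> c * S" "s2 * b \<le> c * S" "f \<le> c * S"
      using B0 B1 B2 B3
      by (intro le; simp only: power_mult_distrib s m_def z_def b_def f_def)+
  qed
  have t1: "\<bar>\<kappa> * vol_int K (\<lambda>x. v' x * laplacian K u x)\<bar> \<le> (s0 * x) * (s0 * s3 * m)"
  proof -
    have "\<bar>vol_int K (\<lambda>x. v' x * laplacian K u x)\<bar> \<le> m * norm0 K (laplacian K u)"
      unfolding m_def by (rule vol_int_Cauchy_Schwarz[OF cK]) (intro cont)+
    also have "\<dots> \<le> m * (s3 * x)"
      unfolding s3_def by (intro mult_left_mono sq_le_scaled_imp_le nn Ch) (use lap in \<open>simp add: x_def\<close>)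
    finally have "\<kappa> * \<bar>vol_int K (\<lambda>x. v' x * laplacian K u x)\<bar> \<le> \<kappa> * (m * (s3 * x))"
      using pos by (intro mult_left_mono) auto
    also have "\<dots> = (s0 * x) * (s0 * s3 * m)" unfolding s(6)[symmetric] by (simp add: power2_eq_square)
    finally show ?thesis using pos by (simp add: abs_mult)
  qed
  have t2: "\<bar>(\<kappa> + \<kappa>a) * vol_int K (\<lambda>x. grad K u' x \<bullet> grad K v' x)\<bar> \<le> (s1 * y) * (s1 * z)"
  proof -
    have "\<bar>vol_int K (\<lambda>x. grad K u' x \<bullet> grad K v' x)\<bar> \<le> y * z"
      using vol_int_Cauchy_Schwarz_vec[OF cK continuous_on_grad[OF K u'] continuous_on_grad[OF K v']]
      by (simp add: y_def z_def seminorm1_def)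
    then have "(\<kappa> + \<kappa>a) * \<bar>vol_int K (\<lambda>x. grad K u' x \<bullet> grad K v' x)\<bar> \<le> (\<kappa> + \<kappa>a) * (y * z)"
      using pos by (intro mult_left_mono) auto
    also have "\<dots> = (s1 * y) * (s1 * z)" unfolding s(7)[symmetric] by (simp add: power2_eq_square)
    finally show ?thesis using pos by (simp add: abs_mult)
  qed
  have t3: "\<bar>bdry_int K (\<lambda>n x. u' x * v' x * (max (a x \<bullet> n) 0 - a x \<bullet> n))\<bar> \<le> E * f"
    unfolding E_def f_def by (rule advective_boundary_bound[OF K u' v' ca])
  have t4: "\<bar>\<kappa> * bdry_int K (\<lambda>n x. (grad K u' x \<bullet> n) * v' x)\<bar> \<le> (s1 * y) * (s2 * b)"
  proof -
    have "\<bar>bdry_int K (\<lambda>n x. (grad K u' x \<bullet> n) * v' x)\<bar> \<le> norm0_bdry K (\<lambda>n x. grad K u' x \<bullet> n) * b"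
      unfolding b_def by (rule bdry_int_Cauchy_Schwarz[OF K]) (intro continuous_intros cont)+
    also have "\<dots> \<le> (sqrt (Ctrace / h) * y) * b"
      by (intro mult_right_mono sq_le_scaled_imp_le nn Ch) (use tru' in \<open>simp add: y_def\<close>)
    finally have "\<kappa> * \<bar>bdry_int K (\<lambda>n x. (grad K u' x \<bullet> n) * v' x)\<bar> \<le> \<kappa> * ((sqrt (Ctrace / h) * y) * b)"
      using pos by (intro mult_left_mono) auto
    also have "\<dots> = (\<kappa> * sqrt (Ctrace / h)) * (y * b)" by simp
    also have "\<dots> \<le> (s0 * s2) * (y * b)" using s02 nn by (intro mult_right_mono) auto
    also have "\<dots> \<le> (s1 * s2) * (y * b)" using s nn by (intro mult_right_mono) auto
    finally show ?thesis using pos by (simp add: abs_mult mult_ac)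
  qed
  have t5: "\<bar>\<kappa> * bdry_int K (\<lambda>n x. u' x * (grad K v' x \<bullet> n))\<bar> \<le> (s2 * B) * (s1 * z)"
  proof -
    have "\<bar>bdry_int K (\<lambda>n x. u' x * (grad K v' x \<bullet> n))\<bar> \<le> B * norm0_bdry K (\<lambda>n x. grad K v' x \<bullet> n)"
      unfolding B_def by (rule bdry_int_Cauchy_Schwarz[OF K]) (intro continuous_intros cont)+
    also have "\<dots> \<le> B * (sqrt (Ctrace / h) * z)"
      by (intro mult_left_mono sq_le_scaled_imp_le nn Ch) (use trv' in \<open>simp add: z_def\<close>)
    finally have "\<kappa> * \<bar>bdry_int K (\<lambda>n x. u' x * (grad K v' x \<bullet> n))\<bar> \<le> \<kappa> * (B * (sqrt (Ctrace / h) * z))"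
      using pos by (intro mult_left_mono) auto
    also have "\<dots> = (\<kappa> * sqrt (Ctrace / h)) * (B * z)" by simp
    also have "\<dots> \<le> (s0 * s2) * (B * z)" using s02 nn by (intro mult_right_mono) auto
    also have "\<dots> \<le> (s1 * s2) * (B * z)" using s nn by (intro mult_right_mono) auto
    finally show ?thesis using pos by (simp add: abs_mult mult_ac)
  qed
  have t6: "\<bar>Cpen * \<kappa> / h * bdry_int K (\<lambda>n x. u' x * v' x)\<bar> \<le> (s2 * B) * (s2 * b)"
  proof -
    have "\<bar>bdry_int K (\<lambda>n x. u' x * v' x)\<bar> \<le> B * b"
      unfolding B_def b_def by (rule bdry_int_Cauchy_Schwarz[OF K]) (intro cont)+
    then have "s2\<^sup>2 * \<bar>bdry_int K (\<lambda>n x. u' x * v' x)\<bar> \<le> s2\<^sup>2 * (B * b)" by (intro mult_left_mono) auto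
    then show ?thesis unfolding s(8)[symmetric] by (simp add: abs_mult power2_eq_square mult_ac)
  qed
  have adv: "bdry_int K (\<lambda>n x. u' x * v' x * max (a x \<bullet> n) 0) - vol_int K (\<lambda>x. u' x * (a x \<bullet> grad K v' x))
     = vol_int K (\<lambda>x. v' x * (a x \<bullet> grad K u' x)) + bdry_int K (\<lambda>n x. u' x * v' x * (max (a x \<bullet> n) 0 - a x \<bullet> n))"
  proof -
    have "bdry_int K (\<lambda>n x. u' x * v' x * (max (a x \<bullet> n) 0 - a x \<bullet> n))
       = bdry_int K (\<lambda>n x. u' x * v' x * max (a x \<bullet> n) 0 + (-1) * (u' x * v' x * (a x \<bullet> n)))"
      by (simp add: algebra_simps)
    also have "\<dots> = bdry_int K (\<lambda>n x. u' x * v' x * max (a x \<bullet> n) 0) + (-1) * bdry_int K (\<lambda>n x. u' x * v' x * (a x \<bullet> n))"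
      by (rule bdry_int_lincomb[OF K]) (intro continuous_intros cont)+
    finally show ?thesis using advection_by_parts[OF K u' v' a] by simp
  qed
  have 1: "elem_form K h a \<kappa> \<kappa>a Cpen u u' v' \<ge> S\<^sup>2 - (s0 * x) * (s0 * s3 * m) - (s1 * y) * (s1 * z) - E * f
     - (s1 * y) * (s2 * b) - (s2 * B) * (s1 * z) - (s2 * B) * (s2 * b)"
    unfolding elem_form_expand[OF K u v' ca]
    using t1 t2 t3 t4 t5 t6 adv S unfolding abs_le_iff by linarith
  have 2: "S\<^sup>2 - (s0 * x) * (s0 * s3 * m) - (s1 * y) * (s1 * z) - E * f
     - (s1 * y) * (s2 * b) - (s2 * B) * (s1 * z) - (s2 * B) * (s2 * b)
     \<ge> S\<^sup>2 / 2 - 5 * c\<^sup>2 * ((s0 * x)\<^sup>2 + (s1 * y)\<^sup>2 + (s2 * B)\<^sup>2 + E\<^sup>2)"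
    by (rule test_arithmetic) (use Z s nn in auto)
  have 3: "(s0 * x)\<^sup>2 + (s1 * y)\<^sup>2 + (s2 * B)\<^sup>2 + E\<^sup>2 = \<kappa> * x\<^sup>2 + elem_energy K h a \<kappa> \<kappa>a Cpen u'"
    by (simp add: power_mult_distrib s elem_energy_def y_def B_def E_def)
  show ?thesis using order_trans[OF 2 1] unfolding 3 unfolding x_def .
qed

lemma time_scale_props:
  assumes "norm_inf K a \<ge> 0" "Cinv > 0" "\<kappa> > 0" "h K > 0"
  shows "time_scale Cinv a \<kappa> h K > 0" "time_scale Cinv a \<kappa> h K * (norm_inf K a / h K) \<le> 1"
    "time_scale Cinv a \<kappa> h K * (Cinv * \<kappa> / (h K)\<^sup>2) \<le> 1"
proof -
  let ?m = "max (norm_inf K a / h K) (Cinv * \<kappa> / (h K)\<^sup>2)"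
  have m: "?m > 0" using assms by (simp add: less_max_iff_disj)
  then show "time_scale Cinv a \<kappa> h K > 0" by (simp add: time_scale_def)
  have *: "time_scale Cinv a \<kappa> h K * q \<le> 1" if "q \<le> ?m" for q
    using m that by (simp add: time_scale_def divide_le_eq_1 field_simps)
  show "time_scale Cinv a \<kappa> h K * (norm_inf K a / h K) \<le> 1" by (rule *) simp
  show "time_scale Cinv a \<kappa> h K * (Cinv * \<kappa> / (h K)\<^sup>2) \<le> 1" by (rule *) simp
qed

text \<open>
  The squared norm of the test function carries a factor \<open>Ctau T\<close>. The inverse and trace
  inequalities lose powers of \<open>1/h\<close>, and in each of the five quantities these combine with \<open>T\<close> to
  the dimensionless numbers \<open>T \<alpha> / h\<close> and \<open>T Cinv \<kappa> / h\<^sup>2\<close>, which the choice of the time scale \<open>T\<close> makes at most one.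
\<close>

lemma test_function_bounds:
  fixes K :: "(real^'n) set" and T :: real
  assumes K: "solid_polytope K" and v': "poly_on K v'" and a: "continuous_on K a"
    and pos: "\<kappa> > 0" "h > 0" "Ctrace > 0" "Cinv > 0" "Cpen > 0" "Cart \<ge> 0" "Ctau > 0" "T > 0"
    and al: "\<And>x. x \<in> K \<Longrightarrow> norm (a x) \<le> \<alpha>" "\<alpha> \<ge> 0"
    and T: "T * (\<alpha> / h) \<le> 1" "T * (Cinv * \<kappa> / h\<^sup>2) \<le> 1"
    and m: "(norm0 K v')\<^sup>2 = Ctau * T * S\<^sup>2"
    and tr: "(norm0_bdry K (\<lambda>n. v'))\<^sup>2 \<le> Ctrace / h * (norm0 K v')\<^sup>2"
    and inv: "(seminorm1 K v')\<^sup>2 \<le> Cinv / h\<^sup>2 * (norm0 K v')\<^sup>2"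
  shows "\<kappa> * (Cinv / h\<^sup>2) * (norm0 K v')\<^sup>2 \<le> Ctau * S\<^sup>2"
    and "(\<kappa> + Cart * T * \<alpha>\<^sup>2) * (seminorm1 K v')\<^sup>2 \<le> (Ctau + Cart * Ctau * Cinv) * S\<^sup>2"
    and "Cpen * \<kappa> / h * (norm0_bdry K (\<lambda>n. v'))\<^sup>2 \<le> Cpen * Ctrace * Ctau / Cinv * S\<^sup>2"
    and "(adv_trace_norm K a v')\<^sup>2 \<le> Ctrace * Ctau * S\<^sup>2"
    and "(norm0 K (\<lambda>x. sqrt (Ctau * T) * (a x \<bullet> grad K v' x)))\<^sup>2 \<le> Cinv * Ctau\<^sup>2 * S\<^sup>2"
proof -
  note cK = solid_polytope_compact[OF K]
  note cont = a poly_on_continuous[OF v'] continuous_on_grad[OF K v']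
  \<comment> \<open>The two dimensionless numbers.\<close>
  define r q where "r = T * (\<alpha> / h)" and "q = T * (Cinv * \<kappa> / h\<^sup>2)"
  have r: "0 \<le> r" "r \<le> 1" "r\<^sup>2 \<le> 1" and q: "0 \<le> q" "q \<le> 1"
    using pos al(2) T by (auto simp: r_def q_def power_le_one)
  have S2: "Ctau * S\<^sup>2 \<ge> 0" using pos by simp
  have up: "k * X \<le> X" if "k \<le> 1" "X \<ge> 0" for k X :: real
    using that mult_right_mono[of k 1 X] by simp
  show 1: "\<kappa> * (Cinv / h\<^sup>2) * (norm0 K v')\<^sup>2 \<le> Ctau * S\<^sup>2"
  proof -
    have "\<kappa> * (Cinv / h\<^sup>2) * (norm0 K v')\<^sup>2 = q * (Ctau * S\<^sup>2)" by (simp add: m q_def)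
    then show ?thesis using up[OF q(2) S2] by simp
  qed
  have z: "(seminorm1 K v')\<^sup>2 \<le> Cinv / h\<^sup>2 * (Ctau * T * S\<^sup>2)" using inv m by simp
  have b: "(norm0_bdry K (\<lambda>n. v'))\<^sup>2 \<le> Ctrace / h * (Ctau * T * S\<^sup>2)" using tr m by simp
  show "(\<kappa> + Cart * T * \<alpha>\<^sup>2) * (seminorm1 K v')\<^sup>2 \<le> (Ctau + Cart * Ctau * Cinv) * S\<^sup>2"
  proof -
    have "(\<kappa> + Cart * T * \<alpha>\<^sup>2) * (seminorm1 K v')\<^sup>2 \<le> (\<kappa> + Cart * T * \<alpha>\<^sup>2) * (Cinv / h\<^sup>2 * (Ctau * T * S\<^sup>2))"
      using pos by (intro mult_left_mono z) auto
    also have "\<dots> = q * (Ctau * S\<^sup>2) + r\<^sup>2 * (Cart * Ctau * Cinv * S\<^sup>2)"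
      using pos by (simp add: q_def r_def power2_eq_square field_simps)
    also have "\<dots> \<le> Ctau * S\<^sup>2 + Cart * Ctau * Cinv * S\<^sup>2"
      using pos by (intro add_mono up q r) auto
    finally show ?thesis by (simp add: algebra_simps)
  qed
  show "Cpen * \<kappa> / h * (norm0_bdry K (\<lambda>n. v'))\<^sup>2 \<le> Cpen * Ctrace * Ctau / Cinv * S\<^sup>2"
  proof -
    have "Cpen * \<kappa> / h * (norm0_bdry K (\<lambda>n. v'))\<^sup>2 \<le> Cpen * \<kappa> / h * (Ctrace / h * (Ctau * T * S\<^sup>2))"
      using pos by (intro mult_left_mono b) auto
    also have "\<dots> = q * (Cpen * Ctrace * Ctau / Cinv * S\<^sup>2)"
      using pos by (simp add: q_def power2_eq_square field_simps)
    also have "\<dots> \<le> Cpen * Ctrace * Ctau / Cinv * S\<^sup>2" using pos by (intro up q) auto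
    finally show ?thesis .
  qed
  show "(adv_trace_norm K a v')\<^sup>2 \<le> Ctrace * Ctau * S\<^sup>2"
  proof -
    have "(adv_trace_norm K a v')\<^sup>2 = bdry_int K (\<lambda>n x. \<bar>a x \<bullet> n\<bar> * (v' x)\<^sup>2)"
      by (simp add: norm0_bdry_sq[OF K] power_mult_distrib)
    also have "\<dots> \<le> bdry_int K (\<lambda>n x. \<alpha> * (v' x)\<^sup>2)"
    proof (rule bdry_int_mono[OF K])
      fix n x assume n: "norm (n :: real^'n) = 1" and x: "x \<in> K"
      have "\<bar>a x \<bullet> n\<bar> \<le> norm (a x) * norm n" by (rule Cauchy_Schwarz_ineq2)
      also have "\<dots> \<le> \<alpha>" using al(1)[OF x] n by simp
      finally show "\<bar>a x \<bullet> n\<bar> * (v' x)\<^sup>2 \<le> \<alpha> * (v' x)\<^sup>2" by (rule mult_right_mono) simp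
    qed (intro continuous_intros cont)+
    also have "\<dots> = \<alpha> * (norm0_bdry K (\<lambda>n. v'))\<^sup>2" by (simp add: norm0_bdry_sq[OF K] bdry_int_cmult)
    also have "\<dots> \<le> \<alpha> * (Ctrace / h * (Ctau * T * S\<^sup>2))" by (intro mult_left_mono b al)
    also have "\<dots> = r * (Ctrace * Ctau * S\<^sup>2)" by (simp add: r_def)
    also have "\<dots> \<le> Ctrace * Ctau * S\<^sup>2" using pos by (intro up r) auto
    finally show ?thesis .
  qed
  show "(norm0 K (\<lambda>x. sqrt (Ctau * T) * (a x \<bullet> grad K v' x)))\<^sup>2 \<le> Cinv * Ctau\<^sup>2 * S\<^sup>2"
  proof -
    have "(norm0 K (\<lambda>x. sqrt (Ctau * T) * (a x \<bullet> grad K v' x)))\<^sup>2 = vol_int K (\<lambda>x. (Ctau * T) * (a x \<bullet> grad K v' x)\<^sup>2)"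
      using pos by (simp add: norm0_sq power_mult_distrib)
    also have "\<dots> \<le> vol_int K (\<lambda>x. (Ctau * T * \<alpha>\<^sup>2) * (norm (grad K v' x))\<^sup>2)"
    proof (rule vol_int_mono[OF cK])
      fix x assume x: "x \<in> K"
      have "\<bar>a x \<bullet> grad K v' x\<bar> \<le> norm (a x) * norm (grad K v' x)" by (rule Cauchy_Schwarz_ineq2)
      also have "\<dots> \<le> \<alpha> * norm (grad K v' x)" by (intro mult_right_mono al x) simp
      finally have "(a x \<bullet> grad K v' x)\<^sup>2 \<le> (\<alpha> * norm (grad K v' x))\<^sup>2"
        by (metis abs_ge_zero power2_abs power_mono)
      then have "(Ctau * T) * (a x \<bullet> grad K v' x)\<^sup>2 \<le> (Ctau * T) * (\<alpha> * norm (grad K v' x))\<^sup>2"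
        using pos by (intro mult_left_mono) auto
      then show "(Ctau * T) * (a x \<bullet> grad K v' x)\<^sup>2 \<le> (Ctau * T * \<alpha>\<^sup>2) * (norm (grad K v' x))\<^sup>2"
        by (simp add: power_mult_distrib)
    qed (intro continuous_intros cont)+
    also have "\<dots> = (Ctau * T * \<alpha>\<^sup>2) * (seminorm1 K v')\<^sup>2" by (simp only: vol_int_cmult seminorm1_sq)
    also have "\<dots> \<le> (Ctau * T * \<alpha>\<^sup>2) * (Cinv / h\<^sup>2 * (Ctau * T * S\<^sup>2))"
      using pos by (intro mult_left_mono z) auto
    also have "\<dots> = r\<^sup>2 * (Cinv * Ctau\<^sup>2 * S\<^sup>2)"
      by (simp add: r_def power2_eq_square field_simps)
    also have "\<dots> \<le> Cinv * Ctau\<^sup>2 * S\<^sup>2" using pos by (intro up r) auto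
    finally show ?thesis .
  qed
qed

section \<open>The mean space and the global form\<close>

lemma smooth_imp_C1_field:
  fixes a :: "real^'n \<Rightarrow> real^'n"
  assumes op: "open \<Omega>" and sm: "smooth_up_to_boundary \<Omega> a"
  shows "\<exists>D. C1_field (closure \<Omega>) \<Omega> a D \<and> (\<forall>x\<in>\<Omega>. (\<Sum>i\<in>UNIV. D i x) = divg \<Omega> a x)"
proof -
  have c: "continuous_on (closure \<Omega>) a" using sm by (simp add: smooth_up_to_boundary_def)
  have ck: "Ck_up_to_boundary (Suc 0) \<Omega> (\<lambda>x. a x $ i)" for i
    using sm unfolding smooth_up_to_boundary_def by blast
  have diff: "(\<lambda>x. a x $ i) differentiable (at x)" if "x \<in> \<Omega>" for i x
    using ck[of i] that by simp
  have "\<forall>i. \<exists>g. continuous_on (closure \<Omega>) g \<and> (\<forall>x\<in>\<Omega>. g x = grad \<Omega> (\<lambda>x. a x $ i) x $ i)"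
    using ck by simp
  then have "\<exists>D. \<forall>i. continuous_on (closure \<Omega>) (D i) \<and> (\<forall>x\<in>\<Omega>. D i x = grad \<Omega> (\<lambda>x. a x $ i) x $ i)"
    by (rule choice)
  then obtain D where D0: "\<forall>i. continuous_on (closure \<Omega>) (D i) \<and> (\<forall>x\<in>\<Omega>. D i x = grad \<Omega> (\<lambda>x. a x $ i) x $ i)"
    by (rule exE)
  have D: "\<And>i. continuous_on (closure \<Omega>) (D i)"
    "\<And>i x. x \<in> \<Omega> \<Longrightarrow> D i x = grad \<Omega> (\<lambda>x. a x $ i) x $ i"
    using D0 by blast+
  have "((\<lambda>t. a (x + t *\<^sub>R axis i 1) $ i) has_real_derivative D i x) (at 0)" if x: "x \<in> \<Omega>" for x i
  proof -
    let ?F = "frechet_derivative (\<lambda>x. a x $ i) (at x)"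
    have Di: "D i x = ?F (axis i 1)" using D(2)[OF x] by (simp add: grad_def at_within_open[OF x op])
    have F: "((\<lambda>x. a x $ i) has_derivative ?F) (at x)" using diff[OF x] frechet_derivative_works by blast
    then have lin: "linear ?F" by (rule has_derivative_linear)
    have "((\<lambda>x. a x $ i) has_derivative ?F) (at (x + 0 *\<^sub>R axis i 1))" using F by simp
    moreover have "((\<lambda>t. x + t *\<^sub>R axis i 1) has_derivative (\<lambda>t. t *\<^sub>R axis i 1)) (at 0)"
      by (auto intro!: derivative_eq_intros)
    ultimately have "((\<lambda>x. a x $ i) \<circ> (\<lambda>t. x + t *\<^sub>R axis i 1) has_derivative ?F \<circ> (\<lambda>t. t *\<^sub>R axis i 1)) (at 0)"
      by (intro diff_chain_at)
    then have "((\<lambda>t. a (x + t *\<^sub>R axis i 1) $ i) has_derivative (\<lambda>t. t * D i x)) (at 0)"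
      by (simp add: o_def linear_scale[OF lin] Di)
    then show ?thesis by (simp add: has_field_derivative_def mult_commute_abs)
  qed
  then have "C1_field (closure \<Omega>) \<Omega> a D" using c D(1) by (simp add: C1_field_def)
  moreover have "(\<Sum>i\<in>UNIV. D i x) = divg \<Omega> a x" if "x \<in> \<Omega>" for x
    using D(2)[OF that] by (simp add: divg_def)
  ultimately show ?thesis by blast
qed

lemma C1_field_subset:
  "C1_field S U b D \<Longrightarrow> T \<subseteq> S \<Longrightarrow> V \<subseteq> U \<Longrightarrow> C1_field T V b D"
  unfolding C1_field_def by (meson continuous_on_subset subsetD)

lemma div_free_on_closure:
  assumes b: "C1_field (closure \<Omega>) \<Omega> b D" and z: "\<And>x. x \<in> \<Omega> \<Longrightarrow> (\<Sum>i\<in>UNIV. D i x) = 0" and x: "x \<in> closure \<Omega>"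
  shows "(\<Sum>i\<in>UNIV. D i x) = 0"
proof -
  have "continuous_on (closure \<Omega>) (\<lambda>x. \<Sum>i\<in>UNIV. D i x)"
    using b by (intro continuous_on_sum) (auto simp: C1_field_def)
  from continuous_constant_on_closure[OF this z x] show ?thesis .
qed

lemma C1_field_id: "C1_field S U (\<lambda>x::real^'n. x) (\<lambda>i x. 1)"
  unfolding C1_field_def
proof (intro conjI allI ballI continuous_on_id continuous_on_const)
  fix x :: "real^'n" and i
  have "((\<lambda>t. x $ i + t) has_real_derivative 1) (at 0)" by (auto intro!: derivative_eq_intros)
  then show "((\<lambda>t. (x + t *\<^sub>R axis i 1) $ i) has_real_derivative 1) (at 0)" by (simp add: axis_def)
qed

lemma grad_interior_element:
  assumes m: "solid_mesh \<Omega> M" and K: "K \<in> M" and x: "x \<in> interior K"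
  shows "grad \<Omega> v x = grad K v x"
proof -
  have "x \<in> \<Omega>" using solid_mesh_interior_subset[OF m K] x by blast
  then have "at x within \<Omega> = at x" using solid_mesh_open[OF m] by (rule at_within_open)
  then show ?thesis by (simp add: grad_def at_within_interior[OF x])
qed

lemma seminorm1_mesh:
  assumes m: "solid_mesh \<Omega> M" and v: "\<And>K. K \<in> M \<Longrightarrow> poly_on K v"
  shows "(seminorm1 \<Omega> v)\<^sup>2 = (\<Sum>K\<in>M. (seminorm1 K v)\<^sup>2)"
  unfolding seminorm1_sq
proof (rule vol_int_mesh[OF m])
  fix K assume K: "K \<in> M"
  have "solid_polytope K" by (rule solid_mesh_element[OF m K])
  then show "continuous_on K (\<lambda>x. (norm (grad K v x))\<^sup>2)"
    by (intro continuous_intros continuous_on_grad v K)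
qed (simp add: grad_interior_element[OF m])

text \<open>
  This is applied with \<open>b = a\<close>, where it says that the advective form is skew-symmetric, and with the
  identity field, where it yields a Poincare type statement.
\<close>

lemma mean_advection_zero:
  assumes m: "solid_mesh \<Omega> M" and bd: "bounded \<Omega>"
    and v: "continuous_on (closure \<Omega>) v" "\<And>x. x \<notin> \<Omega> \<Longrightarrow> v x = 0" "\<And>K. K \<in> M \<Longrightarrow> poly_on K v"
    and b: "C1_field (closure \<Omega>) \<Omega> b D"
  shows "(\<Sum>K\<in>M. vol_int K (\<lambda>x. 2 * (v x * (b x \<bullet> grad K v x)) + (v x)\<^sup>2 * (\<Sum>i\<in>UNIV. D i x))) = 0"
proof -
  have "(\<Sum>K\<in>M. vol_int K (\<lambda>x. grad K (\<lambda>x. v x * v x) x \<bullet> b x + v x * v x * (\<Sum>i\<in>UNIV. D i x))) = 0"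
    by (rule mesh_divergence_zero[OF m bd _ _ _ b]) (auto intro!: continuous_intros poly_on_mult v)
  moreover have "vol_int K (\<lambda>x. grad K (\<lambda>x. v x * v x) x \<bullet> b x + v x * v x * (\<Sum>i\<in>UNIV. D i x))
      = vol_int K (\<lambda>x. 2 * (v x * (b x \<bullet> grad K v x)) + (v x)\<^sup>2 * (\<Sum>i\<in>UNIV. D i x))" if K: "K \<in> M" for K
  proof (rule vol_int_cong)
    fix x assume "x \<in> K"
    then have "grad K (\<lambda>x. v x * v x) x = v x *\<^sub>R grad K v x + v x *\<^sub>R grad K v x"
      by (intro grad_mult v(3) solid_mesh_element[OF m] K)
    then show "grad K (\<lambda>x. v x * v x) x \<bullet> b x + v x * v x * (\<Sum>i\<in>UNIV. D i x)
      = 2 * (v x * (b x \<bullet> grad K v x)) + (v x)\<^sup>2 * (\<Sum>i\<in>UNIV. D i x)"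
      unfolding power2_eq_square
      by (simp only: inner_add_left inner_scaleR_left inner_commute[of "b x"])
  qed
  ultimately show ?thesis by simp
qed

lemma form_bar_self:
  assumes m: "solid_mesh \<Omega> M" and bd: "bounded \<Omega>"
    and v: "continuous_on (closure \<Omega>) v" "\<And>x. x \<notin> \<Omega> \<Longrightarrow> v x = 0" "\<And>K. K \<in> M \<Longrightarrow> poly_on K v"
    and a: "C1_field (closure \<Omega>) \<Omega> a D" "\<And>x. x \<in> closure \<Omega> \<Longrightarrow> (\<Sum>i\<in>UNIV. D i x) = 0"
  shows "form_bar \<Omega> a \<kappa> v v = \<kappa> * (\<Sum>K\<in>M. (seminorm1 K v)\<^sup>2)"
proof -
  have sol: "solid_polytope K" if "K \<in> M" for K by (rule solid_mesh_element[OF m that])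
  have ca: "continuous_on K a" if "K \<in> M" for K
    using a(1) solid_mesh_subset[OF m that] continuous_on_subset by (auto simp: C1_field_def)
  have "vol_int \<Omega> (\<lambda>x. v x * (a x \<bullet> grad \<Omega> v x)) = (\<Sum>K\<in>M. vol_int K (\<lambda>x. v x * (a x \<bullet> grad K v x)))"
    by (rule vol_int_mesh[OF m])
       (auto intro!: continuous_intros poly_on_continuous[OF v(3)] continuous_on_grad v(3) ca sol
         simp: grad_interior_element[OF m])
  also have "\<dots> = 0"
  proof -
    have "2 * (\<Sum>K\<in>M. vol_int K (\<lambda>x. v x * (a x \<bullet> grad K v x)))
        = (\<Sum>K\<in>M. vol_int K (\<lambda>x. 2 * (v x * (a x \<bullet> grad K v x)) + (v x)\<^sup>2 * (\<Sum>i\<in>UNIV. D i x)))"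
    proof (subst sum_distrib_left, rule sum.cong[OF refl])
      fix K assume K: "K \<in> M"
      have "vol_int K (\<lambda>x. 2 * (v x * (a x \<bullet> grad K v x)) + (v x)\<^sup>2 * (\<Sum>i\<in>UNIV. D i x))
          = vol_int K (\<lambda>x. 2 * (v x * (a x \<bullet> grad K v x)))"
        by (rule vol_int_cong) (use a(2) solid_mesh_subset[OF m K] in auto)
      then show "2 * vol_int K (\<lambda>x. v x * (a x \<bullet> grad K v x))
          = vol_int K (\<lambda>x. 2 * (v x * (a x \<bullet> grad K v x)) + (v x)\<^sup>2 * (\<Sum>i\<in>UNIV. D i x))"
        by (simp only: vol_int_cmult)
    qed
    then show ?thesis using mean_advection_zero[OF m bd v a(1)] by simp
  qed
  finally have 1: "vol_int \<Omega> (\<lambda>x. v x * (a x \<bullet> grad \<Omega> v x)) = 0" .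
  have "vol_int \<Omega> (\<lambda>x. \<kappa> * (grad \<Omega> v x \<bullet> grad \<Omega> v x)) = \<kappa> * (seminorm1 \<Omega> v)\<^sup>2"
    by (simp only: vol_int_cmult seminorm1_sq power2_norm_eq_inner)
  then show ?thesis using 1 seminorm1_mesh[OF m v(3)] by (simp add: form_bar_def)
qed

text \<open>
  The divergence theorem for the field \<open>v\<^sup>2 x\<close>, whose divergence is \<open>d v\<^sup>2\<close> if the gradient of \<open>v\<close> vanishes.
\<close>

lemma poly_vanishing_gradient_and_trace:
  fixes K :: "(real^'n) set"
  assumes K: "solid_polytope K" and v: "poly_on K v"
    and g: "\<And>x. x \<in> K \<Longrightarrow> grad K v x = 0" and tr: "norm0_bdry K (\<lambda>n. v) = 0" and x: "x \<in> K"
  shows "v x = 0"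
proof -
  note cv = poly_on_continuous[OF v]
  have "vol_int K (\<lambda>x. grad K (\<lambda>x. v x * v x) x \<bullet> x + v x * v x * (\<Sum>i\<in>(UNIV::'n set). 1))
      = bdry_int K (\<lambda>n x. v x * v x * (x \<bullet> n))"
    by (rule gauss_poly_field[OF K poly_on_mult[OF v v] C1_field_id])
  moreover have "\<bar>bdry_int K (\<lambda>n x. v x * (v x * (x \<bullet> n)))\<bar> \<le> norm0_bdry K (\<lambda>n. v) * norm0_bdry K (\<lambda>n x. v x * (x \<bullet> n))"
    by (rule bdry_int_Cauchy_Schwarz[OF K]) (intro continuous_intros cv)+
  ultimately have "vol_int K (\<lambda>x. grad K (\<lambda>x. v x * v x) x \<bullet> x + v x * v x * (\<Sum>i\<in>(UNIV::'n set). 1)) = 0"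
    using tr by (simp add: mult.assoc)
  moreover have "vol_int K (\<lambda>x. grad K (\<lambda>x. v x * v x) x \<bullet> x + v x * v x * (\<Sum>i\<in>(UNIV::'n set). 1))
     = vol_int K (\<lambda>x. real CARD('n) * (v x * v x))"
    by (rule vol_int_cong) (simp add: grad_mult[OF K v v] g)
  ultimately have z: "vol_int K (\<lambda>x. v x * v x) = 0" by (simp add: vol_int_cmult)
  have "v x * v x = 0" by (rule vol_int_eq_0_imp_zero[OF K _ _ z x]) (auto intro!: continuous_intros cv)
  then show ?thesis by simp
qed

lemma seminorm1_zero_imp_grad_zero:
  assumes K: "solid_polytope K" and v: "poly_on K v" and z: "seminorm1 K v = 0" and x: "x \<in> K"
  shows "grad K v x = 0"
proof -
  have z': "vol_int K (\<lambda>x. (norm (grad K v x))\<^sup>2) = 0" using z by (simp add: seminorm1_sq[symmetric])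
  have "(norm (grad K v x))\<^sup>2 = 0"
    by (rule vol_int_eq_0_imp_zero[OF K _ _ z' x]) (auto intro!: continuous_intros continuous_on_grad K v)
  then show ?thesis by simp
qed

text \<open>
  As on a single element, the divergence of \<open>v\<^sup>2 x\<close> is \<open>d v\<^sup>2\<close>; the zero boundary values replace the trace.
\<close>

lemma mean_vanishing_gradient:
  fixes \<Omega> :: "(real^'n) set"
  assumes m: "solid_mesh \<Omega> M" and bd: "bounded \<Omega>"
    and v: "continuous_on (closure \<Omega>) v" "\<And>x. x \<notin> \<Omega> \<Longrightarrow> v x = 0" "\<And>K. K \<in> M \<Longrightarrow> poly_on K v"
    and g: "\<And>K x. K \<in> M \<Longrightarrow> x \<in> K \<Longrightarrow> grad K v x = 0"
  shows "v = (\<lambda>_. 0)"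
proof
  fix x
  note fin = solid_mesh_finite[OF m] and cov = solid_mesh_cover[OF m]
  have sol: "solid_polytope K" if "K \<in> M" for K by (rule solid_mesh_element[OF m that])
  have "(\<Sum>K\<in>M. vol_int K (\<lambda>x. 2 * (v x * (x \<bullet> grad K v x)) + (v x)\<^sup>2 * (\<Sum>i\<in>(UNIV::'n set). 1))) = 0"
    by (rule mean_advection_zero[OF m bd v C1_field_id])
  moreover have "vol_int K (\<lambda>x. 2 * (v x * (x \<bullet> grad K v x)) + (v x)\<^sup>2 * (\<Sum>i\<in>(UNIV::'n set). 1))
     = vol_int K (\<lambda>x. real CARD('n) * (v x)\<^sup>2)" if "K \<in> M" for K
    by (rule vol_int_cong) (simp add: g[OF that])
  ultimately have "(\<Sum>K\<in>M. vol_int K (\<lambda>x. (v x)\<^sup>2)) = 0"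
    by (simp add: sum_distrib_left[symmetric])
  then have z: "vol_int K (\<lambda>x. (v x)\<^sup>2) = 0" if "K \<in> M" for K
    using that fin by (subst (asm) sum_nonneg_eq_0_iff) (auto intro: vol_int_nonneg)
  show "v x = 0"
  proof (cases "x \<in> \<Omega>")
    case True
    then obtain K where K: "K \<in> M" "x \<in> K" using cov closure_subset by blast
    have "(v x)\<^sup>2 = 0"
      by (rule vol_int_eq_0_imp_zero[OF sol[OF K(1)] _ _ z[OF K(1)] K(2)])
         (auto intro!: continuous_intros poly_on_continuous[OF v(3)[OF K(1)]])
    then show ?thesis by simp
  qed (rule v(2))
qed

lemma conforming_mesh_affine: "conforming_mesh et \<Omega> M F \<Longrightarrow> K \<in> M \<Longrightarrow> affine_iso (F K)"
  by (auto simp: conforming_mesh_def)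

lemma cont_space_poly_on:
  assumes "conforming_mesh et \<Omega> M F" "v \<in> cont_space et p \<Omega> M F" "K \<in> M"
  shows "poly_on K v"
  using assms local_polys_polynomial[OF conforming_mesh_affine[OF assms(1,3)]]
  unfolding cont_space_def poly_on_def by blast

lemma disc_space_poly_on:
  assumes "conforming_mesh et \<Omega> M F" "w \<in> disc_space et p M F" "K \<in> M"
  shows "poly_on K (w K)"
proof -
  have "w K \<in> local_polys et p (F K)" using assms(2,3) by (simp add: disc_space_def)
  then show ?thesis by (rule poly_onI[OF local_polys_polynomial[OF conforming_mesh_affine[OF assms(1,3)]]])
qed

lemma cont_space_zero:
  assumes "conforming_mesh et \<Omega> M F" shows "(\<lambda>_. 0) \<in> cont_space et p \<Omega> M F"
  unfolding cont_space_def using local_polys_zero[OF conforming_mesh_affine[OF assms]] by auto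

lemma disc_space_zero:
  assumes "conforming_mesh et \<Omega> M F" shows "(\<lambda>_ _. 0) \<in> disc_space et p M F"
  unfolding disc_space_def using local_polys_zero[OF conforming_mesh_affine[OF assms]] by auto

lemma disc_space_lincomb:
  assumes "conforming_mesh et \<Omega> M F" "v \<in> disc_space et p M F" "w \<in> disc_space et p M F"
  shows "(\<lambda>K x. v K x + s * w K x) \<in> disc_space et p M F"
  using assms local_polys_lincomb[OF conforming_mesh_affine[OF assms(1)]]
  unfolding disc_space_def by auto

lemma supg_norm_eq:
  assumes m: "solid_mesh \<Omega> M" and v: "\<And>K. K \<in> M \<Longrightarrow> poly_on K v"
  shows "supg_norm \<Omega> M h a \<kappa> \<kappa>art Cpen \<tau> (v, w) = sqrt (\<Sum>K\<in>M.
     \<kappa> * (seminorm1 K v)\<^sup>2 + elem_energy K (h K) a \<kappa> (\<kappa>art K) Cpen (w K)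
     + (norm0 K (\<lambda>x. sqrt (\<tau> K) * (a x \<bullet> grad K (\<lambda>y. v y + w K y) x)))\<^sup>2)"
  unfolding supg_norm_def elem_energy_def
  by (simp add: seminorm1_mesh[OF m v] sum.distrib sum_distrib_left)

text \<open>
  The test function that proves the inf-sup condition has the same mean component as the trial
  function, so that the global form is a sum over elements.
\<close>

lemma form_B_same_mean:
  assumes m: "solid_mesh \<Omega> M" and bd: "bounded \<Omega>"
    and v: "continuous_on (closure \<Omega>) v" "\<And>x. x \<notin> \<Omega> \<Longrightarrow> v x = 0" "\<And>K. K \<in> M \<Longrightarrow> poly_on K v"
    and a: "C1_field (closure \<Omega>) \<Omega> a D" "\<And>x. x \<in> closure \<Omega> \<Longrightarrow> (\<Sum>i\<in>UNIV. D i x) = 0"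
  shows "form_B \<Omega> M h a \<kappa> \<kappa>art Cpen (v, u') (v, w) =
     (\<Sum>K\<in>M. \<kappa> * (seminorm1 K v)\<^sup>2 - vol_int K (\<lambda>x. u' K x * (a x \<bullet> grad K v x))
        + elem_form K (h K) a \<kappa> (\<kappa>art K) Cpen v (u' K) (w K))"
proof -
  have "form_coupling_prime M a \<kappa> v w + form_prime M h a \<kappa> \<kappa>art Cpen u' w
     = (\<Sum>K\<in>M. elem_form K (h K) a \<kappa> (\<kappa>art K) Cpen v (u' K) (w K))"
    unfolding form_coupling_prime_def form_prime_def elem_form_def by (simp only: sum.distrib)
  moreover have "form_bar \<Omega> a \<kappa> v v = (\<Sum>K\<in>M. \<kappa> * (seminorm1 K v)\<^sup>2)"
    unfolding sum_distrib_left[symmetric] by (rule form_bar_self[OF m bd v a])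
  ultimately show ?thesis
    unfolding form_B_def fst_conv snd_conv form_coupling_bar_def sum.distrib sum_subtractf by linarith
qed

section \<open>The test function and the inf-sup condition\<close>

lemma mesh_size_pos:
  assumes m: "solid_mesh \<Omega> M" and h: "mesh_size \<sigma> M h" and \<sigma>: "\<sigma> > 0" and K: "K \<in> M"
  shows "h K > 0"
proof -
  have sK: "solid_polytope K" by (rule solid_mesh_element[OF m K])
  obtain x where "x \<in> interior K" using sK by (auto simp: solid_polytope_def)
  then obtain r where r: "r > 0" "ball x r \<subseteq> K" using mem_interior by metis
  have "0 < diameter (ball x r)" using r(1) by (simp add: diameter_ball)
  also have "\<dots> \<le> diameter K"
    using r(2) compact_imp_bounded[OF solid_polytope_compact[OF sK]] by (rule diameter_subset)
  finally have "0 < diameter K / \<sigma>" using \<sigma> by simp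
  also have "\<dots> \<le> h K" using h K by (simp add: mesh_size_def)
  finally show ?thesis .
qed

text \<open>
  If the gradients and the penalty vanish, the mean component has zero gradient and zero boundary
  values, and the discontinuous component has zero gradient and zero trace on every element; both are then zero.
\<close>

lemma supg_energy_pos:
  fixes \<Omega> :: "(real^'n) set" and et :: element_type and p pf :: nat
  assumes dom: "polytopal_domain \<Omega>" and cm: "conforming_mesh et \<Omega> M F"
    and v: "v \<in> cont_space et p \<Omega> M F" and w: "w \<in> disc_space et pf M F"
    and nz: "(v, w) \<noteq> ((\<lambda>_. 0), (\<lambda>_ _. 0))"
    and pos: "\<kappa> > 0" "Cpen > 0" "\<And>K. K \<in> M \<Longrightarrow> h K > 0" "\<And>K. K \<in> M \<Longrightarrow> \<kappa>art K \<ge> 0"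
  shows "(\<Sum>K\<in>M. \<kappa> * (seminorm1 K v)\<^sup>2 + elem_energy K (h K) a \<kappa> (\<kappa>art K) Cpen (w K)) > 0"
proof (rule ccontr)
  assume neg: "\<not> ?thesis"
  have m: "solid_mesh \<Omega> M" by (rule conforming_mesh_solid[OF dom cm])
  have bd: "bounded \<Omega>" using dom by (simp add: polytopal_domain_def)
  note fin = solid_mesh_finite[OF m] and sol = solid_mesh_element[OF m]
  have pv: "poly_on K v" and pw: "poly_on K (w K)" if "K \<in> M" for K
    using cont_space_poly_on[OF cm v that] disc_space_poly_on[OF cm w that] by auto
  have terms: "\<kappa> * (seminorm1 K v)\<^sup>2 \<ge> 0" "(\<kappa> + \<kappa>art K) * (seminorm1 K (w K))\<^sup>2 \<ge> 0"
     "Cpen * \<kappa> / h K * (norm0_bdry K (\<lambda>n. w K))\<^sup>2 \<ge> 0" "(adv_trace_norm K a (w K))\<^sup>2 \<ge> 0" if "K \<in> M" for K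
    using pos(1,2) pos(3,4)[OF that] by simp_all
  have en: "\<kappa> * (seminorm1 K v)\<^sup>2 + elem_energy K (h K) a \<kappa> (\<kappa>art K) Cpen (w K) \<ge> 0" if "K \<in> M" for K
    using terms[OF that] unfolding elem_energy_def by linarith
  have tot: "\<kappa> * (seminorm1 K v)\<^sup>2 + elem_energy K (h K) a \<kappa> (\<kappa>art K) Cpen (w K) = 0" if "K \<in> M" for K
  proof (rule sum_nonneg_0[OF fin en _ that])
    show "(\<Sum>K\<in>M. \<kappa> * (seminorm1 K v)\<^sup>2 + elem_energy K (h K) a \<kappa> (\<kappa>art K) Cpen (w K)) = 0"
      by (rule antisym[OF _ sum_nonneg[OF en]]) (use neg in \<open>simp_all add: not_less\<close>)
  qed
  have zero: "\<kappa> * (seminorm1 K v)\<^sup>2 = 0 \<and> (\<kappa> + \<kappa>art K) * (seminorm1 K (w K))\<^sup>2 = 0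
     \<and> Cpen * \<kappa> / h K * (norm0_bdry K (\<lambda>n. w K))\<^sup>2 = 0" if "K \<in> M" for K
    using terms[OF that] tot[OF that] unfolding elem_energy_def by (intro conjI; linarith)
  have z: "seminorm1 K v = 0" "seminorm1 K (w K) = 0" "norm0_bdry K (\<lambda>n. w K) = 0" if "K \<in> M" for K
    using zero[OF that] pos(1,2) pos(3,4)[OF that] by (simp_all add: add_pos_nonneg)
  have "v = (\<lambda>_. 0)"
  proof (rule mean_vanishing_gradient[OF m bd])
    show "continuous_on (closure \<Omega>) v" "\<And>x. x \<notin> \<Omega> \<Longrightarrow> v x = 0" using v by (auto simp: cont_space_def)
    show "poly_on K v" if "K \<in> M" for K by (rule pv[OF that])
    show "grad K v x = 0" if "K \<in> M" "x \<in> K" for K x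
      by (rule seminorm1_zero_imp_grad_zero[OF sol[OF that(1)] pv[OF that(1)] z(1)[OF that(1)] that(2)])
  qed
  moreover have "w K = (\<lambda>_. 0)" for K
  proof (cases "K \<in> M")
    case True
    have "w K x = 0" if "x \<in> K" for x
      using poly_vanishing_gradient_and_trace[OF sol[OF True] pw[OF True] _ z(3)[OF True] that]
        seminorm1_zero_imp_grad_zero[OF sol[OF True] pw[OF True] z(2)[OF True]] by blast
    moreover have "real_polynomial_function (w K)"
      using local_polys_polynomial[OF conforming_mesh_affine[OF cm True], of "w K" et pf] w True
      by (simp add: disc_space_def)
    moreover have "interior K \<noteq> {}" "interior K \<subseteq> K"
      using sol[OF True] interior_subset by (auto simp: solid_polytope_def)
    ultimately show ?thesis by (intro real_polynomial_zero_on_open[of "w K" "interior K"]) auto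
  next
    case False then show ?thesis using w by (simp add: disc_space_def)
  qed
  ultimately show False using nz by auto
qed

text \<open>
  The orthogonality \<open>\<integral> (f - P) P = 0\<close> for the streamline derivative \<open>f\<close> turns the product of \<open>f\<close> and \<open>\<tau> P\<close> into
  the square of the norm of \<open>\<surd>\<tau> P\<close>.
\<close>

lemma optimal_test_function:
  fixes K :: "(real^'n) set" and et :: element_type and pf :: nat
  assumes K: "solid_polytope K" and F: "affine_iso FK" and a: "continuous_on K a"
    and v: "poly_on K v" and u': "poly_on K u'" and \<tau>: "\<tau> \<ge> 0"
  defines "P \<equiv> l2_projector K (local_polys et pf FK) (\<lambda>z. a z \<bullet> grad K (\<lambda>y. v y + u' y) z)"
  defines "w \<equiv> (\<lambda>x. \<tau> * P x)"
  shows "w \<in> local_polys et pf FK"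
    and "(norm0 K w)\<^sup>2 = \<tau> * (norm0 K (\<lambda>x. sqrt \<tau> * P x))\<^sup>2"
    and "vol_int K (\<lambda>x. w x * (a x \<bullet> grad K v x)) + vol_int K (\<lambda>x. w x * (a x \<bullet> grad K u' x))
       = (norm0 K (\<lambda>x. sqrt \<tau> * P x))\<^sup>2"
proof -
  note cK = solid_polytope_compact[OF K]
  let ?f = "\<lambda>z. a z \<bullet> grad K (\<lambda>y. v y + u' y) z"
  have cf: "continuous_on K ?f"
    by (intro continuous_intros a continuous_on_grad K poly_on_add v u')
  note proj = l2_projector[OF K F cf, where et = et and p = pf, folded P_def]
  have Pr: "real_polynomial_function P" by (rule local_polys_polynomial[OF F proj(1)])
  note cP = continuous_real_polynomial[OF Pr, of K]
  have S: "(norm0 K (\<lambda>x. sqrt \<tau> * P x))\<^sup>2 = \<tau> * vol_int K (\<lambda>x. P x * P x)"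
  proof -
    have "(sqrt \<tau> * y)\<^sup>2 = \<tau> * (y * y)" for y
      unfolding power_mult_distrib real_sqrt_pow2[OF \<tau>] by (simp add: power2_eq_square)
    then show ?thesis unfolding norm0_sq by (simp only: vol_int_cmult)
  qed
  show w: "w \<in> local_polys et pf FK"
    using local_polys_lincomb[OF F local_polys_zero[OF F] proj(1), of \<tau>] by (simp add: w_def)
  show "(norm0 K w)\<^sup>2 = \<tau> * (norm0 K (\<lambda>x. sqrt \<tau> * P x))\<^sup>2"
  proof -
    have "(\<tau> * y)\<^sup>2 = \<tau> * (\<tau> * (y * y))" for y by (simp add: power2_eq_square)
    then show ?thesis unfolding S unfolding norm0_sq w_def by (simp only: vol_int_cmult)
  qed
  have cw: "continuous_on K w" unfolding w_def by (intro continuous_intros cP)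
  have "vol_int K (\<lambda>x. w x * (a x \<bullet> grad K v x)) + vol_int K (\<lambda>x. w x * (a x \<bullet> grad K u' x))
      = vol_int K (\<lambda>x. w x * (a x \<bullet> grad K v x) + w x * (a x \<bullet> grad K u' x))"
    by (rule vol_int_add[OF cK, symmetric]) (intro continuous_intros cw a continuous_on_grad K v u')+
  also have "\<dots> = vol_int K (\<lambda>x. \<tau> * ((?f x - P x) * P x + 1 * (P x * P x)))"
  proof (rule vol_int_cong)
    fix x assume x: "x \<in> K"
    show "w x * (a x \<bullet> grad K v x) + w x * (a x \<bullet> grad K u' x) = \<tau> * ((?f x - P x) * P x + 1 * (P x * P x))"
      unfolding grad_add[OF K v u' x] w_def inner_add_right by (simp add: algebra_simps)
  qed
  also have "\<dots> = \<tau> * vol_int K (\<lambda>x. (?f x - P x) * P x + 1 * (P x * P x))"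
    by (rule vol_int_cmult)
  also have "vol_int K (\<lambda>x. (?f x - P x) * P x + 1 * (P x * P x)) 
      = vol_int K (\<lambda>x. (?f x - P x) * P x) + 1 * vol_int K (\<lambda>x. P x * P x)"
    by (rule vol_int_lincomb[OF cK]) (intro continuous_intros cf cP)+
  also have "vol_int K (\<lambda>x. (?f x - P x) * P x) = 0" by (rule proj(2)[OF proj(1)])
  finally show "vol_int K (\<lambda>x. w x * (a x \<bullet> grad K v x)) + vol_int K (\<lambda>x. w x * (a x \<bullet> grad K u' x))
       = (norm0 K (\<lambda>x. sqrt \<tau> * P x))\<^sup>2" unfolding S by simp
qed

lemma elem_energy_add_le:
  assumes K: "solid_polytope K" and u: "poly_on K u" and w: "poly_on K w" and a: "continuous_on K a"
    and pos: "\<kappa> + \<kappa>a \<ge> 0" "Cpen * \<kappa> / h \<ge> 0"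
  shows "elem_energy K h a \<kappa> \<kappa>a Cpen (\<lambda>x. u x + s * w x)
     \<le> 2 * elem_energy K h a \<kappa> \<kappa>a Cpen u + 2 * s\<^sup>2 * elem_energy K h a \<kappa> \<kappa>a Cpen w"
proof -
  note cont = a poly_on_continuous[OF u] poly_on_continuous[OF w]
  have 1: "(\<kappa> + \<kappa>a) * (seminorm1 K (\<lambda>x. u x + s * w x))\<^sup>2 
     \<le> (\<kappa> + \<kappa>a) * (2 * (seminorm1 K u)\<^sup>2 + 2 * s\<^sup>2 * (seminorm1 K w)\<^sup>2)"
    by (intro mult_left_mono seminorm1_sq_add_le K u w pos)
  have 2: "Cpen * \<kappa> / h * (norm0_bdry K (\<lambda>n x. u x + s * w x))\<^sup>2 
     \<le> Cpen * \<kappa> / h * (2 * (norm0_bdry K (\<lambda>n. u))\<^sup>2 + 2 * s\<^sup>2 * (norm0_bdry K (\<lambda>n. w))\<^sup>2)"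
    by (intro mult_left_mono norm0_bdry_sq_add_le K cont pos)
  have 3: "(norm0_bdry K (\<lambda>n x. sqrt \<bar>a x \<bullet> n\<bar> * (u x + s * w x)))\<^sup>2
     \<le> 2 * (adv_trace_norm K a u)\<^sup>2 + 2 * s\<^sup>2 * (adv_trace_norm K a w)\<^sup>2"
  proof -
    have "(\<lambda>n x. sqrt \<bar>a x \<bullet> n\<bar> * (u x + s * w x)) = (\<lambda>n x. sqrt \<bar>a x \<bullet> n\<bar> * u x + s * (sqrt \<bar>a x \<bullet> n\<bar> * w x))"
      by (simp add: algebra_simps)
    moreover have "(norm0_bdry K (\<lambda>n x. sqrt \<bar>a x \<bullet> n\<bar> * u x + s * (sqrt \<bar>a x \<bullet> n\<bar> * w x)))\<^sup>2
     \<le> 2 * (adv_trace_norm K a u)\<^sup>2 + 2 * s\<^sup>2 * (adv_trace_norm K a w)\<^sup>2"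
      by (rule norm0_bdry_sq_add_le[OF K]) (intro continuous_intros cont)+
    ultimately show ?thesis by (simp only:)
  qed
  from 1 2 3 show ?thesis unfolding elem_energy_def by (simp only: distrib_left) (simp add: algebra_simps)
qed

lemma streamline_norm_add_le:
  assumes K: "solid_polytope K" and v: "poly_on K v" and u: "poly_on K u" and w: "poly_on K w" and a: "continuous_on K a"
  shows "(norm0 K (\<lambda>x. r * (a x \<bullet> grad K (\<lambda>y. v y + (u y + s * w y)) x)))\<^sup>2
     \<le> 2 * (norm0 K (\<lambda>x. r * (a x \<bullet> grad K (\<lambda>y. v y + u y) x)))\<^sup>2 + 2 * s\<^sup>2 * (norm0 K (\<lambda>x. r * (a x \<bullet> grad K w x)))\<^sup>2"
proof -
  note cK = solid_polytope_compact[OF K]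
  have vu: "poly_on K (\<lambda>y. v y + u y)" by (intro poly_on_add v u)
  have g: "grad K (\<lambda>y. v y + (u y + s * w y)) x = grad K (\<lambda>y. v y + u y) x + s *\<^sub>R grad K w x" if "x \<in> K" for x
    using grad_add[OF K vu poly_on_cmult[OF w] that] grad_cmult[OF K w that] by (simp add: add.assoc)
  have "vol_int K (\<lambda>x. (r * (a x \<bullet> grad K (\<lambda>y. v y + (u y + s * w y)) x))\<^sup>2)
      = vol_int K (\<lambda>x. (r * (a x \<bullet> grad K (\<lambda>y. v y + u y) x) + s * (r * (a x \<bullet> grad K w x)))\<^sup>2)"
  proof (rule vol_int_cong)
    fix x assume x: "x \<in> K"
    show "(r * (a x \<bullet> grad K (\<lambda>y. v y + (u y + s * w y)) x))\<^sup>2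
      = (r * (a x \<bullet> grad K (\<lambda>y. v y + u y) x) + s * (r * (a x \<bullet> grad K w x)))\<^sup>2"
      unfolding g[OF x] inner_add_right inner_scaleR_right by (simp only: distrib_left mult.left_commute)
  qed
  then have "(norm0 K (\<lambda>x. r * (a x \<bullet> grad K (\<lambda>y. v y + (u y + s * w y)) x)))\<^sup>2
      = (norm0 K (\<lambda>x. r * (a x \<bullet> grad K (\<lambda>y. v y + u y) x) + s * (r * (a x \<bullet> grad K w x))))\<^sup>2"
    by (simp only: norm0_sq)
  also have "\<dots> \<le> 2 * (norm0 K (\<lambda>x. r * (a x \<bullet> grad K (\<lambda>y. v y + u y) x)))\<^sup>2 + 2 * s\<^sup>2 * (norm0 K (\<lambda>x. r * (a x \<bullet> grad K w x)))\<^sup>2"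
    by (rule norm0_sq_add_le[OF cK]) (intro continuous_intros a continuous_on_grad K vu w)+
  finally show ?thesis .
qed

text \<open>
  The witness is \<open>z = u' + \<delta> w\<close>. On each element put \<open>E = N + S\<^sup>2\<close>, where \<open>N\<close> is the coercive energy of the
  trial function. Then the form is at least \<open>\<delta>/2 E\<close>, and the squared SUPG norms of trial and test function are
  both at most \<open>(3 + 2 CSUPG) E\<close>; for the streamline part of the norm this is the assumption with the
  constant \<open>CSUPG\<close>. The number \<open>cc\<close> collects the constants of \<open>test_function_bounds\<close>. With \<open>\<delta> = 1/(40 (cc + 1))\<close> the
  loss \<open>5 cc N\<close> in \<open>element_test_bound\<close>, multiplied by \<open>\<delta>\<close>, is at most half of the gain \<open>N/4\<close> from coercivity.
\<close>

lemma supg_inf_sup_witness: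
  fixes \<Omega> :: "(real^'n) set" and et :: element_type and p pf :: nat
    and \<sigma> Ctrace Cinv Cpen Cart Ctau CSUPG :: real
  assumes dom: "polytopal_domain \<Omega>"
    and constants: "\<sigma> > 0" "Ctrace > 0" "Cinv > 0" "Cpen > 0" "Cart \<ge> 0" "Ctau > 0" "CSUPG > 0"
    and penalty: "Cpen \<ge> 8 * Ctrace"
    and cm: "conforming_mesh et \<Omega> M F" and ms: "mesh_size \<sigma> M h"
    and sm: "smooth_up_to_boundary \<Omega> a" and df: "\<And>x. x \<in> \<Omega> \<Longrightarrow> divg \<Omega> a x = 0" and \<kappa>: "\<kappa> > 0"
    and \<tau>: "\<And>K. K \<in> M \<Longrightarrow> \<tau> K = Ctau * time_scale Cinv a \<kappa> h K"
    and \<kappa>art: "\<And>K. K \<in> M \<Longrightarrow> \<kappa>art K = Cart * time_scale Cinv a \<kappa> h K * (norm_inf K a)\<^sup>2"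
    and trace: "\<And>K w. K \<in> M \<Longrightarrow> w \<in> cont_space et p \<Omega> M F \<union> (\<lambda>v'. v' K) ` disc_space et pf M F \<Longrightarrow>
         (norm0_bdry K (\<lambda>n. w))\<^sup>2 \<le> Ctrace / h K * (norm0 K w)\<^sup>2 \<and>
         (norm0_bdry K (\<lambda>n x. grad K w x \<bullet> n))\<^sup>2 \<le> Ctrace / h K * (seminorm1 K w)\<^sup>2"
    and inverse: "\<And>K w. K \<in> M \<Longrightarrow> w \<in> cont_space et p \<Omega> M F \<union> (\<lambda>v'. v' K) ` disc_space et pf M F \<Longrightarrow>
         (seminorm1 K w)\<^sup>2 \<le> Cinv / (h K)\<^sup>2 * (norm0 K w)\<^sup>2 \<and>
         (norm0 K (laplacian K w))\<^sup>2 \<le> Cinv / (h K)\<^sup>2 * (seminorm1 K w)\<^sup>2"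
    and supg: "\<And>v v' K. v \<in> cont_space et p \<Omega> M F \<Longrightarrow> v' \<in> disc_space et pf M F \<Longrightarrow> K \<in> M \<Longrightarrow>
         (norm0 K (\<lambda>x. sqrt (\<tau> K) * (a x \<bullet> grad K (\<lambda>y. v y + v' K y) x)))\<^sup>2
         \<le> CSUPG * (\<kappa>art K * (seminorm1 K (v' K))\<^sup>2
             + (norm0 K (\<lambda>x. sqrt (\<tau> K) *
                  l2_projector K (local_polys et pf (F K))
                    (\<lambda>z. a z \<bullet> grad K (\<lambda>y. v y + v' K y) z) x))\<^sup>2)"
    and v: "v \<in> cont_space et p \<Omega> M F" and u': "u' \<in> disc_space et pf M F"
    and nz: "(v, u') \<noteq> ((\<lambda>_. 0), (\<lambda>_ _. 0))"
  defines "cc \<equiv> Ctau + (Ctau + Cart * Ctau * Cinv) + Cpen * Ctrace * Ctau / Cinv + Ctrace * Ctau + Cinv * Ctau\<^sup>2"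
  defines "\<delta> \<equiv> 1 / (40 * (cc + 1))"
  shows "\<exists>z\<in>disc_space et pf M F. (v, z) \<noteq> ((\<lambda>_. 0), (\<lambda>_ _. 0)) \<and>
    \<delta> / 2 / (3 + 2 * CSUPG) \<le> form_B \<Omega> M h a \<kappa> \<kappa>art Cpen (v, u') (v, z) /
      (supg_norm \<Omega> M h a \<kappa> \<kappa>art Cpen \<tau> (v, u') * supg_norm \<Omega> M h a \<kappa> \<kappa>art Cpen \<tau> (v, z))"
proof -
  let ?kv = "\<lambda>K. \<kappa> * (seminorm1 K v)\<^sup>2"
  let ?ad = "\<lambda>K. vol_int K (\<lambda>x. u' K x * (a x \<bullet> grad K v x))"
  let ?ef = "\<lambda>K. elem_form K (h K) a \<kappa> (\<kappa>art K) Cpen v (u' K)"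
  let ?en = "\<lambda>K. elem_energy K (h K) a \<kappa> (\<kappa>art K) Cpen"
  let ?B = "form_B \<Omega> M h a \<kappa> \<kappa>art Cpen (v, u')"
  let ?sn = "supg_norm \<Omega> M h a \<kappa> \<kappa>art Cpen \<tau>"
  have m: "solid_mesh \<Omega> M" by (rule conforming_mesh_solid[OF dom cm])
  have bd: "bounded \<Omega>" using dom by (simp add: polytopal_domain_def)
  note fin = solid_mesh_finite[OF m] and sol = solid_mesh_element[OF m]
  note aff = conforming_mesh_affine[OF cm]
  note hpos = mesh_size_pos[OF m ms constants(1)]
  note zc = cont_space_zero[OF cm, of p] and zd = disc_space_zero[OF cm, of pf]
  obtain D where D: "C1_field (closure \<Omega>) \<Omega> a D" "\<And>x. x \<in> \<Omega> \<Longrightarrow> (\<Sum>i\<in>UNIV. D i x) = divg \<Omega> a x"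
    using smooth_imp_C1_field[OF solid_mesh_open[OF m] sm] by auto
  have D0: "(\<Sum>i\<in>UNIV. D i x) = 0" if "x \<in> closure \<Omega>" for x
    by (rule div_free_on_closure[OF D(1) _ that]) (simp add: D(2) df)
  have dfK: "div_free_field K a" if "K \<in> M" for K
    unfolding div_free_field_def
    using C1_field_subset[OF D(1) solid_mesh_subset[OF m that] solid_mesh_interior_subset[OF m that]]
      D0 solid_mesh_subset[OF m that] by blast
  note ca = div_free_field_continuous[OF dfK]
  have al: "norm (a x) \<le> norm_inf K a" if "K \<in> M" "x \<in> K" for K x
    by (rule norm_le_norm_inf[OF sol[OF that(1)] ca[OF that(1)] that(2)])
  have al0: "norm_inf K a \<ge> 0" if K: "K \<in> M" for K
  proof -
    obtain x where "x \<in> K" using sol[OF K] interior_subset by (auto simp: solid_polytope_def)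
    then show ?thesis using al[OF K] norm_ge_zero order_trans by blast
  qed
  define T where "T = time_scale Cinv a \<kappa> h"
  have Tp: "T K > 0" "T K * (norm_inf K a / h K) \<le> 1" "T K * (Cinv * \<kappa> / (h K)\<^sup>2) \<le> 1" if "K \<in> M" for K
    unfolding T_def using time_scale_props[where K = K and h = h, OF al0[OF that] constants(3) \<kappa> hpos[OF that]] by auto
  have \<tau>T: "\<tau> K = Ctau * T K" and \<kappa>aT: "\<kappa>art K = Cart * T K * (norm_inf K a)\<^sup>2" if "K \<in> M" for K
    using \<tau>[OF that] \<kappa>art[OF that] by (simp_all add: T_def)
  have \<tau>0: "\<tau> K \<ge> 0" and \<kappa>a0: "\<kappa>art K \<ge> 0" if "K \<in> M" for K
    using \<tau>T[OF that] \<kappa>aT[OF that] Tp(1)[OF that] constants by simp_all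
  have vc: "continuous_on (closure \<Omega>) v" "\<And>x. x \<notin> \<Omega> \<Longrightarrow> v x = 0" using v by (auto simp: cont_space_def)
  have pv: "poly_on K v" and pu: "poly_on K (u' K)" if "K \<in> M" for K
    using cont_space_poly_on[OF cm v that] disc_space_poly_on[OF cm u' that] by auto
  define P where "P K = l2_projector K (local_polys et pf (F K)) (\<lambda>z. a z \<bullet> grad K (\<lambda>y. v y + u' K y) z)" for K
  define S where "S K = norm0 K (\<lambda>x. sqrt (\<tau> K) * P K x)" for K
  define w where "w K = (if K \<in> M then (\<lambda>x. \<tau> K * P K x) else (\<lambda>_. 0))" for K
  have S0: "S K \<ge> 0" for K by (simp add: S_def norm0_nonneg)
  have wK: "w K = (\<lambda>x. \<tau> K * P K x)" if "K \<in> M" for K using that by (simp add: w_def)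
  have opt: "w K \<in> local_polys et pf (F K)" "(norm0 K (w K))\<^sup>2 = \<tau> K * (S K)\<^sup>2"
    "vol_int K (\<lambda>x. w K x * (a x \<bullet> grad K v x)) + vol_int K (\<lambda>x. w K x * (a x \<bullet> grad K (u' K) x)) = (S K)\<^sup>2"
    if K: "K \<in> M" for K
    unfolding wK[OF K] S_def P_def
    by (rule optimal_test_function[OF sol[OF K] aff[OF K] ca[OF K] pv[OF K] pu[OF K] \<tau>0[OF K]])+
  have wd: "w \<in> disc_space et pf M F"
    unfolding disc_space_def using opt(1) by (auto simp: w_def)
  have w1: "(norm0 K (w K))\<^sup>2 = Ctau * T K * (S K)\<^sup>2"
    and w2: "vol_int K (\<lambda>x. w K x * (a x \<bullet> grad K v x)) + vol_int K (\<lambda>x. w K x * (a x \<bullet> grad K (u' K) x)) = (S K)\<^sup>2"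
    if K: "K \<in> M" for K
    using opt(2)[OF K] opt(3)[OF K] \<tau>T[OF K] by simp_all
  have pw: "poly_on K (w K)" if "K \<in> M" for K by (rule disc_space_poly_on[OF cm wd that])
  have c0: "Ctau \<ge> 0" "Ctau + Cart * Ctau * Cinv \<ge> 0" "Cpen * Ctrace * Ctau / Cinv \<ge> 0" "Ctrace * Ctau \<ge> 0" "Cinv * Ctau\<^sup>2 \<ge> 0"
    using constants by simp_all
  have cc: "cc \<ge> 0" unfolding cc_def using c0 by linarith
  have ccle: "Ctau * (S K)\<^sup>2 \<le> cc * (S K)\<^sup>2" "(Ctau + Cart * Ctau * Cinv) * (S K)\<^sup>2 \<le> cc * (S K)\<^sup>2"
    "Cpen * Ctrace * Ctau / Cinv * (S K)\<^sup>2 \<le> cc * (S K)\<^sup>2" "Ctrace * Ctau * (S K)\<^sup>2 \<le> cc * (S K)\<^sup>2" for K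
    unfolding cc_def by (rule mult_right_mono, use c0 in linarith, simp)+
  define N where "N K = ?kv K + ?en K (u' K)" for K
  define E where "E K = N K + (S K)\<^sup>2" for K
  define R where "R K z = (norm0 K (\<lambda>x. sqrt (\<tau> K) * (a x \<bullet> grad K (\<lambda>y. v y + z y) x)))\<^sup>2" for K and z :: "real^'n \<Rightarrow> real"
  define z where "z K x = u' K x + \<delta> * w K x" for K x
  have \<delta>: "\<delta> > 0" "\<delta> \<le> 1" "\<delta> * cc \<le> 1 / 40" unfolding \<delta>_def using cc by (auto simp: field_simps)
  have zd': "z \<in> disc_space et pf M F"
    using disc_space_lincomb[OF cm u' wd, of \<delta>] by (simp add: z_def[abs_def])
  have zK: "z K = (\<lambda>x. u' K x + \<delta> * w K x)" for K by (simp add: z_def[abs_def])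
  have elem: "N K \<ge> 0 \<and>
      ?kv K - ?ad K
        + ?ef K (z K) \<ge> \<delta> / 2 * E K \<and>
      N K + R K (u' K) \<le> (3 + 2 * CSUPG) * E K \<and>
      ?kv K + ?en K (z K) + R K (z K) \<le> (3 + 2 * CSUPG) * E K"
    if K: "K \<in> M" for K
  proof -
    have tv: "(norm0_bdry K (\<lambda>n x. grad K v x \<bullet> n))\<^sup>2 \<le> Ctrace / h K * (seminorm1 K v)\<^sup>2"
      using trace[OF K, of v] v by blast
    have tu: "(norm0_bdry K (\<lambda>n x. grad K (u' K) x \<bullet> n))\<^sup>2 \<le> Ctrace / h K * (seminorm1 K (u' K))\<^sup>2"
      using trace[OF K, of "u' K"] u' by blast
    have tw: "(norm0_bdry K (\<lambda>n. w K))\<^sup>2 \<le> Ctrace / h K * (norm0 K (w K))\<^sup>2"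
       "(norm0_bdry K (\<lambda>n x. grad K (w K) x \<bullet> n))\<^sup>2 \<le> Ctrace / h K * (seminorm1 K (w K))\<^sup>2"
      using trace[OF K, of "w K"] wd by blast+
    have iv: "(norm0 K (laplacian K v))\<^sup>2 \<le> Cinv / (h K)\<^sup>2 * (seminorm1 K v)\<^sup>2"
      using inverse[OF K, of v] v by blast
    have iw: "(seminorm1 K (w K))\<^sup>2 \<le> Cinv / (h K)\<^sup>2 * (norm0 K (w K))\<^sup>2"
      using inverse[OF K, of "w K"] wd by blast
    note b = test_function_bounds[OF sol[OF K] pw[OF K] ca[OF K] \<kappa> hpos[OF K] constants(2,3,4,5,6) Tp(1)[OF K]
        al[OF K] al0[OF K] Tp(2)[OF K] Tp(3)[OF K] w1[OF K] tw(1) iw]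
    note b' = b(2)[folded \<kappa>aT[OF K]]
    have coer: "N K / 4 \<le> ?kv K - ?ad K
        + ?ef K (u' K)"
      unfolding N_def
      by (rule element_coercivity[OF sol[OF K] pv[OF K] pu[OF K] dfK[OF K] \<kappa> \<kappa>a0[OF K] hpos[OF K] constants(2) penalty tv tu])
    have bb: "\<kappa> * (Cinv / (h K)\<^sup>2) * (norm0 K (w K))\<^sup>2 \<le> cc * (S K)\<^sup>2"
      "(\<kappa> + \<kappa>art K) * (seminorm1 K (w K))\<^sup>2 \<le> cc * (S K)\<^sup>2"
      "Cpen * \<kappa> / h K * (norm0_bdry K (\<lambda>n. w K))\<^sup>2 \<le> cc * (S K)\<^sup>2"
      "(adv_trace_norm K a (w K))\<^sup>2 \<le> cc * (S K)\<^sup>2"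
      using b(1,3,4) b' ccle[of K] by linarith+
    have test: "(S K)\<^sup>2 / 2 - 5 * cc * N K \<le> ?ef K (w K)"
    proof -
      have s: "(sqrt cc)\<^sup>2 = cc" using cc by simp
      have "Cpen \<ge> Ctrace" using penalty constants by linarith
      then have "(S K)\<^sup>2 / 2 - 5 * (sqrt cc)\<^sup>2 * N K \<le> ?ef K (w K)"
        unfolding N_def
        by (rule element_test_bound[OF sol[OF K] pv[OF K] pu[OF K] pw[OF K] dfK[OF K] \<kappa> \<kappa>a0[OF K] hpos[OF K] constants(2,3) _
              real_sqrt_ge_zero[OF cc] S0 tu tw(2) iv w2[OF K]])
           (unfold s, rule bb(1), rule bb(2), rule bb(3), rule bb(4))
      then show ?thesis unfolding s .
    qed
    have N0: "N K \<ge> 0"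
      unfolding N_def elem_energy_def
      using \<kappa> \<kappa>a0[OF K] constants hpos[OF K] by (intro add_nonneg_nonneg mult_nonneg_nonneg divide_nonneg_nonneg) auto
    have lin: "?ef K (z K)
       = ?ef K (u' K) + \<delta> * ?ef K (w K)"
      unfolding zK by (rule elem_form_lincomb[OF sol[OF K] pv[OF K] pu[OF K] pu[OF K] pw[OF K] ca[OF K]])
    have B: "?kv K - ?ad K
        + ?ef K (z K) \<ge> \<delta> / 2 * E K"
    proof -
      have "\<delta> * ((S K)\<^sup>2 / 2 - 5 * cc * N K) \<le> \<delta> * ?ef K (w K)"
        using test \<delta>(1) by (intro mult_left_mono) auto
      moreover have "\<delta> * ((S K)\<^sup>2 / 2 - 5 * cc * N K) = \<delta> / 2 * (S K)\<^sup>2 - 5 * ((\<delta> * cc) * N K)"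
        by (simp add: algebra_simps)
      moreover have "(\<delta> * cc) * N K \<le> 1 / 40 * N K" using \<delta>(3) N0 by (rule mult_right_mono)
      moreover have "\<delta> / 2 * N K \<le> N K / 8"
      proof -
        have "\<delta> \<le> 1 / 40" unfolding \<delta>_def using cc by (auto simp: field_simps)
        then have "\<delta> / 2 * N K \<le> 1 / 8 * N K" using N0 by (intro mult_right_mono) auto
        then show ?thesis by simp
      qed
      moreover have "\<delta> / 2 * E K = \<delta> / 2 * N K + \<delta> / 2 * (S K)\<^sup>2" unfolding E_def by (rule distrib_left)
      ultimately show ?thesis using coer unfolding lin by linarith
    qed
    have en: "?en K (w K)
        \<le> ((Ctau + Cart * Ctau * Cinv) + Cpen * Ctrace * Ctau / Cinv + Ctrace * Ctau) * (S K)\<^sup>2"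
      using b' b(3,4) unfolding elem_energy_def distrib_right[of _ _ "(S K)\<^sup>2"] by linarith
    have RU: "R K (u' K) \<le> CSUPG * E K"
    proof -
      have "R K (u' K) \<le> CSUPG * (\<kappa>art K * (seminorm1 K (u' K))\<^sup>2 + (S K)\<^sup>2)"
        unfolding R_def S_def P_def by (rule supg[OF v u' K])
      also have "\<dots> \<le> CSUPG * E K"
      proof (rule mult_left_mono)
        have "?kv K \<ge> 0" "\<kappa> * (seminorm1 K (u' K))\<^sup>2 \<ge> 0"
          "Cpen * \<kappa> / h K * (norm0_bdry K (\<lambda>n. u' K))\<^sup>2 \<ge> 0" "(adv_trace_norm K a (u' K))\<^sup>2 \<ge> 0"
          using \<kappa> constants hpos[OF K] by simp_all
        then show "\<kappa>art K * (seminorm1 K (u' K))\<^sup>2 + (S K)\<^sup>2 \<le> E K"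
          unfolding E_def N_def elem_energy_def distrib_right by linarith
      qed (use constants in simp)
      finally show ?thesis .
    qed
    have RV: "R K (z K) \<le> 2 * R K (u' K) + 2 * \<delta>\<^sup>2 * (Cinv * Ctau\<^sup>2 * (S K)\<^sup>2)"
    proof -
      have "R K (z K) \<le> 2 * R K (u' K) + 2 * \<delta>\<^sup>2 * (norm0 K (\<lambda>x. sqrt (\<tau> K) * (a x \<bullet> grad K (w K) x)))\<^sup>2"
        unfolding R_def zK by (rule streamline_norm_add_le[OF sol[OF K] pv[OF K] pu[OF K] pw[OF K] ca[OF K]])
      also have "\<dots> \<le> 2 * R K (u' K) + 2 * \<delta>\<^sup>2 * (Cinv * Ctau\<^sup>2 * (S K)\<^sup>2)"
        using b(5) unfolding \<tau>T[OF K] by (intro add_left_mono mult_left_mono) auto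
      finally show ?thesis .
    qed
    have EV: "?en K (z K)
       \<le> 2 * ?en K (u' K) + 2 * \<delta>\<^sup>2 * ?en K (w K)"
      unfolding zK using \<kappa> \<kappa>a0[OF K] constants hpos[OF K]
      by (intro elem_energy_add_le sol pu pw ca K) auto
    \<comment> \<open>The part of the squared norm of the test function that is due to \<open>w\<close>.\<close>
    have small: "2 * \<delta>\<^sup>2 * ?en K (w K) + 2 * \<delta>\<^sup>2 * (Cinv * Ctau\<^sup>2 * (S K)\<^sup>2) \<le> (S K)\<^sup>2"
    proof -
      have "?en K (w K) + Cinv * Ctau\<^sup>2 * (S K)\<^sup>2 \<le> cc * (S K)\<^sup>2"
      proof -
        have "Ctau * (S K)\<^sup>2 \<ge> 0" using constants by simp
        then show ?thesis using en unfolding cc_def distrib_right[of _ _ "(S K)\<^sup>2"] by linarith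
      qed
      then have "2 * \<delta>\<^sup>2 * (?en K (w K) + Cinv * Ctau\<^sup>2 * (S K)\<^sup>2) \<le> 2 * \<delta>\<^sup>2 * (cc * (S K)\<^sup>2)"
        by (intro mult_left_mono) auto
      also have "\<dots> = (2 * \<delta> * (\<delta> * cc)) * (S K)\<^sup>2" by (simp add: power2_eq_square)
      also have "\<dots> \<le> 1 * (S K)\<^sup>2"
      proof (rule mult_right_mono)
        have "\<delta> * (\<delta> * cc) \<le> 1 * (1 / 40)" using \<delta> cc by (intro mult_mono) auto
        then show "2 * \<delta> * (\<delta> * cc) \<le> 1" by simp
      qed simp
      finally show ?thesis by (simp add: distrib_left)
    qed
    have kv: "?kv K \<ge> 0" using \<kappa> by simp
    have EE: "(3 + 2 * CSUPG) * E K = 3 * N K + 3 * (S K)\<^sup>2 + 2 * (CSUPG * E K)"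
      by (simp add: E_def algebra_simps)
    have SE: "CSUPG * E K \<ge> 0" "(S K)\<^sup>2 \<ge> 0" using N0 constants by (simp_all add: E_def)
    have "N K + R K (u' K) \<le> (3 + 2 * CSUPG) * E K" unfolding EE using RU SE N0 by linarith
    moreover have "?kv K + ?en K (z K) + R K (z K) \<le> (3 + 2 * CSUPG) * E K"
    proof -
      have gen: "kv + ez + rz \<le> 3 * (kv + eu) + 3 * s + 2 * ce"
        if "ru \<le> ce" "0 \<le> s" "0 \<le> kv + eu" "rz \<le> 2 * ru + p" "ez \<le> 2 * eu + q" "q + p \<le> s" "0 \<le> kv"
        for kv ez rz eu s ce ru p q :: real using that by argo
      show ?thesis unfolding EE unfolding N_def by (rule gen[OF RU SE(2) N0[unfolded N_def] RV EV small kv])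
    qed
    ultimately show ?thesis using N0 B by blast
  qed
  define Q where "Q = 3 + 2 * CSUPG"
  have Q: "Q > 0" using constants by (simp add: Q_def)
  let ?E = "\<Sum>K\<in>M. E K"
  have form: "?B (v, z) = (\<Sum>K\<in>M. ?kv K - ?ad K
        + ?ef K (z K))" for z
    by (rule form_B_same_mean[OF m bd vc pv D(1) D0])
  have B: "\<delta> / 2 * ?E \<le> ?B (v, z)"
    unfolding form sum_distrib_left by (rule sum_mono) (use elem in blast)
  have nrm: "?sn (v, y) = sqrt (\<Sum>K\<in>M. ?kv K + ?en K (y K) + R K (y K))" for y
    unfolding R_def by (rule supg_norm_eq[OF m pv])
  have nU: "?sn (v, u') \<le> sqrt (Q * ?E)"
    unfolding nrm Q_def sum_distrib_left N_def[symmetric] by (intro real_sqrt_le_mono sum_mono) (use elem in blast)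
  have nV: "?sn (v, z) \<le> sqrt (Q * ?E)"
    unfolding nrm Q_def sum_distrib_left by (intro real_sqrt_le_mono sum_mono) (use elem in blast)
  have posn: "?sn (v, y) > 0" 
    if y: "y \<in> disc_space et pf M F" "(v, y) \<noteq> ((\<lambda>_. 0), (\<lambda>_ _. 0))" for y
  proof -
    have "0 < (\<Sum>K\<in>M. ?kv K + ?en K (y K))"
      by (rule supg_energy_pos[OF dom cm v y \<kappa> constants(4) hpos \<kappa>a0])
    also have "\<dots> \<le> (\<Sum>K\<in>M. ?kv K + ?en K (y K) + R K (y K))"
      by (rule sum_mono) (simp add: R_def)
    finally show ?thesis unfolding nrm by simp
  qed
  have Epos: "?E > 0"
  proof -
    have "0 < (\<Sum>K\<in>M. N K)"
      unfolding N_def by (rule supg_energy_pos[OF dom cm v u' nz \<kappa> constants(4) hpos \<kappa>a0])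
    also have "\<dots> \<le> ?E" by (rule sum_mono) (simp add: E_def)
    finally show ?thesis .
  qed
  \<comment> \<open>A test function that is zero would make the form vanish, against its positive lower bound.\<close>
  have znz: "(v, z) \<noteq> ((\<lambda>_. 0), (\<lambda>_ _. 0))"
  proof
    assume "(v, z) = ((\<lambda>_. 0), (\<lambda>_ _. 0))"
    then have v0: "v = (\<lambda>_. 0)" and z0: "z = (\<lambda>_ _. 0)" by auto
    have "?kv K - ?ad K
        + ?ef K (z K) = 0" if K: "K \<in> M" for K
    proof -
      have g: "grad K v x = 0" if "x \<in> K" for x
        unfolding v0 by (rule grad_eqI[OF sol[OF K] that]) simp
      have "vol_int K (\<lambda>x. (norm (grad K v x))\<^sup>2) = vol_int K (\<lambda>x. 0)" by (rule vol_int_cong) (simp add: g)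
      moreover have "?ad K = vol_int K (\<lambda>x. 0)" by (rule vol_int_cong) (simp add: g)
      moreover have "?ef K (z K) = 0"
        using elem_form_lincomb[OF sol[OF K] pv[OF K] pu[OF K] poly_on_const[of K 0] poly_on_const[of K 0] ca[OF K],
            of "h K" \<kappa> "\<kappa>art K" Cpen "-1"] by (simp add: z0)
      ultimately show ?thesis by (simp add: seminorm1_sq)
    qed
    then have "?B (v, z) = 0" unfolding form by simp
    moreover have "\<delta> / 2 * ?E > 0" using \<delta>(1) Epos by simp
    ultimately show False using B by linarith
  qed
  have p: "?sn (v, u') > 0" "?sn (v, z) > 0" using posn[OF u' nz] posn[OF zd' znz] by auto
  have "?sn (v, u') * ?sn (v, z) \<le> sqrt (Q * ?E) * sqrt (Q * ?E)" using nU nV p Q Epos by (intro mult_mono) auto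
  also have "\<dots> = Q * ?E" using Q Epos by simp
  finally have "\<delta> / 2 / Q * (?sn (v, u') * ?sn (v, z)) \<le> \<delta> / 2 / Q * (Q * ?E)" using \<delta>(1) Q by (intro mult_left_mono) auto
  also have "\<dots> = \<delta> / 2 * ?E" using Q by simp
  also note B
  finally have "\<delta> / 2 / Q \<le> ?B (v, z) / (?sn (v, u') * ?sn (v, z))"
    using p by (simp add: pos_le_divide_eq)
  then show ?thesis using zd' znz unfolding Q_def by blast
qed

text \<open>
  Reads a bound for pairs of a mean and a discontinuous function as a bound for each function; the
  other member of the pair is then zero.
\<close>

lemma ball_components:
  assumes "\<forall>v\<in>A. \<forall>v'\<in>B. \<forall>K\<in>M. \<forall>w\<in>{v, v' K}. Q K w" "z \<in> A" "z' \<in> B"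
    "K \<in> M" "w \<in> A \<union> (\<lambda>v'. v' K) ` B"
  shows "Q K w"
  using assms by blast

theorem corollary4p3:
  fixes \<Omega> :: "(real^'n) set"
    and et :: element_type
    and p pf :: nat
    and \<sigma> Ctrace Cinv Cpen Cart Ctau CSUPG :: real
  assumes dim: "CARD('n) \<in> {2, 3}"
    and domain: "polytopal_domain \<Omega>"
    and degree: "p \<ge> 1"
    and constants: "\<sigma> > 0" "Ctrace > 0" "Cinv > 0" "Cpen > 0" "Cart \<ge> 0" "Ctau > 0" "CSUPG > 0"
    and penalty: "Cpen \<ge> 8 * Ctrace"
  shows "\<exists>\<beta>>0.
    \<forall>(M :: (real^'n) set set) (F :: (real^'n) set \<Rightarrow> real^'n \<Rightarrow> real^'n) (h :: (real^'n) set \<Rightarrow> real)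
      (a :: real^'n \<Rightarrow> real^'n) (\<kappa> :: real) (\<kappa>art :: (real^'n) set \<Rightarrow> real) (\<tau> :: (real^'n) set \<Rightarrow> real).
    let Vbar = cont_space et p \<Omega> M F; Vdisc = disc_space et pf M F in
      conforming_mesh et \<Omega> M F \<longrightarrow> shape_regular \<sigma> M \<longrightarrow> mesh_size \<sigma> M h \<longrightarrow>
      smooth_up_to_boundary \<Omega> a \<longrightarrow> (\<forall>x\<in>\<Omega>. divg \<Omega> a x = 0) \<longrightarrow>
      \<kappa> > 0 \<longrightarrow>
      (\<forall>K\<in>M. \<tau> K = Ctau * time_scale Cinv a \<kappa> h K) \<longrightarrow>
      (\<forall>K\<in>M. \<kappa>art K = Cart * time_scale Cinv a \<kappa> h K * (norm_inf K a)\<^sup>2) \<longrightarrow>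
      (\<forall>v\<in>Vbar. \<forall>v'\<in>Vdisc. \<forall>K\<in>M. \<forall>w\<in>{v, v' K}.
         (norm0_bdry K (\<lambda>n. w))\<^sup>2 \<le> Ctrace / h K * (norm0 K w)\<^sup>2 \<and>
         (norm0_bdry K (\<lambda>n x. grad K w x \<bullet> n))\<^sup>2 \<le> Ctrace / h K * (seminorm1 K w)\<^sup>2) \<longrightarrow>
      (\<forall>v\<in>Vbar. \<forall>v'\<in>Vdisc. \<forall>K\<in>M. \<forall>w\<in>{v, v' K}.
         (seminorm1 K w)\<^sup>2 \<le> Cinv / (h K)\<^sup>2 * (norm0 K w)\<^sup>2 \<and>
         (norm0 K (laplacian K w))\<^sup>2 \<le> Cinv / (h K)\<^sup>2 * (seminorm1 K w)\<^sup>2) \<longrightarrow>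
      (\<forall>v\<in>Vbar. \<forall>v'\<in>Vdisc. \<forall>K\<in>M.
         (norm0 K (\<lambda>x. sqrt (\<tau> K) * (a x \<bullet> grad K (\<lambda>y. v y + v' K y) x)))\<^sup>2
         \<le> CSUPG * (\<kappa>art K * (seminorm1 K (v' K))\<^sup>2
             + (norm0 K (\<lambda>x. sqrt (\<tau> K) *
                  l2_projector K (local_polys et pf (F K))
                    (\<lambda>z. a z \<bullet> grad K (\<lambda>y. v y + v' K y) z) x))\<^sup>2)) \<longrightarrow>
      (INF U\<in>Vbar \<times> Vdisc - {(\<lambda>_. 0, \<lambda>_ _. 0)}.
         SUP V\<in>Vbar \<times> Vdisc - {(\<lambda>_. 0, \<lambda>_ _. 0)}.
           ereal (form_B \<Omega> M h a \<kappa> \<kappa>art Cpen U V /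
                  (supg_norm \<Omega> M h a \<kappa> \<kappa>art Cpen \<tau> U * supg_norm \<Omega> M h a \<kappa> \<kappa>art Cpen \<tau> V)))
      \<ge> ereal \<beta>"
proof -
  define cc where "cc = Ctau + (Ctau + Cart * Ctau * Cinv) + Cpen * Ctrace * Ctau / Cinv + Ctrace * Ctau + Cinv * Ctau\<^sup>2"
  define \<beta> where "\<beta> = 1 / (40 * (cc + 1)) / 2 / (3 + 2 * CSUPG)"
  have "cc \<ge> 0" unfolding cc_def using constants by (intro add_nonneg_nonneg) auto
  then have "\<beta> > 0" unfolding \<beta>_def using constants by simp
  then show ?thesis
  proof (intro exI[of _ \<beta>] conjI allI, assumption, unfold Let_def, intro impI INF_greatest)
    fix M F h a \<kappa> \<kappa>art \<tau> U
    let ?Vbar = "cont_space et p \<Omega> M F" and ?Vdisc = "disc_space et pf M F"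
    assume cm: "conforming_mesh et \<Omega> M F" and ms: "mesh_size \<sigma> M h"
      and sm: "smooth_up_to_boundary \<Omega> a" and df: "\<forall>x\<in>\<Omega>. divg \<Omega> a x = 0" and \<kappa>: "\<kappa> > 0"
      and \<tau>: "\<forall>K\<in>M. \<tau> K = Ctau * time_scale Cinv a \<kappa> h K"
      and \<kappa>art: "\<forall>K\<in>M. \<kappa>art K = Cart * time_scale Cinv a \<kappa> h K * (norm_inf K a)\<^sup>2"
      and tr: "\<forall>v\<in>?Vbar. \<forall>v'\<in>?Vdisc. \<forall>K\<in>M. \<forall>w\<in>{v, v' K}.
         (norm0_bdry K (\<lambda>n. w))\<^sup>2 \<le> Ctrace / h K * (norm0 K w)\<^sup>2 \<and>
         (norm0_bdry K (\<lambda>n x. grad K w x \<bullet> n))\<^sup>2 \<le> Ctrace / h K * (seminorm1 K w)\<^sup>2"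
      and inv: "\<forall>v\<in>?Vbar. \<forall>v'\<in>?Vdisc. \<forall>K\<in>M. \<forall>w\<in>{v, v' K}.
         (seminorm1 K w)\<^sup>2 \<le> Cinv / (h K)\<^sup>2 * (norm0 K w)\<^sup>2 \<and>
         (norm0 K (laplacian K w))\<^sup>2 \<le> Cinv / (h K)\<^sup>2 * (seminorm1 K w)\<^sup>2"
      and sg: "\<forall>v\<in>?Vbar. \<forall>v'\<in>?Vdisc. \<forall>K\<in>M.
         (norm0 K (\<lambda>x. sqrt (\<tau> K) * (a x \<bullet> grad K (\<lambda>y. v y + v' K y) x)))\<^sup>2
         \<le> CSUPG * (\<kappa>art K * (seminorm1 K (v' K))\<^sup>2
             + (norm0 K (\<lambda>x. sqrt (\<tau> K) *
                  l2_projector K (local_polys et pf (F K))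
                    (\<lambda>z. a z \<bullet> grad K (\<lambda>y. v y + v' K y) z) x))\<^sup>2)"
      and U: "U \<in> ?Vbar \<times> ?Vdisc - {(\<lambda>_. 0, \<lambda>_ _. 0)}"
    obtain v u' where vu: "U = (v, u')" "v \<in> ?Vbar" "u' \<in> ?Vdisc" "(v, u') \<noteq> ((\<lambda>_. 0), (\<lambda>_ _. 0))"
      using U by (cases U) auto
    note zero = cont_space_zero[OF cm, of p] disc_space_zero[OF cm, of pf]
    note tr' = ball_components[OF tr zero] and inv' = ball_components[OF inv zero]
    have "\<exists>z\<in>?Vdisc. (v, z) \<noteq> ((\<lambda>_. 0), (\<lambda>_ _. 0)) \<and>
        \<beta> \<le> form_B \<Omega> M h a \<kappa> \<kappa>art Cpen (v, u') (v, z) /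
        (supg_norm \<Omega> M h a \<kappa> \<kappa>art Cpen \<tau> (v, u') * supg_norm \<Omega> M h a \<kappa> \<kappa>art Cpen \<tau> (v, z))"
      unfolding \<beta>_def cc_def
      by (rule supg_inf_sup_witness[where \<tau> = \<tau> and \<kappa>art = \<kappa>art and h = h and F = F and a = a and M = M
            and et = et and p = p and pf = pf and v = v and u' = u' and \<kappa> = \<kappa> and \<Omega> = \<Omega> and \<sigma> = \<sigma>
            and Ctrace = Ctrace and Cinv = Cinv and Cpen = Cpen and Cart = Cart and Ctau = Ctau and CSUPG = CSUPG,
            OF domain constants penalty cm ms sm _ \<kappa> _ _ _ _ _ vu(2,3,4)])
         (erule df[rule_format], erule \<tau>[rule_format], erule \<kappa>art[rule_format],
          (rule tr'; assumption), (rule inv'; assumption), erule (2) sg[rule_format])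
    then obtain z where z: "z \<in> ?Vdisc" "(v, z) \<noteq> ((\<lambda>_. 0), (\<lambda>_ _. 0))"
      "\<beta> \<le> form_B \<Omega> M h a \<kappa> \<kappa>art Cpen (v, u') (v, z) /
        (supg_norm \<Omega> M h a \<kappa> \<kappa>art Cpen \<tau> (v, u') * supg_norm \<Omega> M h a \<kappa> \<kappa>art Cpen \<tau> (v, z))" by blast
    show "ereal \<beta> \<le> (SUP V\<in>?Vbar \<times> ?Vdisc - {(\<lambda>_. 0, \<lambda>_ _. 0)}.
           ereal (form_B \<Omega> M h a \<kappa> \<kappa>art Cpen U V /
                  (supg_norm \<Omega> M h a \<kappa> \<kappa>art Cpen \<tau> U * supg_norm \<Omega> M h a \<kappa> \<kappa>art Cpen \<tau> V)))"
    proof (rule SUP_upper2)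
      show "(v, z) \<in> ?Vbar \<times> ?Vdisc - {(\<lambda>_. 0, \<lambda>_ _. 0)}" using vu z by simp
      show "ereal \<beta> \<le> ereal (form_B \<Omega> M h a \<kappa> \<kappa>art Cpen U (v, z) /
                  (supg_norm \<Omega> M h a \<kappa> \<kappa>art Cpen \<tau> U * supg_norm \<Omega> M h a \<kappa> \<kappa>art Cpen \<tau> (v, z)))"
        using z(3) vu(1) by simp
    qed
  qed
qed

end
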